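(* Let $\alpha\in(1,\infty)$ and let $B:\mathbb R\setminus\{0\}\to\mathbb R$ be an even function that is positive, decreasing and convex on $(0,\infty)$ and satisfies, for some $\varepsilon>0$, $B(t)=\dfrac1{t\ln^\alpha(1/t)}$ for all $t\in(0,\varepsilon)$. Let $T\in(0,\infty)$, let $G_{0,T}$ be the completion of $L_2(0,T)$ with respect to $\langle f,g\rangle=\iint f(s)g(t)B(s-t)\,ds\,dt$, regarded as an FHS-space, and let $$X_k(t)=\mathbf 1_{(0,T)}(t)\exp(2\pi i k t/T),\qquad k\in\mathbb Z.$$ Then there is an admissible norm on the FHS-space $G_{0,T}$ with respect to which the vectors $X_k$, $k\in\mathbb Z$, are (pairwise) orthogonal.
   Context: "Positive" and "decreasing" are understood in the weak sense; under the hypotheses the scalar product is well defined and positive definite. Two norms $\|\cdot\|_1,\|\cdot\|_2$ on a real linear space $H$, each turning $H$ into a separable Hilbert space, are FHS-equivalent if they define the same topology and there is a (finite or countable) sequence $(e_k)$ that is an orthogonal basis for both norms with $\sum_k(\lambda_k-1)^2<\infty$, where $\lambda_k=\|e_k\|_2/\|e_k\|_1$. An FHS-space is a linear space with a full FHS-equivalence class of such norms, called admissible norms. Admissible norms on $G_{0,T}$ are those FHS-equivalent to its Hilbert norm. The functions $X_k$ are complex-valued, so they are elements of the complexification of the (real) space $G_{0,T}$; the scalar product of each admissible norm is extended to the complexification as a Hermitian scalar product, and orthogonality of the $X_k$ refers to this extension. *)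

theory Defs
  imports "HOL-Analysis.Analysis"
begin

section \<open>Norms of separable Hilbert spaces on a fixed real linear space\<close>

definition is_inner_product :: "('h::real_vector \<Rightarrow> 'h \<Rightarrow> real) \<Rightarrow> bool" where
  "is_inner_product ip \<longleftrightarrow>
     (\<forall>x y. ip x y = ip y x) \<and>
     (\<forall>x y z. ip (x + y) z = ip x z + ip y z) \<and>
     (\<forall>c x y. ip (c *\<^sub>R x) y = c * ip x y) \<and>
     (\<forall>x. x \<noteq> 0 \<longrightarrow> 0 < ip x x)"

definition norm_dist :: "('h::real_vector \<Rightarrow> real) \<Rightarrow> 'h \<Rightarrow> 'h \<Rightarrow> real" where
  "norm_dist N x y = N (x - y)"

abbreviation norm_topology :: "('h::real_vector \<Rightarrow> real) \<Rightarrow> 'h topology" where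
  "norm_topology N \<equiv> Metric_space.mtopology UNIV (norm_dist N)"

definition separable_hilbert_norm :: "('h::real_vector \<Rightarrow> real) \<Rightarrow> bool" where
  "separable_hilbert_norm N \<longleftrightarrow>
     (\<exists>ip. is_inner_product ip \<and> (\<forall>x. N x = sqrt (ip x x))) \<and>
     Metric_space.mcomplete UNIV (norm_dist N) \<and>
     separable_space (norm_topology N)"

text \<open>The scalar product of a Hilbert norm, recovered from the norm by polarization.\<close>

definition norm_scalar_product :: "('h::real_vector \<Rightarrow> real) \<Rightarrow> 'h \<Rightarrow> 'h \<Rightarrow> real" where
  "norm_scalar_product N x y = ((N (x + y))\<^sup>2 - (N (x - y))\<^sup>2) / 4"

lemma norm_scalar_product_unique:
  assumes ip: "is_inner_product ip" and N: "\<forall>x. N x = sqrt (ip x x)"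
  shows "norm_scalar_product N = ip"
proof (intro ext)
  fix x y
  have sym: "ip u v = ip v u" and add: "ip (u + v) w = ip u w + ip v w"
    and scale: "ip (c *\<^sub>R u) v = c * ip u v" for u v w c
    using ip unfolding is_inner_product_def by blast+
  have add': "ip w (u + v) = ip w u + ip w v" for u v w
    using sym add by metis
  have neg: "ip (- u) v = - ip u v" for u v
    using scale[of "-1" u v] by simp
  have neg': "ip v (- u) = - ip v u" for u v
    using sym neg by metis
  have "ip 0 0 = 0"
    using scale[of 0 0 0] by simp
  then have "0 \<le> ip u u" for u
    using ip unfolding is_inner_product_def by (cases "u = 0") (auto intro: less_imp_le)
  then have sq: "(N u)\<^sup>2 = ip u u" for u
    by (simp add: N)
  have "ip (x - y) (x - y) = ip x x - 2 * ip x y + ip y y"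
    using add[of x "- y" "x - y"] add'[of x x "- y"] add'[of y x "- y"] sym[of y x]
    by (simp add: neg neg')
  moreover have "ip (x + y) (x + y) = ip x x + 2 * ip x y + ip y y"
    using sym[of y x] by (simp add: add add')
  ultimately show "norm_scalar_product N x y = ip x y"
    unfolding norm_scalar_product_def sq by simp
qed


section \<open>FHS-equivalence\<close>

text \<open>A finite or countable sequence is a family indexed by some set of natural numbers.
  ``Basis'' is understood in the Hilbert space sense: the linear span is dense.\<close>

definition orthogonal_basis :: "('h::real_vector \<Rightarrow> real) \<Rightarrow> nat set \<Rightarrow> (nat \<Rightarrow> 'h) \<Rightarrow> bool" where
  "orthogonal_basis N K e \<longleftrightarrow>
     (\<forall>k\<in>K. e k \<noteq> 0) \<and>
     (\<forall>j\<in>K. \<forall>k\<in>K. j \<noteq> k \<longrightarrow> norm_scalar_product N (e j) (e k) = 0) \<and>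
     norm_topology N closure_of span (e ` K) = UNIV"

definition FHS_equivalent :: "('h::real_vector \<Rightarrow> real) \<Rightarrow> ('h \<Rightarrow> real) \<Rightarrow> bool" where
  "FHS_equivalent N\<^sub>1 N\<^sub>2 \<longleftrightarrow>
     separable_hilbert_norm N\<^sub>1 \<and> separable_hilbert_norm N\<^sub>2 \<and>
     norm_topology N\<^sub>1 = norm_topology N\<^sub>2 \<and>
     (\<exists>K e. orthogonal_basis N\<^sub>1 K e \<and> orthogonal_basis N\<^sub>2 K e \<and>
        (\<lambda>k. (N\<^sub>2 (e k) / N\<^sub>1 (e k) - 1)\<^sup>2) summable_on K)"

text \<open>A Hilbert space is regarded as an FHS-space by means of the FHS-equivalence class of its
  own norm.\<close>

definition admissible_norms :: "('h::real_inner \<Rightarrow> real) set" where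
  "admissible_norms = {N. FHS_equivalent norm N}"


section \<open>Complexification\<close>

text \<open>The pair \<open>(u, v)\<close> stands for the element \<open>u + \<i> v\<close> of the complexification. The
  extended scalar product is linear in the first and antilinear in the second argument.\<close>

definition hermitian_extension ::
    "('h \<Rightarrow> 'h \<Rightarrow> real) \<Rightarrow> 'h \<times> 'h \<Rightarrow> 'h \<times> 'h \<Rightarrow> complex" where
  "hermitian_extension ip z w =
     Complex (ip (fst z) (fst w) + ip (snd z) (snd w))
             (ip (snd z) (fst w) - ip (fst z) (snd w))"

definition complexify :: "((real \<Rightarrow> real) \<Rightarrow> 'h) \<Rightarrow> (real \<Rightarrow> complex) \<Rightarrow> 'h \<times> 'h" where
  "complexify J f = (J (\<lambda>t. Re (f t)), J (\<lambda>t. Im (f t)))"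


section \<open>The space $G_{0,T}$\<close>

text \<open>Real-valued square integrable functions on \<open>(0,T)\<close>; they are not quotiented by
  almost everywhere equality, and their values outside \<open>(0,T)\<close> are irrelevant.\<close>

definition L2_functions :: "real \<Rightarrow> (real \<Rightarrow> real) set" where
  "L2_functions T =
     {f. set_borel_measurable lborel {0<..<T} f \<and> set_integrable lborel {0<..<T} (\<lambda>t. (f t)\<^sup>2)}"

definition B_form :: "(real \<Rightarrow> real) \<Rightarrow> real \<Rightarrow> (real \<Rightarrow> real) \<Rightarrow> (real \<Rightarrow> real) \<Rightarrow> real" where
  "B_form B T f g =
     (LINT p:{0<..<T} \<times> {0<..<T}|(lborel \<Otimes>\<^sub>M lborel). f (fst p) * g (snd p) * B (fst p - snd p))"

text \<open>The Hilbert space \<^typ>\<open>'h\<close> together with \<open>J\<close> is a completion of $L_2(0,T)$ with respect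
  to the form: \<open>J\<close> is linear, preserves scalar products and has dense range. This determines
  \<^typ>\<open>'h\<close> and \<open>J\<close> up to a unique isometric isomorphism, and it makes \<open>J\<close> insensitive to changes
  on null sets.\<close>

definition is_G :: "(real \<Rightarrow> real) \<Rightarrow> real \<Rightarrow> ((real \<Rightarrow> real) \<Rightarrow> 'h::{real_inner, complete_space}) \<Rightarrow> bool"
  where
  "is_G B T J \<longleftrightarrow>
     (\<forall>f\<in>L2_functions T. \<forall>g\<in>L2_functions T. J (\<lambda>t. f t + g t) = J f + J g) \<and>
     (\<forall>c. \<forall>f\<in>L2_functions T. J (\<lambda>t. c * f t) = c *\<^sub>R J f) \<and>
     (\<forall>f\<in>L2_functions T. \<forall>g\<in>L2_functions T. inner (J f) (J g) = B_form B T f g) \<and>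
     closure (J ` L2_functions T) = UNIV"

definition X :: "real \<Rightarrow> int \<Rightarrow> real \<Rightarrow> complex" where
  "X T k t = indicator {0<..<T} t * exp (2 * of_real pi * \<i> * of_int k * of_real t / of_real T)"

end

theory Submission
  imports Defs
begin

text \<open>On \<open>(- T, T)\<close> the kernel coincides with an even \<open>2T\<close>-periodic function that is convex on
  \<open>(0, 2T)\<close>; its cosine coefficients are nonnegative and bounded below by a multiple of
  \<open>(ln k)\<close> to the power \<open>1 - \<alpha>\<close>. Hence the Fourier coefficients on \<open>(0, T)\<close> extend to bounded
  functionals on the completion. The off-diagonal entries of the Gram matrix of the trigonometric
  system are divided differences of the sine integrals of \<open>B\<close> over \<open>(0, T)\<close>, which are of order
  \<open>(ln k)\<close> to the power \<open>- \<alpha>\<close>. After a normalization that is common to the cosine and the sine of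
  the same frequency, the Gram matrix therefore differs from the identity by a Hilbert-Schmidt
  matrix. Let \<open>U\<close> map an orthonormal basis to the normalized system: \<open>U* U - 1\<close> is a
  Hilbert-Schmidt operator and \<open>U\<close> is injective by the boundedness of the coefficient functionals,
  so \<open>U\<close> is invertible and transports the norm to an admissible norm for which the system is
  orthonormal; the basis common to both norms diagonalizes \<open>U U*\<close>.\<close>

text \<open>The period is \<open>2T\<close> because the form sees all differences in
  \<open>(- T, T)\<close>: a \<open>T\<close>-periodic kernel would have to be singular at
  \<open>T\<close> too, whereas reflecting \<open>B\<close> at \<open>T\<close> keeps convexity,
  since \<open>B\<close> is decreasing. The price is that the system of period \<open>T\<close> is
  not orthogonal for the form and has to be compared with an orthonormal one. The comparison works
  because of a gap of one logarithm: squared norms decay no faster than \<open>(ln k)\<close> to the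
  power \<open>1 - \<alpha>\<close>, the sine integrals gain one further factor. After normalization
  the squared off-diagonal entries, summed over \<open>k \<le> j\<close>, leave
  \<open>1 / (j ln^2 j)\<close>, which converges for every \<alpha> > 1. Close to the diagonal the
  denominators of the divided differences are small and size bounds do not suffice; increments of
  the sine integrals are bounded by differentiating in the frequency. One normalization for cosine
  and sine is forced by the exponentials: \<open>X T k\<close> and \<open>X T (- k)\<close> are
  orthogonal only if real and imaginary part have equal norms, so orthogonality of the real system
  alone is not enough.\<close>

section \<open>Orthonormal families and operators given by series\<close>

text \<open>The bound on finite sums applies to blocks of the series, so square summability of the
  coefficients gives the Cauchy property. It is applied with \<open>C = 1\<close> to orthonormal
  families and with \<open>C = 1 + sqrt M\<close> to the nearly orthonormal one.\<close>

lemma square_summable_scaleR: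
  fixes x :: "nat \<Rightarrow> 'h::{real_inner, complete_space}"
  assumes bound: "\<And>F c. finite F \<Longrightarrow> (norm (\<Sum>i\<in>F. c i *\<^sub>R x i))\<^sup>2 \<le> C * (\<Sum>i\<in>F. (c i)\<^sup>2)"
    and c: "summable (\<lambda>i. (c i)\<^sup>2)"
  shows "summable (\<lambda>i. c i *\<^sub>R x i)" "(norm (\<Sum>i. c i *\<^sub>R x i))\<^sup>2 \<le> C * (\<Sum>i. (c i)\<^sup>2)"
proof -
  have C: "0 \<le> C"
    using bound[of "{0}" "\<lambda>_. 1"] by (simp add: order_trans[OF zero_le_power2])
  have "Cauchy (\<lambda>n. \<Sum>i<n. c i *\<^sub>R x i)"
  proof (rule metric_CauchyI)
    fix e :: real assume e: "0 < e"
    \<comment> \<open>\<open>C + 1\<close> in place of \<open>C\<close> keeps the denominator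
      positive when \<open>C = 0\<close>.\<close>
    have "0 < e\<^sup>2 / (C + 1)" using e C by simp
    then obtain N where N: "\<And>m n. N \<le> m \<Longrightarrow> norm (\<Sum>i=m..<n. (c i)\<^sup>2) < e\<^sup>2 / (C + 1)"
      using c unfolding summable_Cauchy by blast
    have *: "dist (\<Sum>i<m. c i *\<^sub>R x i) (\<Sum>i<n. c i *\<^sub>R x i) < e" if "N \<le> m" "m \<le> n" for m n
    proof -
      have "(\<Sum>i<n. c i *\<^sub>R x i) - (\<Sum>i<m. c i *\<^sub>R x i) = (\<Sum>i=m..<n. c i *\<^sub>R x i)"
        using that by (simp add: sum_diff_nat_ivl lessThan_atLeast0)
      then have "(dist (\<Sum>i<m. c i *\<^sub>R x i) (\<Sum>i<n. c i *\<^sub>R x i))\<^sup>2 = (norm (\<Sum>i=m..<n. c i *\<^sub>R x i))\<^sup>2"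
        by (metis dist_norm dist_commute)
      also have "\<dots> \<le> C * (\<Sum>i=m..<n. (c i)\<^sup>2)"
        by (rule bound) simp
      also have "\<dots> \<le> (C + 1) * (\<Sum>i=m..<n. (c i)\<^sup>2)"
        by (intro mult_right_mono sum_nonneg) auto
      also have "\<dots> < e\<^sup>2"
        using N[OF that(1), of n] C by (simp add: field_simps sum_nonneg)
      finally show ?thesis
        using e power2_less_imp_less by fastforce
    qed
    have "dist (\<Sum>i<m. c i *\<^sub>R x i) (\<Sum>i<n. c i *\<^sub>R x i) < e" if "N \<le> m" "N \<le> n" for m n
      using *[of m n] *[of n m] that by (cases "m \<le> n") (auto simp: dist_commute)
    then show "\<exists>M. \<forall>m\<ge>M. \<forall>n\<ge>M. dist (\<Sum>i<m. c i *\<^sub>R x i) (\<Sum>i<n. c i *\<^sub>R x i) < e"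
      by blast
  qed
  then show s: "summable (\<lambda>i. c i *\<^sub>R x i)"
    by (simp add: summable_iff_convergent Cauchy_convergent)
  have "(\<lambda>n. (norm (\<Sum>i<n. c i *\<^sub>R x i))\<^sup>2) \<longlonglongrightarrow> (norm (\<Sum>i. c i *\<^sub>R x i))\<^sup>2"
    by (intro tendsto_intros summable_LIMSEQ s)
  moreover have "(\<lambda>n. C * (\<Sum>i<n. (c i)\<^sup>2)) \<longlonglongrightarrow> C * (\<Sum>i. (c i)\<^sup>2)"
    by (intro tendsto_intros summable_LIMSEQ c)
  ultimately show "(norm (\<Sum>i. c i *\<^sub>R x i))\<^sup>2 \<le> C * (\<Sum>i. (c i)\<^sup>2)"
    by (rule LIMSEQ_le) (auto intro!: bound)
qed

text \<open>Common source of two operators: with \<open>w\<close> orthonormal it synthesizes vectors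
  along \<open>x\<close> from coordinates, with \<open>x\<close> orthonormal it is the operator
  whose matrix rows are the \<open>w i\<close>.\<close>

lemma series_operator:
  fixes x :: "nat \<Rightarrow> 'h::{real_inner, complete_space}" and w :: "nat \<Rightarrow> 'a::real_inner"
  assumes bound: "\<And>F c. finite F \<Longrightarrow> (norm (\<Sum>i\<in>F. c i *\<^sub>R x i))\<^sup>2 \<le> C * (\<Sum>i\<in>F. (c i)\<^sup>2)"
    and D: "\<And>n y. (\<Sum>i<n. (inner y (w i))\<^sup>2) \<le> D * (norm y)\<^sup>2"
  shows "(\<lambda>i. inner y (w i) *\<^sub>R x i) sums (\<Sum>i. inner y (w i) *\<^sub>R x i)"
    and "bounded_linear (\<lambda>y. \<Sum>i. inner y (w i) *\<^sub>R x i)"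
proof -
  have C: "0 \<le> C"
    using bound[of "{0}" "\<lambda>_. 1"] by (simp add: order_trans[OF zero_le_power2])
  have s: "summable (\<lambda>i. (inner y (w i))\<^sup>2)" for y
    by (rule summableI_nonneg_bounded[OF _ D]) simp
  have s': "(\<lambda>i. inner y (w i) *\<^sub>R x i) sums (\<Sum>i. inner y (w i) *\<^sub>R x i)" for y
    using square_summable_scaleR(1)[OF bound s] summable_sums by blast
  then show "(\<lambda>i. inner y (w i) *\<^sub>R x i) sums (\<Sum>i. inner y (w i) *\<^sub>R x i)" .
  have b: "norm (\<Sum>i. inner y (w i) *\<^sub>R x i) \<le> norm y * sqrt (C * D)" for y
  proof -
    have "(norm (\<Sum>i. inner y (w i) *\<^sub>R x i))\<^sup>2 \<le> C * (\<Sum>i. (inner y (w i))\<^sup>2)"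
      by (rule square_summable_scaleR(2)[OF bound s])
    also have "\<dots> \<le> C * (D * (norm y)\<^sup>2)"
      by (intro mult_left_mono suminf_le_const s D C)
    finally have "norm (\<Sum>i. inner y (w i) *\<^sub>R x i) \<le> sqrt (C * D * (norm y)\<^sup>2)"
      by (simp add: real_le_rsqrt mult.assoc)
    then show ?thesis by (simp add: real_sqrt_mult mult_ac)
  qed
  show "bounded_linear (\<lambda>y. \<Sum>i. inner y (w i) *\<^sub>R x i)"
  proof (rule bounded_linear_intro)
    fix y z :: 'a and r :: real
    show "(\<Sum>i. inner (y + z) (w i) *\<^sub>R x i) = (\<Sum>i. inner y (w i) *\<^sub>R x i) + (\<Sum>i. inner z (w i) *\<^sub>R x i)"
      using sums_add[OF s'[of y] s'[of z]] s'[of "y + z"]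
      by (simp add: inner_add_left scaleR_add_left sums_unique2)
    show "(\<Sum>i. inner (r *\<^sub>R y) (w i) *\<^sub>R x i) = r *\<^sub>R (\<Sum>i. inner y (w i) *\<^sub>R x i)"
      using sums_scaleR_right[OF s'[of y], of r] s'[of "r *\<^sub>R y"]
      by (simp add: sums_unique2)
  qed (rule b)
qed

lemma norm_sum_orthonormal:
  fixes e :: "'i \<Rightarrow> 'h::real_inner"
  assumes "finite F" and o: "\<And>i j. i \<in> F \<Longrightarrow> j \<in> F \<Longrightarrow> inner (e i) (e j) = of_bool (i = j)"
  shows "(norm (\<Sum>i\<in>F. c i *\<^sub>R e i))\<^sup>2 = (\<Sum>i\<in>F. (c i)\<^sup>2)"
proof -
  have "(norm (\<Sum>i\<in>F. c i *\<^sub>R e i))\<^sup>2 = (\<Sum>i\<in>F. \<Sum>j\<in>F. c i * (c j * inner (e i) (e j)))"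
    unfolding power2_norm_eq_inner inner_sum_left inner_sum_right
    by (simp add: inner_commute mult_ac)
  also have "\<dots> = (\<Sum>i\<in>F. \<Sum>j\<in>F. if i = j then (c i)\<^sup>2 else 0)"
    by (intro sum.cong refl) (simp add: o power2_eq_square)
  also have "\<dots> = (\<Sum>i\<in>F. (c i)\<^sup>2)"
    using \<open>finite F\<close> by simp
  finally show ?thesis .
qed

lemma Bessel_inequality:
  fixes e :: "'i \<Rightarrow> 'h::real_inner"
  assumes "finite F" and o: "\<And>i j. i \<in> F \<Longrightarrow> j \<in> F \<Longrightarrow> inner (e i) (e j) = of_bool (i = j)"
  shows "(\<Sum>i\<in>F. (inner y (e i))\<^sup>2) \<le> (norm y)\<^sup>2"
proof -
  let ?p = "\<Sum>i\<in>F. inner y (e i) *\<^sub>R e i"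
  have "inner y ?p = (\<Sum>i\<in>F. (inner y (e i))\<^sup>2)"
    by (simp add: inner_sum_right power2_eq_square)
  moreover have "(norm ?p)\<^sup>2 = (\<Sum>i\<in>F. (inner y (e i))\<^sup>2)"
    by (rule norm_sum_orthonormal[OF assms])
  moreover have "0 \<le> (norm (y - ?p))\<^sup>2" by simp
  ultimately show ?thesis
    by (simp add: power2_norm_eq_inner inner_diff_left inner_diff_right inner_commute)
qed

lemma orthogonal_to_dense_eq_0:
  fixes y :: "'h::real_inner"
  assumes "closure (span A) = UNIV" and "\<And>a. a \<in> A \<Longrightarrow> inner y a = 0"
  shows "y = 0"
proof -
  have "span A \<subseteq> {x. inner y x = 0}"
    by (rule span_minimal) (auto simp: assms subspace_def inner_add_right)
  moreover have "closed {x. inner y x = 0}"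
    by (intro closed_Collect_eq continuous_intros)
  ultimately have "closure (span A) \<subseteq> {x. inner y x = 0}"
    by (rule closure_minimal)
  then have "y \<in> {x. inner y x = 0}" using assms(1) by blast
  then show ?thesis by simp
qed

text \<open>Density is exploited in one argument at a time. The lemma later identifies
  \<open>inner (U y) (U z)\<close> with \<open>inner (y + K y) z\<close>, which replaces speaking of
  the adjoint of \<open>U\<close>.\<close>

lemma bounded_bilinear_eq_on_dense:
  fixes p q :: "'a::real_normed_vector \<Rightarrow> 'a \<Rightarrow> 'b::real_normed_vector"
  assumes "bounded_bilinear p" "bounded_bilinear q" and dense: "closure (span A) = UNIV"
    and eq: "\<And>a b. a \<in> A \<Longrightarrow> b \<in> A \<Longrightarrow> p a b = q a b"
  shows "p x y = q x y"
proof -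
  interpret p: bounded_bilinear p by fact
  interpret q: bounded_bilinear q by fact
  have *: "{y. p x y = q x y} = UNIV" if "\<And>b. b \<in> A \<Longrightarrow> p x b = q x b" for x
  proof -
    have "span A \<subseteq> {y. p x y = q x y}"
      by (rule span_minimal)
        (auto simp: that subspace_def p.zero_right q.zero_right p.add_right q.add_right
          p.scaleR_right q.scaleR_right)
    moreover have "closed {y. p x y = q x y}"
      by (intro closed_Collect_eq p.continuous_on q.continuous_on continuous_intros)
    ultimately show ?thesis
      using closure_minimal dense by (metis top.extremum_uniqueI)
  qed
  have "span A \<subseteq> {x. p x y = q x y}"
    by (rule span_minimal)
      (use * eq in \<open>auto simp: subspace_def p.zero_left q.zero_left p.add_left q.add_left
          p.scaleR_left q.scaleR_left\<close>)
  moreover have "closed {x. p x y = q x y}"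
    by (intro closed_Collect_eq p.continuous_on q.continuous_on continuous_intros)
  ultimately have "closure (span A) \<subseteq> {x. p x y = q x y}"
    by (rule closure_minimal)
  then show ?thesis using dense by auto
qed

text \<open>\<open>sgn\<close> normalizes and sends 0 to 0, so the recursion is total; that no step
  produces 0 is a consequence of independence.\<close>

fun gram_schmidt :: "(nat \<Rightarrow> 'h::real_inner) \<Rightarrow> nat \<Rightarrow> 'h" where
  "gram_schmidt x n =
     sgn (x n - (\<Sum>i<n. inner (x n) (gram_schmidt x i) *\<^sub>R gram_schmidt x i))"

declare gram_schmidt.simps [simp del]

lemma gram_schmidt:
  fixes x :: "nat \<Rightarrow> 'h::real_inner"
  assumes ind: "\<And>n. x n \<notin> span (x ` {..<n})"
  defines "u \<equiv> gram_schmidt x"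
  shows "inner (u i) (u j) = of_bool (i = j)" and "span (u ` {..<n}) = span (x ` {..<n})"
proof -
  have main: "span (u ` {..<n}) = span (x ` {..<n}) \<and>
    (\<forall>i<n. \<forall>j<n. inner (u i) (u j) = of_bool (i = j))" for n
  proof (induction n)
    case (Suc n)
    define p where "p = (\<Sum>i<n. inner (x n) (u i) *\<^sub>R u i)"
    define y where "y = x n - p"
    have un: "u n = sgn y"
      unfolding u_def y_def p_def by (subst gram_schmidt.simps) simp
    have p: "p \<in> span (u ` {..<n})"
      unfolding p_def by (intro span_sum span_scale span_base) auto
    \<comment> \<open>Otherwise \<open>x n = p\<close> would lie in the span of the earlier
      vectors.\<close>
    have "y \<noteq> 0"
      using p ind[of n] Suc by (auto simp: y_def)
    have xn: "x n = norm y *\<^sub>R u n + p"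
      using \<open>y \<noteq> 0\<close> by (simp add: un sgn_div_norm y_def)
    have un': "u n = (1 / norm y) *\<^sub>R (x n - p)"
      using \<open>y \<noteq> 0\<close> by (simp add: un sgn_div_norm y_def inverse_eq_divide)
    have mono: "span (u ` {..<n}) \<subseteq> span (u ` {..<Suc n})" "span (x ` {..<n}) \<subseteq> span (x ` {..<Suc n})"
      by (intro span_mono; auto)+
    have "x n \<in> span (u ` {..<Suc n})"
      unfolding xn by (intro span_add span_scale) (use p mono in \<open>auto intro: span_base\<close>)
    moreover have "u n \<in> span (x ` {..<Suc n})"
      unfolding un' by (intro span_scale span_diff) (use p mono Suc in \<open>auto intro: span_base\<close>)
    ultimately have "span (u ` {..<Suc n}) = span (x ` {..<Suc n})"
      using mono Suc span_superset[of "u ` {..<n}"] span_superset[of "x ` {..<n}"]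
      by (intro span_subspace[symmetric] subset_antisym span_minimal subspace_span)
        (auto simp: lessThan_Suc intro: span_base)
    moreover have yu: "inner y (u j) = 0" if "j < n" for j
    proof -
      have "inner p (u j) = (\<Sum>i<n. if i = j then inner (x n) (u j) else 0)"
        unfolding p_def inner_sum_left using that Suc by (intro sum.cong refl) auto
      also have "\<dots> = inner (x n) (u j)" using that by simp
      finally show ?thesis by (simp add: y_def inner_diff_left)
    qed
    moreover have "inner (u n) (u n) = 1"
      using \<open>y \<noteq> 0\<close> by (simp add: un norm_sgn flip: power2_norm_eq_inner)
    moreover have "inner (u n) (u j) = 0" if "j < n" for j
      using yu[OF that] by (simp add: un sgn_div_norm)
    ultimately show ?case
      using Suc by (auto simp: less_Suc_eq inner_commute)
  qed auto
  show "span (u ` {..<n}) = span (x ` {..<n})" using main by blast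
  show "inner (u i) (u j) = of_bool (i = j)"
    using main[of "Suc (max i j)"] by (simp add: less_Suc_eq_le)
qed

section \<open>The spectral theorem for compact symmetric operators\<close>

text \<open>Sequential compactness is the form in which the applications need it: a bounded sequence
  is given and a convergent subsequence of its images is extracted.\<close>

definition compact_operator :: "('a::real_normed_vector \<Rightarrow> 'b::real_normed_vector) \<Rightarrow> bool" where
  "compact_operator K \<longleftrightarrow> bounded_linear K \<and>
     (\<forall>f::nat \<Rightarrow> 'a. bounded (range f) \<longrightarrow> (\<exists>r. strict_mono r \<and> convergent (\<lambda>n. K (f (r n)))))"

text \<open>Unit vectors of \<open>W\<close> maximizing \<open>norm (K x)\<close> are approximate
  eigenvectors of the square of \<open>K\<close> for \<open>m\<^sup>2\<close>. Compactness makes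
  this exact, and factoring \<open>K\<^sup>2 - m\<^sup>2\<close> leads back to \<open>K\<close>.
  Working with the square avoids expressing the norm of \<open>K\<close> through
  \<open>inner (K x) x\<close>.\<close>

lemma compact_symmetric_eigenvector:
  fixes K :: "'h::real_inner \<Rightarrow> 'h"
  assumes K: "compact_operator K" and sym: "\<And>x y. inner (K x) y = inner x (K y)"
    and W: "subspace W" "closed W" "K ` W \<subseteq> W" and w: "w \<in> W" "w \<noteq> 0"
  obtains v \<kappa> where "v \<in> W" "norm v = 1" "K v = \<kappa> *\<^sub>R v"
proof (cases "\<forall>x\<in>W. K x = 0")
  case True
  then show ?thesis
    using that[of "sgn w" 0] w W(1) by (simp add: norm_sgn sgn_div_norm subspace_scale)
next
  case False
  interpret K: bounded_linear K using K by (simp add: compact_operator_def)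
  define S where "S = {norm (K x) |x. x \<in> W \<and> norm x = 1}"
  define m where "m = Sup S"
  obtain M where M: "\<And>x. norm (K x) \<le> norm x * M" using K.bounded by blast
  have bdd: "bdd_above S"
  proof (rule bdd_aboveI)
    fix s assume "s \<in> S"
    then obtain x where "s = norm (K x)" "norm x = 1" unfolding S_def by blast
    then show "s \<le> M" using M[of x] by simp
  qed
  have ne: "S \<noteq> {}"
    using w W(1) unfolding S_def by (auto intro!: exI[of _ "sgn w"] simp: norm_sgn sgn_div_norm subspace_scale)
  have le: "norm (K x) \<le> m * norm x" if "x \<in> W" for x
  proof (cases "x = 0")
    case False
    have "norm (K (sgn x)) \<in> S"
      unfolding S_def using False that W(1)
      by (auto intro!: exI[of _ "sgn x"] simp: norm_sgn sgn_div_norm subspace_scale)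
    then have "norm (K (sgn x)) \<le> m" unfolding m_def by (rule cSup_upper[OF _ bdd])
    then show ?thesis using False by (simp add: sgn_div_norm K.scaleR field_simps)
  qed (simp add: K.zero)
  have m: "0 < m"
  proof -
    obtain x where "x \<in> W" "K x \<noteq> 0" using False by blast
    then have "0 < m * norm x" using le[of x] zero_less_norm_iff[of "K x"] by linarith
    then show ?thesis by (metis norm_ge_zero zero_less_mult_pos2 zero_less_mult_iff not_less)
  qed
  have "\<exists>x. x \<in> W \<and> norm x = 1 \<and> m - 1 / Suc n < norm (K x)" for n
  proof -
    have "m - 1 / Suc n < Sup S" by (simp add: m_def)
    then show ?thesis
      unfolding less_cSup_iff[OF ne bdd] by (auto simp: S_def)
  qed
  then obtain x where x: "\<And>n. x n \<in> W" "\<And>n. norm (x n) = 1" "\<And>n. m - 1 / Suc n < norm (K (x n))"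
    by metis
  have "bounded (range x)"
    using x(2) by (auto simp: bounded_iff intro!: exI[of _ 1])
  then obtain r where r: "strict_mono r" "convergent (\<lambda>n. K (x (r n)))"
    using K unfolding compact_operator_def by blast
  then obtain y where y: "(\<lambda>n. K (x (r n))) \<longlonglongrightarrow> y" by (auto simp: convergent_def)
  have up: "norm (K (x n)) \<le> m" for n using le[OF x(1)] x(2) by simp
  have lim_m: "(\<lambda>n. norm (K (x n))) \<longlonglongrightarrow> m"
  proof (rule tendsto_sandwich)
    show "(\<lambda>n. m - 1 / Suc n) \<longlonglongrightarrow> m"
      using tendsto_diff[OF tendsto_const LIMSEQ_inverse_real_of_nat, of m] by (simp add: inverse_eq_divide)
    show "eventually (\<lambda>n. m - 1 / Suc n \<le> norm (K (x n))) sequentially"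
      by (intro always_eventually allI less_imp_le x(3))
    show "eventually (\<lambda>n. norm (K (x n)) \<le> m) sequentially"
      by (intro always_eventually allI up)
  qed auto
  \<comment> \<open>The defect in the eigenvalue equation for the square. Expanding its norm gives
    at most \<open>m^4 - m^2 * norm (K (x n))^2\<close>, which tends to 0 along a maximizing
    sequence.\<close>
  define z where "z n = K (K (x n)) - m\<^sup>2 *\<^sub>R x n" for n
  have zle: "(norm (z n))\<^sup>2 \<le> m\<^sup>2 * m\<^sup>2 - m\<^sup>2 * (norm (K (x n)))\<^sup>2" for n
  proof -
    have "(norm (z n))\<^sup>2 = (norm (K (K (x n))))\<^sup>2 - 2 * m\<^sup>2 * (norm (K (x n)))\<^sup>2 + m\<^sup>2 * m\<^sup>2 * (norm (x n))\<^sup>2"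
    proof -
      have 1: "inner (K (K (x n))) (x n) = (norm (K (x n)))\<^sup>2"
        using sym[of "K (x n)" "x n"] by (simp add: power2_norm_eq_inner)
      have "(norm (z n))\<^sup>2 = inner (K (K (x n))) (K (K (x n))) - 2 * (m\<^sup>2 * inner (K (K (x n))) (x n))
          + m\<^sup>2 * m\<^sup>2 * inner (x n) (x n)"
        unfolding z_def power2_norm_eq_inner
        by (simp add: inner_diff_left inner_diff_right inner_commute[of "x n" "K _"]
            algebra_simps)
      then show ?thesis
        by (simp only: 1 power2_norm_eq_inner[symmetric])
    qed
    moreover have "(norm (K (K (x n))))\<^sup>2 \<le> m\<^sup>2 * (norm (K (x n)))\<^sup>2"
      unfolding power_mult_distrib[symmetric]
      using le[of "K (x n)"] x(1) W(3) by (intro power_mono) auto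
    ultimately show ?thesis by (simp add: x(2))
  qed
  have "(\<lambda>n. m\<^sup>2 * m\<^sup>2 - m\<^sup>2 * (norm (K (x n)))\<^sup>2) \<longlonglongrightarrow> m\<^sup>2 * m\<^sup>2 - m\<^sup>2 * m\<^sup>2"
    by (intro tendsto_intros lim_m)
  then have lim0: "(\<lambda>n. m\<^sup>2 * m\<^sup>2 - m\<^sup>2 * (norm (K (x n)))\<^sup>2) \<longlonglongrightarrow> 0" by simp
  have "(\<lambda>n. (norm (z n))\<^sup>2) \<longlonglongrightarrow> 0"
    by (rule Lim_null_comparison[OF _ lim0]) (use zle in simp)
  then have "(\<lambda>n. sqrt ((norm (z n))\<^sup>2)) \<longlonglongrightarrow> sqrt 0" by (rule tendsto_real_sqrt)
  then have z0: "z \<longlonglongrightarrow> 0" by (simp add: tendsto_norm_zero_iff)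
  have z0': "(\<lambda>n. z (r n)) \<longlonglongrightarrow> 0"
    using LIMSEQ_subseq_LIMSEQ[OF z0 r(1)] by (simp add: o_def)
  have Ky: "(\<lambda>n. K (K (x (r n)))) \<longlonglongrightarrow> K y" by (rule K.tendsto[OF y])
  define a where "a = (1 / m\<^sup>2) *\<^sub>R K y"
  \<comment> \<open>Solving the definition of \<open>z\<close> for \<open>x\<close> shows that the
    vectors themselves converge along \<open>r\<close>, not only their images.\<close>
  have "(\<lambda>n. (1 / m\<^sup>2) *\<^sub>R (K (K (x (r n))) - z (r n))) \<longlonglongrightarrow> (1 / m\<^sup>2) *\<^sub>R (K y - 0)"
    by (intro tendsto_intros Ky z0')
  then have xa: "(\<lambda>n. x (r n)) \<longlonglongrightarrow> a"
    using m by (simp add: z_def a_def)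
  have aW: "a \<in> W" using closed_sequentially[OF W(2) _ xa] x(1) by blast
  have "(\<lambda>n. norm (x (r n))) \<longlonglongrightarrow> norm a" by (intro tendsto_intros xa)
  then have a1: "norm a = 1" by (simp add: x(2) LIMSEQ_const_iff)
  have "K a = y" using K.tendsto[OF xa] y LIMSEQ_unique by blast
  then have KK: "K (K a) = m\<^sup>2 *\<^sub>R a" using m by (simp add: a_def)
  \<comment> \<open>\<open>(K - m) (K + m) a = 0\<close>: either \<open>a\<close> is an eigenvector
    for \<open>- m\<close>, or \<open>K a + m a\<close> is one for \<open>m\<close>.\<close>
  show ?thesis
  proof (cases "K a + m *\<^sub>R a = 0")
    case True
    then have "K a = (- m) *\<^sub>R a" by (simp add: eq_neg_iff_add_eq_0)
    then show ?thesis using that aW a1 by blast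
  next
    case False
    let ?v = "K a + m *\<^sub>R a"
    have "K ?v = m *\<^sub>R ?v" by (simp add: K.add K.scaleR KK power2_eq_square scaleR_add_right)
    then have "K (sgn ?v) = m *\<^sub>R sgn ?v" by (simp add: sgn_div_norm K.scaleR)
    moreover have "sgn ?v \<in> W"
      unfolding sgn_div_norm using aW W by (intro subspace_scale subspace_add) auto
    ultimately show ?thesis using that[of "sgn ?v" m] False by (simp add: norm_sgn)
  qed
qed

text \<open>By Bessel each \<open>u i\<close> has a nonzero inner product with only countably many
  elements of \<open>E\<close>, and no element of \<open>E\<close> is orthogonal to every
  \<open>u i\<close>. This allows an eigenbasis to be indexed by natural numbers.\<close>

lemma countable_orthonormal:
  fixes E :: "'h::real_inner set" and u :: "nat \<Rightarrow> 'h"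
  assumes dense: "closure (span (range u)) = UNIV"
    and o: "\<And>v w. v \<in> E \<Longrightarrow> w \<in> E \<Longrightarrow> inner v w = of_bool (v = w)"
  shows "countable E"
proof -
  have cnt: "countable {v\<in>E. (inner (u i) v)\<^sup>2 \<noteq> 0}" for i
  proof (rule summable_countable_real)
    show "(\<lambda>v. (inner (u i) v)\<^sup>2) summable_on E"
    proof (rule nonneg_bdd_above_summable_on)
      show "bdd_above (sum (\<lambda>v. (inner (u i) v)\<^sup>2) ` {F. F \<subseteq> E \<and> finite F})"
        by (rule bdd_aboveI[of _ "(norm (u i))\<^sup>2"])
          (auto intro!: Bessel_inequality[where e = "\<lambda>v. v"] o)
    qed simp
  qed
  have sub: "E \<subseteq> (\<Union>i. {v\<in>E. (inner (u i) v)\<^sup>2 \<noteq> 0})"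
  proof
    fix v assume v: "v \<in> E"
    then have "v \<noteq> 0" using o[of v v] by auto
    have "\<exists>i. inner v (u i) \<noteq> 0"
    proof (rule ccontr)
      assume "\<not> (\<exists>i. inner v (u i) \<noteq> 0)"
      then have "v = 0" by (intro orthogonal_to_dense_eq_0[OF dense]) auto
      with \<open>v \<noteq> 0\<close> show False by simp
    qed
    then obtain i where "inner v (u i) \<noteq> 0" ..
    then show "v \<in> (\<Union>i. {v\<in>E. (inner (u i) v)\<^sup>2 \<noteq> 0})" using v by (auto simp: inner_commute)
  qed
  have "countable (\<Union>i. {v\<in>E. (inner (u i) v)\<^sup>2 \<noteq> 0})"
    by (intro countable_UN cnt) simp
  with sub show ?thesis by (rule countable_subset)
qed

text \<open>The Fourier series of \<open>x\<close> converges by completeness, and \<open>x\<close>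
  minus its sum is orthogonal to the whole family.\<close>

lemma orthonormal_maximal_dense:
  fixes v :: "nat \<Rightarrow> 'h::{real_inner, complete_space}"
  assumes o: "\<And>i j. i \<in> I \<Longrightarrow> j \<in> I \<Longrightarrow> inner (v i) (v j) = of_bool (i = j)"
    and max: "\<And>y. (\<And>i. i \<in> I \<Longrightarrow> inner y (v i) = 0) \<Longrightarrow> y = 0"
  shows "closure (span (v ` I)) = UNIV"
proof -
  have "x \<in> closure (span (v ` I))" for x
  proof -
    \<comment> \<open>Coefficients are 0 off \<open>I\<close>, so one series over all natural
      numbers serves every index set, finite or infinite.\<close>
    define c where "c i = (if i \<in> I then inner x (v i) else 0)" for i
    have "(\<Sum>i<n. (c i)\<^sup>2) \<le> (norm x)\<^sup>2" for n
    proof -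
      have "(\<Sum>i<n. (c i)\<^sup>2) = (\<Sum>i\<in>{..<n} \<inter> I. (inner x (v i))\<^sup>2)"
        by (intro sum.mono_neutral_cong_right) (auto simp: c_def)
      also have "\<dots> \<le> (norm x)\<^sup>2" by (rule Bessel_inequality) (auto simp: o)
      finally show ?thesis .
    qed
    then have "summable (\<lambda>i. (c i)\<^sup>2)"
      by (intro summableI_nonneg_bounded[of _ "(norm x)\<^sup>2"]) simp_all
    moreover have "(norm (\<Sum>i\<in>F. d i *\<^sub>R (if i \<in> I then v i else 0)))\<^sup>2 \<le> 1 * (\<Sum>i\<in>F. (d i)\<^sup>2)"
      if F: "finite F" for F and d :: "nat \<Rightarrow> real"
    proof -
      have "(\<Sum>i\<in>F. d i *\<^sub>R (if i \<in> I then v i else 0)) = (\<Sum>i\<in>F \<inter> I. d i *\<^sub>R v i)"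
        using F by (intro sum.mono_neutral_cong_right) auto
      moreover have "(norm (\<Sum>i\<in>F \<inter> I. d i *\<^sub>R v i))\<^sup>2 = (\<Sum>i\<in>F \<inter> I. (d i)\<^sup>2)"
        using F by (intro norm_sum_orthonormal) (auto simp: o)
      moreover have "\<dots> \<le> (\<Sum>i\<in>F. (d i)\<^sup>2)" using F by (intro sum_mono2) auto
      ultimately show ?thesis by simp
    qed
    ultimately have "summable (\<lambda>i. c i *\<^sub>R (if i \<in> I then v i else 0))"
      by (intro square_summable_scaleR(1))
    then have lim: "(\<lambda>n. \<Sum>i<n. c i *\<^sub>R (if i \<in> I then v i else 0)) \<longlonglongrightarrow> (\<Sum>i. c i *\<^sub>R (if i \<in> I then v i else 0))"
      (is "?s \<longlonglongrightarrow> ?p") by (rule summable_LIMSEQ)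
    have "inner (x - ?p) (v i) = 0" if i: "i \<in> I" for i
    proof -
      have "(\<lambda>n. inner (?s n) (v i)) \<longlonglongrightarrow> inner ?p (v i)" by (intro tendsto_intros lim)
      moreover have "(\<lambda>n. inner (?s n) (v i)) \<longlonglongrightarrow> inner x (v i)"
      proof (rule tendsto_eventually)
        show "eventually (\<lambda>n. inner (?s n) (v i) = inner x (v i)) sequentially"
        using eventually_gt_at_top[of i]
      proof eventually_elim
        case (elim n)
        have "inner (?s n) (v i) = (\<Sum>j<n. if j = i then inner x (v i) else 0)"
          unfolding inner_sum_left using i by (intro sum.cong refl) (auto simp: c_def o)
        then show ?case using elim by simp
      qed
      qed
      ultimately have "inner ?p (v i) = inner x (v i)"
        by (rule LIMSEQ_unique)
      then show ?thesis by (simp add: inner_diff_left)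
    qed
    then have "x = ?p" using max[of "x - ?p"] by auto
    moreover have "?s n \<in> span (v ` I)" for n
      by (intro span_sum span_scale) (auto intro: span_base span_zero)
    ultimately show ?thesis
      using lim unfolding closure_sequential by metis
  qed
  then show ?thesis by auto
qed

text \<open>Zorn's lemma yields a maximal orthonormal set of eigenvectors. Its orthogonal complement
  is closed and, by symmetry, invariant, so a nonzero vector in it would provide a further
  eigenvector.\<close>

theorem compact_symmetric_eigenbasis:
  fixes K :: "'h::{real_inner, complete_space} \<Rightarrow> 'h" and u :: "nat \<Rightarrow> 'h"
  assumes K: "compact_operator K" and sym: "\<And>x y. inner (K x) y = inner x (K y)"
    and dense: "closure (span (range u)) = UNIV"
  shows "\<exists>(I :: nat set) v \<kappa>. (\<forall>i\<in>I. \<forall>j\<in>I. inner (v i) (v j) = of_bool (i = j)) \<and>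
    (\<forall>i\<in>I. K (v i) = \<kappa> i *\<^sub>R v i) \<and> closure (span (v ` I)) = UNIV"
proof -
  define P where "P = {E. (\<forall>v\<in>E. \<exists>\<kappa>. K v = \<kappa> *\<^sub>R v) \<and> (\<forall>v\<in>E. \<forall>w\<in>E. inner v w = of_bool (v = w))}"
  interpret K: bounded_linear K using K by (simp add: compact_operator_def)
  have "\<exists>M\<in>P. \<forall>X\<in>P. M \<subseteq> X \<longrightarrow> X = M"
  proof (rule subset_Zorn')
    fix C assume C: "subset.chain P C"
    have sub: "C \<subseteq> P" and ch: "\<And>X Y. X \<in> C \<Longrightarrow> Y \<in> C \<Longrightarrow> X \<subseteq> Y \<or> Y \<subseteq> X"
      using C unfolding subset_chain_def by auto
    have "inner v w = of_bool (v = w)" if "v \<in> X" "X \<in> C" "w \<in> Y" "Y \<in> C" for v w X Y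
      using ch[of X Y] that sub unfolding P_def by blast
    moreover have "\<exists>\<kappa>. K v = \<kappa> *\<^sub>R v" if "v \<in> X" "X \<in> C" for v X
      using that sub unfolding P_def by blast
    ultimately show "\<Union>C \<in> P" unfolding P_def by blast
  qed
  then obtain E where E: "E \<in> P" and Emax': "\<forall>X\<in>P. E \<subseteq> X \<longrightarrow> X = E" by (elim bexE)
  then have Emax: "\<And>X. X \<in> P \<Longrightarrow> E \<subseteq> X \<Longrightarrow> X = E" by simp
  have oE: "inner v w = of_bool (v = w)" if "v \<in> E" "w \<in> E" for v w
    using E that unfolding P_def by blast
  define W where "W = {x. \<forall>v\<in>E. inner x v = 0}"
  have W0: "x = 0" if "x \<in> W" for x
  proof (rule ccontr)
    assume "x \<noteq> 0"
    have "W = (\<Inter>v\<in>E. {x. inner x v = 0})" unfolding W_def by auto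
    moreover have "closed {x. inner x v = 0}" for v :: 'h
      by (intro closed_Collect_eq continuous_intros)
    ultimately have cl: "closed W" by auto
    have inv: "K ` W \<subseteq> W"
    proof (clarsimp simp: W_def)
      fix y v assume y: "\<forall>v\<in>E. inner y v = 0" and v: "v \<in> E"
      obtain \<kappa> where "K v = \<kappa> *\<^sub>R v" using E v unfolding P_def by blast
      then show "inner (K y) v = 0" using y v by (simp add: sym)
    qed
    have "subspace W" unfolding W_def subspace_def by (auto simp: inner_add_left)
    then obtain v \<kappa> where v: "v \<in> W" "norm v = 1" "K v = \<kappa> *\<^sub>R v"
      using compact_symmetric_eigenvector[OF K sym _ cl inv \<open>x \<in> W\<close> \<open>x \<noteq> 0\<close>] by blast
    have vv: "inner v v = 1" using v(2) by (simp flip: power2_norm_eq_inner)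
    have "v \<notin> E" using v(1) vv unfolding W_def by force
    have "insert v E \<in> P"
      using E v vv \<open>v \<notin> E\<close> unfolding P_def W_def by (auto simp: inner_commute)
    then show False using Emax[of "insert v E"] \<open>v \<notin> E\<close> by blast
  qed
  have cE: "countable E" by (rule countable_orthonormal[OF dense oE])
  \<comment> \<open>\<open>orthogonal_basis\<close> asks for a family over a set of natural numbers;
    a numbering of the countable set \<open>E\<close> supplies it.\<close>
  define I where "I = to_nat_on E ` E"
  define v where "v = inv_into E (to_nat_on E)"
  have bij: "bij_betw v I E"
    unfolding v_def I_def
    by (metis bij_betw_inv_into cE inj_on_imp_bij_betw inj_on_to_nat_on)
  have vI: "v ` I = E" using bij by (simp add: bij_betw_def)
  have oI: "inner (v i) (v j) = of_bool (i = j)" if "i \<in> I" "j \<in> I" for i j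
    using oE[of "v i" "v j"] vI that bij by (auto simp: bij_betw_def inj_on_def)
  have "\<forall>i\<in>I. \<exists>\<kappa>. K (v i) = \<kappa> *\<^sub>R v i" using E vI unfolding P_def by blast
  then obtain \<kappa> where "\<forall>i\<in>I. K (v i) = \<kappa> i *\<^sub>R v i" by (rule bchoice[THEN exE])
  then have \<kappa>: "\<And>i. i \<in> I \<Longrightarrow> K (v i) = \<kappa> i *\<^sub>R v i" by blast
  have "closure (span (v ` I)) = UNIV"
  proof (rule orthonormal_maximal_dense[OF oI])
    fix y assume "\<And>i. i \<in> I \<Longrightarrow> inner y (v i) = 0"
    then show "y = 0" using W0[of y] vI unfolding W_def by blast
  qed
  then show ?thesis using oI \<kappa> by (intro exI conjI ballI)
qed

section \<open>Families whose Gram matrix is Hilbert-Schmidt close to the identity\<close>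

lemma span_image_lessThan:
  fixes x :: "nat \<Rightarrow> 'h::real_vector"
  assumes "y \<in> span (x ` {..<n})"
  obtains c where "y = (\<Sum>i<n. c i *\<^sub>R x i)"
proof -
  have "subspace {\<Sum>i<n. c i *\<^sub>R x i |c. True}"
    unfolding subspace_def
  proof (safe, goal_cases)
    case 1
    show ?case by (rule exI[of _ "\<lambda>_. 0"]) simp
  next
    case (2 _ _ c d)
    show ?case by (rule exI[of _ "\<lambda>i. c i + d i"]) (simp add: scaleR_add_left sum.distrib)
  next
    case (3 r _ c)
    show ?case by (rule exI[of _ "\<lambda>i. r * c i"]) (simp add: scaleR_sum_right)
  qed
  moreover have "x ` {..<n} \<subseteq> {\<Sum>i<n. c i *\<^sub>R x i |c. True}"
  proof safe
    fix k assume "k < n"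
    then have "x k = (\<Sum>i<n. of_bool (i = k) *\<^sub>R x i)"
      by (simp add: of_bool_def if_distrib[of "\<lambda>t. t *\<^sub>R _"] cong: if_cong)
    then show "\<exists>c. x k = (\<Sum>i<n. c i *\<^sub>R x i) \<and> True" by auto
  qed
  ultimately have "span (x ` {..<n}) \<subseteq> {\<Sum>i<n. c i *\<^sub>R x i |c. True}" by (intro span_minimal)
  then show ?thesis using assms that by blast
qed

lemma span_range_nat:
  fixes x :: "nat \<Rightarrow> 'h::real_vector"
  assumes "y \<in> span (range x)"
  obtains n where "y \<in> span (x ` {..<n})"
proof -
  obtain t r where t: "finite t" "t \<subseteq> range x" "y = (\<Sum>a\<in>t. r a *\<^sub>R a)"
    using assms unfolding span_explicit by blast
  obtain S where S: "finite S" "t = x ` S" using finite_subset_image[OF t(1,2)] by blast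
  obtain n where "S \<subseteq> {..<n}" using finite_nat_iff_bounded S(1) by blast
  then have "t \<subseteq> x ` {..<n}" using S(2) by blast
  then have "y \<in> span (x ` {..<n})" unfolding t(3)
    by (intro span_sum span_scale) (auto intro: span_base)
  then show ?thesis by (rule that)
qed

text \<open>Combinations with rational coefficients are dense; coding them by lists of rationals
  makes their countability immediate.\<close>

lemma separable_space_orthonormal:
  fixes u :: "nat \<Rightarrow> 'h::real_inner"
  assumes dense: "closure (span (range u)) = UNIV" and u: "\<And>i. norm (u i) = 1"
  shows "separable_space (euclidean :: 'h topology)"
proof -
  define C where "C = range (\<lambda>l::rat list. \<Sum>i<length l. of_rat (l ! i) *\<^sub>R u i)"
  have "span (range u) \<subseteq> closure C"
  proof
    fix y assume "y \<in> span (range u)"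
    then obtain n where "y \<in> span (u ` {..<n})" by (rule span_range_nat)
    then obtain c where c: "y = (\<Sum>i<n. c i *\<^sub>R u i)" by (rule span_image_lessThan)
    show "y \<in> closure C"
      unfolding closure_approachable
    proof safe
      fix e :: real assume e: "0 < e"
      have "\<exists>q::rat. \<bar>of_rat q - c i\<bar> < e / (n + 1)" for i
      proof -
        have "0 < e / (n + 1)" using e by simp
        then have "c i - e / (n + 1) < c i + e / (n + 1)" by linarith
        then obtain q :: rat where "c i - e / (n + 1) < of_rat q" "of_rat q < c i + e / (n + 1)"
          using of_rat_dense by blast
        then show ?thesis by (intro exI[of _ q]) linarith
      qed
      then obtain q :: "nat \<Rightarrow> rat" where q: "\<And>i. \<bar>of_rat (q i) - c i\<bar> < e / (n + 1)" by metis
      let ?l = "map q [0..<n]"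
      have "norm ((\<Sum>i<n. of_rat (q i) *\<^sub>R u i) - y) = norm (\<Sum>i<n. (of_rat (q i) - c i) *\<^sub>R u i)"
        unfolding c by (simp add: sum_subtractf scaleR_diff_left)
      also have "\<dots> \<le> (\<Sum>i<n. e / (n + 1))"
        by (rule sum_norm_le) (use q u in \<open>auto simp: less_imp_le\<close>)
      also have "\<dots> < e" using e by (simp add: field_simps)
      finally have "dist (\<Sum>i<n. of_rat (q i) *\<^sub>R u i) y < e" by (simp add: dist_norm)
      moreover have "(\<Sum>i<n. of_rat (q i) *\<^sub>R u i) \<in> C"
        unfolding C_def by (rule image_eqI[where x = "map q [0..<n]"]) simp_all
      ultimately show "\<exists>z\<in>C. dist z y < e" by blast
    qed
  qed
  then have "closure C = UNIV" using dense closure_minimal[of "span (range u)" "closure C"] by auto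
  then show ?thesis
    unfolding separable_space_def
    by (intro exI[of _ C]) (auto simp: C_def intro!: countableI_type)
qed

text \<open>Cutting the series after \<open>n\<close> terms leaves an error controlled, uniformly on
  bounded sets, by the tail of the summable squares of \<open>norm (w i)\<close>, and the cut-off
  images lie in a compact box. Hence the image of a bounded sequence is totally bounded.\<close>

lemma hilbert_schmidt_compact:
  fixes u w :: "nat \<Rightarrow> 'h::{real_inner, complete_space}"
  assumes o: "\<And>i j. inner (u i) (u j) = of_bool (i = j)"
    and w: "summable (\<lambda>i. (norm (w i))\<^sup>2)"
  shows "compact_operator (\<lambda>y. \<Sum>i. inner y (w i) *\<^sub>R u i)"
    and "(\<lambda>i. inner y (w i) *\<^sub>R u i) sums (\<Sum>i. inner y (w i) *\<^sub>R u i)"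
    and "(norm (\<Sum>i. inner y (w i) *\<^sub>R u i))\<^sup>2 \<le> (\<Sum>i. (inner y (w i))\<^sup>2)"
    and "summable (\<lambda>i. (inner y (w i))\<^sup>2)"
proof -
  let ?K = "\<lambda>y. \<Sum>i. inner y (w i) *\<^sub>R u i"
  have ub: "(norm (\<Sum>i\<in>F. c i *\<^sub>R u i))\<^sup>2 \<le> 1 * (\<Sum>i\<in>F. (c i)\<^sup>2)" if "finite F" for F and c :: "nat \<Rightarrow> real"
    using norm_sum_orthonormal[OF that, of u c] o by simp
  have CS: "(inner y (w i))\<^sup>2 \<le> (norm (w i))\<^sup>2 * (norm y)\<^sup>2" for i and y
    using Cauchy_Schwarz_ineq[of y "w i"] by (simp add: power2_norm_eq_inner mult.commute)
  have D: "(\<Sum>i<n. (inner y (w i))\<^sup>2) \<le> (\<Sum>i. (norm (w i))\<^sup>2) * (norm y)\<^sup>2" for n y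
  proof -
    have "(\<Sum>i<n. (inner y (w i))\<^sup>2) \<le> (\<Sum>i<n. (norm (w i))\<^sup>2) * (norm y)\<^sup>2"
      unfolding sum_distrib_right by (intro sum_mono CS)
    also have "\<dots> \<le> (\<Sum>i. (norm (w i))\<^sup>2) * (norm y)\<^sup>2"
      by (intro mult_right_mono sum_le_suminf w) auto
    finally show ?thesis .
  qed
  have s: "summable (\<lambda>i. (inner y (w i))\<^sup>2)" for y
    by (rule summableI_nonneg_bounded[OF _ D]) simp
  then show "summable (\<lambda>i. (inner y (w i))\<^sup>2)" .
  show "(norm (?K y))\<^sup>2 \<le> (\<Sum>i. (inner y (w i))\<^sup>2)"
    using square_summable_scaleR(2)[OF ub s] by simp
  have bl: "bounded_linear ?K" by (rule series_operator(2)[OF ub D])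
  have K_sums: "(\<lambda>i. inner y (w i) *\<^sub>R u i) sums ?K y" for y by (rule series_operator(1)[OF ub D])
  then show "(\<lambda>i. inner y (w i) *\<^sub>R u i) sums ?K y" .
  have tail: "(norm (?K y - (\<Sum>i<n. inner y (w i) *\<^sub>R u i)))\<^sup>2 \<le> (\<Sum>i. (norm (w (i + n)))\<^sup>2) * (norm y)\<^sup>2" for y n
  proof -
    have "?K y - (\<Sum>i<n. inner y (w i) *\<^sub>R u i) = (\<Sum>i. inner y (w (i + n)) *\<^sub>R u (i + n))"
      using suminf_split_initial_segment[OF sums_summable[OF K_sums[of y]], of n] by simp
    also have "(norm \<dots>)\<^sup>2 \<le> 1 * (\<Sum>i. (inner y (w (i + n)))\<^sup>2)"
    proof (rule square_summable_scaleR(2))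
      show "(norm (\<Sum>i\<in>F. c i *\<^sub>R u (i + n)))\<^sup>2 \<le> 1 * (\<Sum>i\<in>F. (c i)\<^sup>2)" if "finite F" for F and c :: "nat \<Rightarrow> real"
        using norm_sum_orthonormal[OF that, of "\<lambda>i. u (i + n)" c] o by simp
    qed (use s in \<open>simp add: summable_iff_shift[of "\<lambda>i. (inner y (w i))\<^sup>2"]\<close>)
    also have "\<dots> \<le> (\<Sum>i. (norm (w (i + n)))\<^sup>2 * (norm y)\<^sup>2)"
      using s w CS
      by (auto intro!: suminf_le summable_mult2 simp: summable_iff_shift[of "\<lambda>i. (inner y (w i))\<^sup>2"]
          summable_iff_shift[of "\<lambda>i. (norm (w i))\<^sup>2"])
    also have "\<dots> = (\<Sum>i. (norm (w (i + n)))\<^sup>2) * (norm y)\<^sup>2"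
      using w by (intro suminf_mult2[symmetric]) (simp add: summable_iff_shift[of "\<lambda>i. (norm (w i))\<^sup>2"])
    finally show ?thesis .
  qed
  show "compact_operator ?K"
    unfolding compact_operator_def
  proof (intro conjI bl allI impI)
    fix f :: "nat \<Rightarrow> 'h" assume "bounded (range f)"
    then obtain R where R: "0 < R" "\<And>n. norm (f n) \<le> R" unfolding bounded_pos by auto
    \<comment> \<open>The box of all \<open>n\<close>-term sums whose coefficients obey the
      Cauchy-Schwarz bound for \<open>inner (f j) (w i)\<close>; it is compact as an iterated sum of
      segments.\<close>
    define Q where "Q n = {\<Sum>i<n. c i *\<^sub>R u i |c. \<forall>i<n. \<bar>c i\<bar> \<le> R * norm (w i)}" for n
    have Qc: "compact (Q n)" for n
    proof (induction n)
      case 0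
      have "Q 0 = {0}" by (auto simp: Q_def)
      then show ?case by simp
    next
      case (Suc n)
      define A where "A = (\<lambda>t. t *\<^sub>R u n) ` {- (R * norm (w n))..R * norm (w n)}"
      have "compact A" unfolding A_def
        by (intro compact_continuous_image continuous_intros) simp
      moreover have "Q (Suc n) = {x + y |x y. x \<in> Q n \<and> y \<in> A}"
      proof safe
        fix x assume "x \<in> Q (Suc n)"
        then obtain c where c: "x = (\<Sum>i<Suc n. c i *\<^sub>R u i)" "\<forall>i<Suc n. \<bar>c i\<bar> \<le> R * norm (w i)"
          unfolding Q_def by blast
        have "(\<Sum>i<n. c i *\<^sub>R u i) \<in> Q n" unfolding Q_def using c(2) by auto
        moreover have "c n *\<^sub>R u n \<in> A" unfolding A_def using c(2) by (auto simp: abs_le_iff minus_le_iff)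
        ultimately show "\<exists>a b. x = a + b \<and> a \<in> Q n \<and> b \<in> A"
          using c(1) by auto
      next
        fix x y assume "x \<in> Q n" "y \<in> A"
        obtain c where c: "x = (\<Sum>i<n. c i *\<^sub>R u i)" "\<forall>i<n. \<bar>c i\<bar> \<le> R * norm (w i)"
          using \<open>x \<in> Q n\<close> unfolding Q_def by blast
        obtain t where "y = t *\<^sub>R u n" "t \<in> {- (R * norm (w n))..R * norm (w n)}"
          using \<open>y \<in> A\<close> unfolding A_def by blast
        then have t: "y = t *\<^sub>R u n" "\<bar>t\<bar> \<le> R * norm (w n)" by auto
        show "x + y \<in> Q (Suc n)"
          unfolding Q_def using c t by (auto simp: less_Suc_eq intro!: exI[of _ "c(n := t)"])
      qed
      ultimately show ?case using Suc compact_sums by auto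
    qed
    define S where "S = range (\<lambda>n. ?K (f n))"
    have "compact (closure S)"
      unfolding compact_eq_totally_bounded
    proof (intro conjI allI impI)
      show "complete (closure S)" by (simp add: complete_eq_closed)
      fix e :: real assume e: "0 < e"
      have "(\<lambda>n. \<Sum>i. (norm (w (i + n)))\<^sup>2) \<longlonglongrightarrow> 0"
        by (rule suminf_exist_split2[OF w])
      \<comment> \<open>The factor \<open>1 / R\<close> compensates the bound \<open>R\<close> on
        the sequence, so the cut-off error is at most \<open>e / 4\<close>. Together with an
        \<open>e / 4\<close>-net of the box this gives closed balls of radius \<open>e / 2\<close>,
        which cover the closure as well.\<close>
      then have "eventually (\<lambda>n. (\<Sum>i. (norm (w (i + n)))\<^sup>2) < (e / (4 * R))\<^sup>2) sequentially"
        by (rule order_tendstoD) (use e R in simp)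
      then obtain n where n: "(\<Sum>i. (norm (w (i + n)))\<^sup>2) < (e / (4 * R))\<^sup>2"
        by (auto simp: eventually_sequentially)
      have "\<exists>k. finite k \<and> Q n \<subseteq> (\<Union>x\<in>k. ball x (e / 4))"
        using Qc[of n] e unfolding compact_eq_totally_bounded by (metis divide_pos_pos zero_less_numeral)
      then obtain k where k: "finite k" "Q n \<subseteq> (\<Union>x\<in>k. ball x (e / 4))" by blast
      have "S \<subseteq> (\<Union>x\<in>k. cball x (e / 2))"
      proof
        fix z assume "z \<in> S"
        then obtain j where z: "z = ?K (f j)" unfolding S_def by blast
        define p where "p = (\<Sum>i<n. inner (f j) (w i) *\<^sub>R u i)"
        have "\<bar>inner (f j) (w i)\<bar> \<le> R * norm (w i)" for i
          using Cauchy_Schwarz_ineq2[of "f j" "w i"] R(2)[of j] mult_right_mono[of "norm (f j)" R "norm (w i)"]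
          by simp
        then have "p \<in> Q n" unfolding p_def Q_def
          by (intro CollectI exI[of _ "\<lambda>i. inner (f j) (w i)"]) simp
        then obtain x where x: "x \<in> k" "dist x p < e / 4" using k by auto
        have "(norm (z - p))\<^sup>2 \<le> (\<Sum>i. (norm (w (i + n)))\<^sup>2) * (norm (f j))\<^sup>2"
          unfolding z p_def by (rule tail)
        also have "\<dots> \<le> (e / (4 * R))\<^sup>2 * R\<^sup>2"
          by (intro mult_mono power_mono R(2)) (use n in auto)
        also have "\<dots> = (e / 4)\<^sup>2" using R(1) by (simp add: power2_eq_square)
        finally have "norm (z - p) \<le> e / 4" by (rule power2_le_imp_le) (use e in simp)
        then have "dist x z \<le> e / 2"
          using x(2) dist_triangle[of x z p] by (simp add: dist_norm norm_minus_commute)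
        then show "z \<in> (\<Union>x\<in>k. cball x (e / 2))" using x(1) by auto
      qed
      then have "closure S \<subseteq> (\<Union>x\<in>k. cball x (e / 2))"
        by (rule closure_minimal) (use k(1) in auto)
      also have "\<dots> \<subseteq> (\<Union>x\<in>k. ball x e)" using e by force
      finally show "\<exists>k. finite k \<and> closure S \<subseteq> (\<Union>x\<in>k. ball x e)" using k(1) by blast
    qed
    moreover have "\<forall>n. ?K (f n) \<in> closure S"
      unfolding S_def using closure_subset by fastforce
    ultimately have "\<exists>l\<in>closure S. \<exists>r. strict_mono r \<and> ((\<lambda>n. ?K (f n)) \<circ> r) \<longlonglongrightarrow> l"
      unfolding compact_def by (elim allE[of _ "\<lambda>n. ?K (f n)"]) simp
    then show "\<exists>r. strict_mono r \<and> convergent (\<lambda>n. ?K (f (r n)))"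
      unfolding o_def convergent_def by (elim bexE exE conjE) (intro exI conjI)
  qed
qed

section \<open>Norms comparable with the given one\<close>

lemma norm_topology_eq_euclidean:
  fixes N :: "'h::real_normed_vector \<Rightarrow> real"
  assumes M: "Metric_space UNIV (norm_dist N)" and c: "0 < c"
    and low: "\<And>y. c * norm y \<le> N y" and up: "\<And>y. N y \<le> C * norm y"
  shows "norm_topology N = euclidean"
proof -
  interpret M: Metric_space UNIV "norm_dist N" by fact
  \<comment> \<open>\<open>C\<close> may be nonpositive when the space is trivial; the radii below
    need a positive constant.\<close>
  define C' where "C' = max C 1"
  have C': "0 < C'" "N y \<le> C' * norm y" for y
    using order_trans[OF up mult_right_mono[of C C' "norm y"]] by (auto simp: C'_def)
  have "openin M.mtopology U \<longleftrightarrow> open U" for U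
    unfolding M.openin_mtopology open_contains_ball
  proof (simp, intro iffI ballI allI impI)
    fix x assume "\<forall>x. x \<in> U \<longrightarrow> (\<exists>r>0. M.mball x r \<subseteq> U)" "x \<in> U"
    then obtain r where r: "0 < r" "M.mball x r \<subseteq> U" by blast
    have "ball x (r / C') \<subseteq> M.mball x r"
    proof
      fix y assume "y \<in> ball x (r / C')"
      then have "C' * norm (x - y) < r" using C'(1) by (simp add: dist_norm field_simps)
      then show "y \<in> M.mball x r" using C'(2)[of "x - y"] by (simp add: M.mball_def norm_dist_def)
    qed
    then show "\<exists>e>0. ball x e \<subseteq> U" using r C'(1) by (intro exI[of _ "r / C'"]) auto
  next
    fix x assume "\<forall>x\<in>U. \<exists>e>0. ball x e \<subseteq> U" "x \<in> U"
    then obtain r where r: "0 < r" "ball x r \<subseteq> U" by blast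
    have "M.mball x (c * r) \<subseteq> ball x r"
    proof
      fix y assume "y \<in> M.mball x (c * r)"
      then have "c * norm (x - y) < c * r"
        using low[of "x - y"] by (simp add: M.mball_def norm_dist_def)
      then show "y \<in> ball x r" using c by (simp add: dist_norm)
    qed
    then show "\<exists>r>0. M.mball x r \<subseteq> U" using r c by (intro exI[of _ "c * r"]) auto
  qed
  then show ?thesis by (simp add: topology_eq)
qed

lemma separable_hilbert_norm_equivalent:
  fixes N :: "'h::{real_normed_vector, complete_space} \<Rightarrow> real"
  assumes ip: "is_inner_product ip" and N: "\<And>y. N y = sqrt (ip y y)" and c: "0 < c"
    and low: "\<And>y. c * norm y \<le> N y" and up: "\<And>y. N y \<le> C * norm y"
    and M: "Metric_space UNIV (norm_dist N)"
    and sep: "separable_space (euclidean :: 'h topology)"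
  shows "separable_hilbert_norm N"
  unfolding separable_hilbert_norm_def
proof (intro conjI)
  interpret M: Metric_space UNIV "norm_dist N" by fact
  have top: "M.mtopology = euclidean" by (rule norm_topology_eq_euclidean[OF M c low up])
  show "\<exists>ip. is_inner_product ip \<and> (\<forall>x. N x = sqrt (ip x x))" using ip N by blast
  show "separable_space M.mtopology" unfolding top by (rule sep)
  show "M.mcomplete"
    unfolding M.mcomplete_def
  proof (intro allI impI)
    fix \<sigma> assume \<sigma>: "M.MCauchy \<sigma>"
    have "Cauchy \<sigma>"
    proof (rule metric_CauchyI)
      fix e :: real assume "0 < e"
      then have "0 < c * e" using c by simp
      then obtain n0 where n0: "\<And>n m. n0 \<le> n \<Longrightarrow> n0 \<le> m \<Longrightarrow> norm_dist N (\<sigma> n) (\<sigma> m) < c * e"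
        using \<sigma> unfolding M.MCauchy_def by blast
      have "dist (\<sigma> n) (\<sigma> m) < e" if "n0 \<le> n" "n0 \<le> m" for n m
      proof -
        have "c * norm (\<sigma> n - \<sigma> m) < c * e"
          using low[of "\<sigma> n - \<sigma> m"] n0[OF that] unfolding norm_dist_def by linarith
        then show ?thesis using c by (simp add: dist_norm)
      qed
      then show "\<exists>k. \<forall>m\<ge>k. \<forall>n\<ge>k. dist (\<sigma> m) (\<sigma> n) < e" by blast
    qed
    then obtain x where "\<sigma> \<longlonglongrightarrow> x" using Cauchy_convergent convergent_def by blast
    then show "\<exists>x. limitin M.mtopology \<sigma> x sequentially" unfolding top by auto
  qed
qed

text \<open>The condition \<open>ind\<close> enters twice. On finite sums it gives linear
  independence, as Gram-Schmidt requires. In the limit it says that no nonzero square summable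
  combination vanishes, which independence alone would not give and which makes \<open>U\<close>
  injective.\<close>

theorem near_orthonormal_admissible:
  fixes x :: "nat \<Rightarrow> 'h::{real_inner, complete_space}"
  defines "a \<equiv> \<lambda>i j. inner (x i) (x j) - of_bool (i = j)"
  assumes dense: "closure (span (range x)) = UNIV"
    and hs: "\<And>n. (\<Sum>i<n. \<Sum>j<n. (a i j)\<^sup>2) \<le> M"
    and ind: "\<And>k. \<exists>C. \<forall>n c. k < n \<longrightarrow> \<bar>c k\<bar> \<le> C * norm (\<Sum>i<n. c i *\<^sub>R x i)"
  obtains N where "N \<in> admissible_norms" "\<And>i j. norm_scalar_product N (x i) (x j) = of_bool (i = j)"
proof -
  have M: "0 \<le> M" using hs[of 0] by simp
  have a_sym: "a i j = a j i" for i j by (simp add: a_def inner_commute)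
  \<comment> \<open>Cauchy-Schwarz over pairs of indices bounds the part of the quadratic form that
    is due to \<open>a\<close> by \<open>sqrt M\<close> times the sum of squares.\<close>
  have bound: "(norm (\<Sum>i\<in>F. c i *\<^sub>R x i))\<^sup>2 \<le> (1 + sqrt M) * (\<Sum>i\<in>F. (c i)\<^sup>2)"
    if F: "finite F" for F and c :: "nat \<Rightarrow> real"
  proof -
    obtain n where n: "F \<subseteq> {..<n}" using finite_nat_iff_bounded F by blast
    have "(norm (\<Sum>i\<in>F. c i *\<^sub>R x i))\<^sup>2 = (\<Sum>i\<in>F. \<Sum>j\<in>F. c i * c j * inner (x i) (x j))"
      unfolding power2_norm_eq_inner inner_sum_left inner_sum_right
      by (simp add: inner_commute mult_ac)
    also have "\<dots> = (\<Sum>i\<in>F. \<Sum>j\<in>F. c i * c j * of_bool (i = j)) + (\<Sum>i\<in>F. \<Sum>j\<in>F. c i * c j * a i j)"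
      by (simp add: a_def sum.distrib[symmetric] right_diff_distrib)
    also have "(\<Sum>i\<in>F. \<Sum>j\<in>F. c i * c j * of_bool (i = j)) = (\<Sum>i\<in>F. (c i)\<^sup>2)"
      using F by (simp add: of_bool_def if_distrib power2_eq_square cong: if_cong)
    also have "(\<Sum>i\<in>F. \<Sum>j\<in>F. c i * c j * a i j) \<le> sqrt M * (\<Sum>i\<in>F. (c i)\<^sup>2)"
    proof (rule power2_le_imp_le)
      have "(\<Sum>i\<in>F. \<Sum>j\<in>F. c i * c j * a i j)\<^sup>2 = (\<Sum>p\<in>F \<times> F. (c (fst p) * c (snd p)) * a (fst p) (snd p))\<^sup>2"
        by (simp add: sum.cartesian_product case_prod_unfold)
      also have "\<dots> \<le> (\<Sum>p\<in>F \<times> F. (c (fst p) * c (snd p))\<^sup>2) * (\<Sum>p\<in>F \<times> F. (a (fst p) (snd p))\<^sup>2)"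
        by (rule Cauchy_Schwarz_ineq_sum)
      also have "(\<Sum>p\<in>F \<times> F. (c (fst p) * c (snd p))\<^sup>2) = (\<Sum>i\<in>F. (c i)\<^sup>2)\<^sup>2"
        by (simp add: power2_eq_square sum_product sum.cartesian_product case_prod_unfold mult_ac)
      finally have "(\<Sum>i\<in>F. \<Sum>j\<in>F. c i * c j * a i j)\<^sup>2
        \<le> (\<Sum>i\<in>F. (c i)\<^sup>2)\<^sup>2 * (\<Sum>p\<in>F \<times> F. (a (fst p) (snd p))\<^sup>2)" .
      also have "\<dots> \<le> (\<Sum>i\<in>F. (c i)\<^sup>2)\<^sup>2 * (\<Sum>p\<in>{..<n} \<times> {..<n}. (a (fst p) (snd p))\<^sup>2)"
        using n by (intro mult_left_mono sum_mono2) auto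
      also have "\<dots> \<le> (\<Sum>i\<in>F. (c i)\<^sup>2)\<^sup>2 * M"
        using hs[of n] by (intro mult_left_mono) (simp_all add: sum.cartesian_product case_prod_unfold)
      finally show "(\<Sum>i\<in>F. \<Sum>j\<in>F. c i * c j * a i j)\<^sup>2 \<le> (sqrt M * (\<Sum>i\<in>F. (c i)\<^sup>2))\<^sup>2"
        using M by (simp add: power_mult_distrib mult.commute)
    qed (auto intro!: mult_nonneg_nonneg sum_nonneg M)
    finally show ?thesis by (simp add: algebra_simps)
  qed
  have "x n \<notin> span (x ` {..<n})" for n
  proof
    assume "x n \<in> span (x ` {..<n})"
    then obtain c where c: "x n = (\<Sum>i<n. c i *\<^sub>R x i)" by (rule span_image_lessThan)
    obtain C where C: "\<And>m d. n < m \<Longrightarrow> \<bar>d n\<bar> \<le> C * norm (\<Sum>i<m. d i *\<^sub>R x i)" using ind[of n] by blast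
    \<comment> \<open>The coefficient \<open>- 1\<close> at \<open>n\<close> turns the dependence
      into a vanishing sum, whereas \<open>ind\<close> would bound the modulus of that coefficient
      by 0.\<close>
    have "(\<Sum>i<Suc n. (c(n := -1)) i *\<^sub>R x i) = 0" by (simp add: c)
    then show False using C[of "Suc n" "c(n := -1)"] by simp
  qed
  note gs = gram_schmidt[of x, OF this]
  \<comment> \<open>Orthonormalizing the family itself yields a complete orthonormal sequence over
    all of \<open>nat\<close>, with the index set of \<open>x\<close>.\<close>
  define u where "u = gram_schmidt x"
  have o: "inner (u i) (u j) = of_bool (i = j)" for i j unfolding u_def by (rule gs(1))
  have "span (range x) \<subseteq> span (range u)"
  proof (rule span_minimal)
    show "range x \<subseteq> span (range u)"
    proof safe
      fix n
      have "x n \<in> span (u ` {..<Suc n})"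
        unfolding u_def gs(2) by (rule span_base) auto
      then show "x n \<in> span (range u)" using span_mono[of "u ` {..<Suc n}" "range u"] by auto
    qed
  qed simp
  then have udense: "closure (span (range u)) = UNIV"
    using dense closure_mono by (metis top.extremum_uniqueI)
  have ub: "(norm (\<Sum>i\<in>F. c i *\<^sub>R u i))\<^sup>2 \<le> 1 * (\<Sum>i\<in>F. (c i)\<^sup>2)" if "finite F" for F and c :: "nat \<Rightarrow> real"
    using norm_sum_orthonormal[OF that, of u c] o by simp
  have row: "(\<Sum>j<n. (a i j)\<^sup>2) \<le> M" for i n
  proof -
    define m where "m = max n (Suc i)"
    have "(\<Sum>j<n. (a i j)\<^sup>2) \<le> (\<Sum>j<m. (a i j)\<^sup>2)" by (intro sum_mono2) (auto simp: m_def)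
    moreover have "\<dots> \<le> (\<Sum>i<m. \<Sum>j<m. (a i j)\<^sup>2)"
      by (rule member_le_sum[of i _ "\<lambda>i. \<Sum>j<m. (a i j)\<^sup>2"]) (auto intro!: sum_nonneg simp: m_def)
    ultimately show ?thesis using hs[of m] by linarith
  qed
  have srow: "summable (\<lambda>j. (a i j)\<^sup>2)" for i
    by (rule summableI_nonneg_bounded[OF _ row]) simp
  \<comment> \<open>\<open>w i\<close> is the \<open>i\<close>-th row of the matrix \<open>a\<close>
    in the basis \<open>u\<close>, so that \<open>K\<close> below has matrix
    \<open>a\<close>.\<close>
  define w where "w i = (\<Sum>j. a i j *\<^sub>R u j)" for i
  have w_sums: "(\<lambda>j. a i j *\<^sub>R u j) sums w i" for i
    unfolding w_def using square_summable_scaleR(1)[OF ub srow] by (rule summable_sums)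
  have inner_sums: "(\<lambda>j. inner (f j) y) sums inner s y" if "f sums s" for f s and y :: 'h
    using bounded_linear.sums[OF bounded_linear_inner_left that] .
  have uw: "inner (w i) (u k) = a i k" for i k
  proof -
    have "(\<lambda>j. inner (a i j *\<^sub>R u j) (u k)) sums inner (w i) (u k)" by (rule inner_sums[OF w_sums])
    moreover have "(\<lambda>j. inner (a i j *\<^sub>R u j) (u k)) = (\<lambda>j. if j = k then a i j else 0)"
      by (simp add: o fun_eq_iff)
    ultimately show ?thesis using sums_single[of k "a i"] sums_unique2 by metis
  qed
  have w_norm: "(norm (w i))\<^sup>2 \<le> (\<Sum>j. (a i j)\<^sup>2)" for i
    unfolding w_def using square_summable_scaleR(2)[OF ub srow] by simp
  have w_summable: "summable (\<lambda>i. (norm (w i))\<^sup>2)"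
  proof (rule summableI_nonneg_bounded)
    fix m
    have "(\<Sum>i<m. (norm (w i))\<^sup>2) \<le> (\<Sum>i<m. \<Sum>j. (a i j)\<^sup>2)" by (intro sum_mono w_norm)
    also have "\<dots> \<le> M"
    proof (rule LIMSEQ_le_const2)
      show "(\<lambda>n. \<Sum>i<m. \<Sum>j<n. (a i j)\<^sup>2) \<longlonglongrightarrow> (\<Sum>i<m. \<Sum>j. (a i j)\<^sup>2)"
        by (intro tendsto_sum summable_LIMSEQ srow)
      show "\<exists>n0. \<forall>n\<ge>n0. (\<Sum>i<m. \<Sum>j<n. (a i j)\<^sup>2) \<le> M"
      proof (intro exI allI impI)
        fix n assume "m \<le> n"
        then have "(\<Sum>i<m. \<Sum>j<n. (a i j)\<^sup>2) \<le> (\<Sum>i<n. \<Sum>j<n. (a i j)\<^sup>2)"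
          by (intro sum_mono2) (auto intro!: sum_nonneg)
        then show "(\<Sum>i<m. \<Sum>j<n. (a i j)\<^sup>2) \<le> M" using hs[of n] by linarith
      qed
    qed
    finally show "(\<Sum>i<m. (norm (w i))\<^sup>2) \<le> M" .
  qed simp
  define K where "K y = (\<Sum>i. inner y (w i) *\<^sub>R u i)" for y
  define U where "U y = (\<Sum>i. inner y (u i) *\<^sub>R x i)" for y
  note hsc = hilbert_schmidt_compact[OF o w_summable, folded K_def]
  have Kc: "compact_operator K" using hsc(1) unfolding K_def[abs_def] .
  have Bessel_u: "(\<Sum>i<n. (inner y (u i))\<^sup>2) \<le> 1 * (norm y)\<^sup>2" for n y
    using Bessel_inequality[of "{..<n}" u y] o by simp
  have U_sums: "(\<lambda>i. inner y (u i) *\<^sub>R x i) sums U y" for y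
    unfolding U_def by (rule series_operator(1)[OF bound Bessel_u])
  have U_bl: "bounded_linear U"
    unfolding U_def[abs_def] by (rule series_operator(2)[OF bound Bessel_u])
  interpret U: bounded_linear U by (rule U_bl)
  interpret K: bounded_linear K using Kc by (simp add: compact_operator_def)
  have Uu: "U (u k) = x k" for k
  proof -
    have "(\<lambda>i. inner (u k) (u i) *\<^sub>R x i) = (\<lambda>i. if i = k then x i else 0)"
      by (auto simp: o fun_eq_iff)
    then show ?thesis using U_sums[of "u k"] sums_single[of k x] sums_unique2 by metis
  qed
  have Ku: "inner (K (u k)) (u j) = a j k" for k j
  proof -
    have "(\<lambda>i. inner (inner (u k) (w i) *\<^sub>R u i) (u j)) sums inner (K (u k)) (u j)"
      by (rule inner_sums[OF hsc(2)])
    moreover have "(\<lambda>i. inner (inner (u k) (w i) *\<^sub>R u i) (u j)) = (\<lambda>i. if i = j then a i k else 0)"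
      by (auto simp: o fun_eq_iff uw inner_commute[of "u k"])
    ultimately show ?thesis using sums_single[of j "\<lambda>i. a i k"] sums_unique2 by metis
  qed
  \<comment> \<open>The identity \<open>U* U = 1 + K\<close> in weak form; on basis vectors it is
    the definition of \<open>a\<close>.\<close>
  have "inner (U y) (U z) = inner (y + K y) z" for y z
  proof (rule bounded_bilinear_eq_on_dense[where p = "\<lambda>y z. inner (U y) (U z)"
        and q = "\<lambda>y z. inner (y + K y) z", OF _ _ udense])
    show "bounded_bilinear (\<lambda>y z. inner (U y) (U z))"
      by (intro bounded_bilinear.comp[OF bounded_bilinear_inner] U_bl)
    show "bounded_bilinear (\<lambda>y z. inner (y + K y) z)"
      by (intro bounded_bilinear.comp[OF bounded_bilinear_inner] bounded_linear_add
          K.bounded_linear_axioms bounded_linear_ident)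
    show "inner (U y) (U z) = inner (y + K y) z" if "y \<in> range u" "z \<in> range u" for y z
    proof -
      from that obtain i j where "y = u i" "z = u j" by blast
      then show ?thesis using a_sym[of i j] by (simp add: Uu Ku o a_def inner_add_left)
    qed
  qed
  then have UU: "inner (U y) (U z) = inner y z + inner (K y) z" for y z
    by (simp add: inner_add_left)
  have K_sym: "inner (K y) z = inner y (K z)" for y z
    using UU[of y z] UU[of z y] by (simp add: inner_commute)
  obtain I :: "nat set" and v \<kappa> where eig: "(\<forall>i\<in>I. \<forall>j\<in>I. inner (v i) (v j) = of_bool (i = j)) \<and>
    (\<forall>i\<in>I. K (v i) = \<kappa> i *\<^sub>R v i) \<and> closure (span (v ` I)) = UNIV"
    using compact_symmetric_eigenbasis[OF Kc K_sym udense] by (elim exE)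
  have v: "inner (v i) (v j) = of_bool (i = j)" if "i \<in> I" "j \<in> I" for i j
    using eig that by blast
  have \<kappa>: "K (v i) = \<kappa> i *\<^sub>R v i" if "i \<in> I" for i using eig that by blast
  have vdense: "closure (span (v ` I)) = UNIV" using eig by blast
  \<comment> \<open>\<open>ind\<close> bounds the \<open>k\<close>-th coordinate by every partial
    sum beyond \<open>k\<close>, with a constant free of \<open>n\<close>, so the bound survives the
    limit.\<close>
  have U_inj: "y = 0" if Uy: "U y = 0" for y
  proof (rule orthogonal_to_dense_eq_0[OF udense])
    fix b assume "b \<in> range u"
    then obtain k where b: "b = u k" by blast
    obtain C where C: "\<And>m d. k < m \<Longrightarrow> \<bar>d k\<bar> \<le> C * norm (\<Sum>i<m. d i *\<^sub>R x i)" using ind[of k] by blast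
    have "(\<lambda>n. C * norm (\<Sum>i<n. inner y (u i) *\<^sub>R x i)) \<longlonglongrightarrow> C * norm (U y)"
      using U_sums[of y] unfolding sums_def by (intro tendsto_intros)
    then have "\<bar>inner y (u k)\<bar> \<le> C * norm (U y)"
      by (rule LIMSEQ_le_const) (intro exI[of _ "Suc k"] allI impI C, simp)
    then show "inner y b = 0" by (simp add: Uy b)
  qed
  obtain B where B: "\<And>y. norm (U y) \<le> norm y * B" "0 < B" using U.pos_bounded by blast
  \<comment> \<open>If unit vectors \<open>y n\<close> had \<open>U (y n)\<close> tending to 0, then
    \<open>y n + K (y n)\<close> would tend to 0 too. Compactness of \<open>K\<close> then makes a
    subsequence of \<open>y\<close> converge, to a unit vector in the kernel of
    \<open>U\<close>.\<close>
  have "\<exists>c>0. \<forall>y. c * norm y \<le> norm (U y)"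
  proof (rule ccontr)
    assume neg: "\<not> (\<exists>c>0. \<forall>y. c * norm y \<le> norm (U y))"
    have "\<exists>y. norm y = 1 \<and> norm (U y) < 1 / Suc n" for n
    proof -
      have "\<not> (\<forall>y. 1 / Suc n * norm y \<le> norm (U y))" using neg by (metis of_nat_0_less_iff zero_less_Suc zero_less_divide_1_iff)
      then obtain y where y: "norm (U y) < 1 / Suc n * norm y" by (auto simp: not_le)
      then have "y \<noteq> 0" by (auto simp: U.zero)
      then show ?thesis using y
        by (intro exI[of _ "sgn y"]) (simp add: norm_sgn sgn_div_norm U.scaleR field_simps)
    qed
    then obtain y where y1: "\<And>n. norm (y n) = 1" and yU: "\<And>n. norm (U (y n)) < 1 / Suc n" by metis
    have Uy0: "(\<lambda>n. norm (U (y n))) \<longlonglongrightarrow> 0"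
    proof (rule Lim_null_comparison[OF _ LIMSEQ_inverse_real_of_nat])
      show "eventually (\<lambda>n. norm (norm (U (y n))) \<le> inverse (Suc n)) sequentially"
        using yU by (intro always_eventually allI) (simp add: inverse_eq_divide less_imp_le)
    qed
    have "bounded (range y)" by (auto simp: bounded_iff y1 intro!: exI[of _ 1])
    then obtain r where r: "strict_mono r" "convergent (\<lambda>n. K (y (r n)))"
      using Kc unfolding compact_operator_def by blast
    then obtain l where l: "(\<lambda>n. K (y (r n))) \<longlonglongrightarrow> l" by (auto simp: convergent_def)
    have le: "norm (y n + K (y n)) \<le> B * norm (U (y n))" for n
    proof -
      let ?z = "y n + K (y n)"
      have "norm ?z * norm ?z = inner (U (y n)) (U ?z)"
        unfolding UU inner_add_left[symmetric] by (metis power2_norm_eq_inner power2_eq_square)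
      also have "\<dots> \<le> norm (U (y n)) * norm (U ?z)" by (rule norm_cauchy_schwarz)
      also have "\<dots> \<le> norm (U (y n)) * (norm ?z * B)" by (intro mult_left_mono B) simp
      finally have "norm ?z * norm ?z \<le> (B * norm (U (y n))) * norm ?z" by (simp add: mult_ac)
      then show ?thesis using B(2) by (cases "norm ?z = 0") auto
    qed
    have "(\<lambda>n. y n + K (y n)) \<longlonglongrightarrow> 0"
      by (rule Lim_null_comparison[of _ "\<lambda>n. B * norm (U (y n))"])
        (use le tendsto_mult_left[OF Uy0, of B] in \<open>auto intro!: always_eventually\<close>)
    from LIMSEQ_subseq_LIMSEQ[OF this r(1)] l
    have "(\<lambda>n. (y (r n) + K (y (r n))) - K (y (r n))) \<longlonglongrightarrow> 0 - l"
      unfolding o_def by (rule tendsto_diff)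
    then have yl: "(\<lambda>n. y (r n)) \<longlonglongrightarrow> - l" by simp
    have "(\<lambda>n. norm (U (y (r n)))) \<longlonglongrightarrow> norm (U (- l))" by (intro tendsto_norm U.tendsto yl)
    moreover have "(\<lambda>n. norm (U (y (r n)))) \<longlonglongrightarrow> 0"
      using LIMSEQ_subseq_LIMSEQ[OF Uy0 r(1)] by (simp add: o_def)
    ultimately have "norm (U (- l)) = 0" by (rule LIMSEQ_unique)
    then have "- l = 0" by (rule U_inj[OF norm_eq_zero[THEN iffD1]])
    moreover have "(\<lambda>n. norm (y (r n))) \<longlonglongrightarrow> norm (- l)" by (intro tendsto_norm yl)
    ultimately show False by (simp add: y1 LIMSEQ_const_iff)
  qed
  then obtain c where c: "0 < c" "\<And>y. c * norm y \<le> norm (U y)" by blast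
  \<comment> \<open>A lower bound makes the range closed, and it contains the dense span of
    \<open>x\<close>; so \<open>U\<close> is onto.\<close>
  have "complete (range U)"
    by (rule complete_isometric_image[OF c(1) subspace_UNIV U_bl]) (use c(2) complete_UNIV in auto)
  then have "closed (range U)" by (rule complete_imp_closed)
  moreover have "span (range x) \<subseteq> range U"
    by (rule span_minimal)
      (use Uu in \<open>auto intro: linear_subspace_image[OF U.linear subspace_UNIV] simp: image_iff\<close>, metis)
  ultimately have "closure (span (range x)) \<subseteq> range U" by (intro closure_minimal)
  then have U_surj: "surj U" using dense by auto
  have "inj U"
    using U_inj U.linear by (simp add: linear_injective_0)
  define V where "V = inv U"
  have UV: "U (V y) = y" and VU: "V (U y) = y" for y
    unfolding V_def using U_surj \<open>inj U\<close> by (auto simp: surj_f_inv_f)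
  have V_add: "V (y + z) = V y + V z" and V_scale: "V (r *\<^sub>R y) = r *\<^sub>R V y" for y z r
    using VU[of "V y + V z"] VU[of "r *\<^sub>R V y"] by (simp_all add: U.add U.scaleR UV)
  have V_diff: "V (y - z) = V y - V z" for y z
    using V_add[of y "(-1) *\<^sub>R z"] V_scale[of "-1" z] by simp
  have V0: "V y = 0 \<longleftrightarrow> y = 0" for y
    using UV[of y] VU[of 0] by (auto simp: U.zero)
  \<comment> \<open>For this norm \<open>U\<close> is an isometry onto, so it carries the
    orthonormal \<open>u k\<close> to the then orthonormal \<open>x k\<close>.\<close>
  define N where "N y = norm (V y)" for y
  define ip where "ip y z = inner (V y) (V z)" for y z
  have ip: "is_inner_product ip"
    unfolding is_inner_product_def ip_def
    by (auto simp: inner_commute V_add V_scale inner_add_left inner_add_right V0)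
  have N_ip: "N y = sqrt (ip y y)" for y by (simp add: N_def ip_def norm_eq_sqrt_inner)
  have nsp: "norm_scalar_product N = ip"
    by (rule norm_scalar_product_unique[OF ip]) (simp add: N_ip)
  have ip1: "is_inner_product (inner :: 'h \<Rightarrow> 'h \<Rightarrow> real)"
    unfolding is_inner_product_def by (auto simp: inner_commute inner_add_left inner_add_right)
  have nsp1: "norm_scalar_product (norm :: 'h \<Rightarrow> real) = inner"
    by (rule norm_scalar_product_unique[OF ip1]) (simp add: norm_eq_sqrt_inner)
  have met: "Metric_space UNIV (norm_dist N)"
  proof -
    have eq: "norm_dist N = (\<lambda>y z. dist (V y) (V z))"
      by (simp add: fun_eq_iff norm_dist_def N_def V_diff dist_norm)
    have inj: "V y = V z \<longleftrightarrow> y = z" for y z by (metis UV)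
    show ?thesis
      unfolding eq
    proof
      fix y z w
      show "dist (V y) (V z) = dist (V z) (V y)" by (rule dist_commute)
      show "dist (V y) (V w) \<le> dist (V y) (V z) + dist (V z) (V w)" by (rule dist_triangle)
    qed (simp_all add: inj)
  qed
  have met1: "Metric_space UNIV (norm_dist (norm :: 'h \<Rightarrow> real))"
    unfolding norm_dist_def[abs_def] dist_norm[symmetric] by (rule Met_TC.Metric_space_axioms)
  have low: "(1 / B) * norm y \<le> N y" for y
    using B(1)[of "V y"] B(2) by (simp add: UV N_def field_simps)
  have up: "N y \<le> (1 / c) * norm y" for y
    using c(2)[of "V y"] c(1) by (simp add: UV N_def field_simps)
  have "1 / B > 0" using B by simp
  have "norm (u i) = 1" for i using o[of i i] by (simp add: norm_eq_sqrt_inner)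
  then have sep: "separable_space (euclidean :: 'h topology)"
    by (rule separable_space_orthonormal[OF udense])
  have top: "norm_topology N = euclidean"
    by (rule norm_topology_eq_euclidean[OF met \<open>1 / B > 0\<close> low up])
  have top1: "norm_topology (norm :: 'h \<Rightarrow> real) = euclidean"
    by (rule norm_topology_eq_euclidean[OF met1, of 1 1]) auto
  \<comment> \<open>Eigenvectors of \<open>K\<close> moved by \<open>U\<close>: orthonormal for
    \<open>N\<close>, and orthogonal with squared norms \<open>1 + \<kappa> i\<close> for the
    original norm.\<close>
  define e where "e i = U (v i)" for i
  have ip_e: "ip (e i) (e j) = of_bool (i = j)" if "i \<in> I" "j \<in> I" for i j
    using v[OF that] by (simp add: ip_def e_def VU)
  have inner_e: "inner (e i) (e j) = (1 + \<kappa> i) * of_bool (i = j)" if "i \<in> I" "j \<in> I" for i j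
    using v[OF that] by (simp add: e_def UU \<kappa>[OF that(1)])
  have e0: "e i \<noteq> 0" if "i \<in> I" for i
    using ip_e[OF that that] V0[of 0] by (auto simp: ip_def)
  have "UNIV = U ` closure (span (v ` I))" using vdense U_surj by simp
  also have "\<dots> \<subseteq> closure (U ` span (v ` I))"
    by (rule closure_bounded_linear_image_subset[OF U_bl])
  also have "U ` span (v ` I) = span (e ` I)"
    using linear_span_image[OF U.linear, of "v ` I"] by (simp add: e_def image_image)
  finally have edense: "closure (span (e ` I)) = UNIV" by blast
  have \<kappa>1: "(\<kappa> i)\<^sup>2 \<le> (\<Sum>k. (inner (v i) (w k))\<^sup>2)" if "i \<in> I" for i
    using hsc(3)[of "v i"] v[OF that that] by (simp add: \<kappa>[OF that] norm_eq_sqrt_inner)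
  \<comment> \<open>Independence of the Hilbert-Schmidt norm from the basis, as an inequality:
    exchange the sums and apply Bessel to each \<open>w k\<close> against the eigenvectors.\<close>
  have \<kappa>_sum: "(\<Sum>i\<in>F. (\<kappa> i)\<^sup>2) \<le> (\<Sum>k. (norm (w k))\<^sup>2)" if F: "finite F" "F \<subseteq> I" for F
  proof -
    have "(\<Sum>i\<in>F. (\<kappa> i)\<^sup>2) \<le> (\<Sum>i\<in>F. \<Sum>k. (inner (v i) (w k))\<^sup>2)"
      by (intro sum_mono \<kappa>1) (use F in auto)
    also have "\<dots> = (\<Sum>k. \<Sum>i\<in>F. (inner (v i) (w k))\<^sup>2)"
      by (rule suminf_sum[symmetric]) (rule hsc(4))
    also have "\<dots> \<le> (\<Sum>k. (norm (w k))\<^sup>2)"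
    proof (rule suminf_le)
      show "(\<Sum>i\<in>F. (inner (v i) (w k))\<^sup>2) \<le> (norm (w k))\<^sup>2" for k
        using Bessel_inequality[of F v "w k"] v F by (simp add: inner_commute subset_iff)
      show "summable (\<lambda>k. \<Sum>i\<in>F. (inner (v i) (w k))\<^sup>2)" by (rule summable_sum) (rule hsc(4))
    qed (rule w_summable)
    finally show ?thesis .
  qed
  \<comment> \<open>With \<open>s\<close> the root of \<open>1 + \<kappa> i\<close> the quotient is
    \<open>1 / s\<close>. Here \<open>s\<close> is at least \<open>c\<close>, and \<open>\<bar>1 -
    s\<bar> \<le> \<bar>1 - s\<^sup>2\<bar> = \<bar>\<kappa> i\<bar>\<close>.\<close>
  have quot: "(N (e i) / norm (e i) - 1)\<^sup>2 \<le> (\<kappa> i)\<^sup>2 / c\<^sup>2" if i: "i \<in> I" for i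
  proof -
    define s where "s = norm (e i)"
    have "N (e i) = 1" using ip_e[OF i i] by (simp add: N_ip)
    have "norm (v i) = 1" using v[OF i i] by (simp add: norm_eq_sqrt_inner)
    then have sc: "c \<le> s" using c(2)[of "v i"] by (simp add: s_def e_def)
    have s2: "s\<^sup>2 = 1 + \<kappa> i" using inner_e[OF i i] by (simp add: s_def power2_norm_eq_inner)
    have "0 < s" using sc c(1) by linarith
    have "\<bar>1 - s\<bar> * 1 \<le> \<bar>1 - s\<bar> * \<bar>1 + s\<bar>" using \<open>0 < s\<close> by (intro mult_left_mono) auto
    also have "\<dots> = \<bar>\<kappa> i\<bar>" using s2 by (simp flip: abs_mult add: algebra_simps power2_eq_square)
    finally have "(1 - s)\<^sup>2 \<le> (\<kappa> i)\<^sup>2" by (simp add: abs_le_square_iff)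
    then have "(1 - s)\<^sup>2 / s\<^sup>2 \<le> (\<kappa> i)\<^sup>2 / c\<^sup>2"
      using sc c(1) by (intro frac_le) (auto intro: power_mono)
    moreover have "(1 / s - 1)\<^sup>2 = (1 - s)\<^sup>2 / s\<^sup>2"
      using \<open>0 < s\<close> by (simp add: field_simps power2_eq_square)
    ultimately show ?thesis using \<open>N (e i) = 1\<close> by (simp add: s_def)
  qed
  have "(\<lambda>k. (N (e k) / norm (e k) - 1)\<^sup>2) summable_on I"
  proof (rule nonneg_bdd_above_summable_on)
    show "bdd_above (sum (\<lambda>k. (N (e k) / norm (e k) - 1)\<^sup>2) ` {F. F \<subseteq> I \<and> finite F})"
    proof (rule bdd_aboveI2)
      fix F assume F: "F \<in> {F. F \<subseteq> I \<and> finite F}"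
      have "(\<Sum>k\<in>F. (N (e k) / norm (e k) - 1)\<^sup>2) \<le> (\<Sum>k\<in>F. (\<kappa> k)\<^sup>2 / c\<^sup>2)"
        using F quot by (intro sum_mono) auto
      also have "\<dots> \<le> (\<Sum>k. (norm (w k))\<^sup>2) / c\<^sup>2"
        unfolding sum_divide_distrib[symmetric] using F by (intro divide_right_mono \<kappa>_sum) auto
      finally show "(\<Sum>k\<in>F. (N (e k) / norm (e k) - 1)\<^sup>2) \<le> (\<Sum>k. (norm (w k))\<^sup>2) / c\<^sup>2" .
    qed
  qed simp
  moreover have "orthogonal_basis norm I e"
    unfolding orthogonal_basis_def nsp1 top1 using e0 inner_e edense by auto
  moreover have "orthogonal_basis N I e"
    unfolding orthogonal_basis_def nsp top using e0 ip_e edense by auto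
  moreover have "separable_hilbert_norm (norm :: 'h \<Rightarrow> real)"
    by (rule separable_hilbert_norm_equivalent[OF ip1 _ _ _ _ met1 sep, of 1 1]) (auto simp: norm_eq_sqrt_inner)
  moreover have "separable_hilbert_norm N"
    by (rule separable_hilbert_norm_equivalent[OF ip N_ip \<open>1 / B > 0\<close> low up met sep])
  ultimately have "N \<in> admissible_norms"
    unfolding admissible_norms_def FHS_equivalent_def top1 mem_Collect_eq by (auto simp: top)
  moreover have "norm_scalar_product N (x i) (x j) = of_bool (i = j)" for i j
    using VU[of "u i"] VU[of "u j"] by (simp add: nsp ip_def Uu o)
  ultimately show ?thesis by (rule that)
qed

section \<open>Density of trigonometric polynomials\<close>

text \<open>The numbering of the system: index 0 is the constant, \<open>2 * k\<close> the cosine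
  and \<open>2 * k - 1\<close> the sine of frequency \<open>k\<close>.\<close>

definition trig_freq :: "nat \<Rightarrow> nat" where
  "trig_freq i = (i + 1) div 2"

definition trig_basis :: "real \<Rightarrow> nat \<Rightarrow> real \<Rightarrow> real" where
  "trig_basis P i t = (if even i then cos else sin) (2 * pi * trig_freq i * t / P)"

definition trig_poly :: "real \<Rightarrow> (real \<Rightarrow> real) \<Rightarrow> bool" where
  "trig_poly P g \<longleftrightarrow> (\<exists>n c. \<forall>t. g t = (\<Sum>i<n. c i * trig_basis P i t))"

lemma trig_basis_simps:
  "trig_basis P (2 * k) t = cos (2 * pi * k * t / P)"
  "trig_basis P (Suc (2 * k)) t = sin (2 * pi * (k + 1) * t / P)"
  by (simp_all add: trig_basis_def trig_freq_def)

lemma trig_poly_add: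
  assumes "trig_poly P g" "trig_poly P h"
  shows "trig_poly P (\<lambda>t. g t + h t)"
proof -
  obtain n c where c: "\<And>t. g t = (\<Sum>i<n. c i * trig_basis P i t)"
    using assms(1) unfolding trig_poly_def by blast
  obtain m d where d: "\<And>t. h t = (\<Sum>i<m. d i * trig_basis P i t)"
    using assms(2) unfolding trig_poly_def by blast
  define e where "e i = (if i < n then c i else 0) + (if i < m then d i else 0)" for i
  have "g t + h t = (\<Sum>i<max n m. e i * trig_basis P i t)" for t
  proof -
    have "g t = (\<Sum>i<max n m. (if i < n then c i else 0) * trig_basis P i t)"
      unfolding c by (intro sum.mono_neutral_cong_left) auto
    moreover have "h t = (\<Sum>i<max n m. (if i < m then d i else 0) * trig_basis P i t)"
      unfolding d by (intro sum.mono_neutral_cong_left) auto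
    ultimately show ?thesis by (simp add: e_def sum.distrib distrib_right)
  qed
  then show ?thesis unfolding trig_poly_def by blast
qed

lemma trig_poly_scale:
  assumes "trig_poly P g"
  shows "trig_poly P (\<lambda>t. a * g t)"
proof -
  obtain n c where c: "\<And>t. g t = (\<Sum>i<n. c i * trig_basis P i t)"
    using assms unfolding trig_poly_def by blast
  have "a * g t = (\<Sum>i<n. (a * c i) * trig_basis P i t)" for t
    unfolding c by (simp add: sum_distrib_left mult_ac)
  then show ?thesis unfolding trig_poly_def by (intro exI allI)
qed

lemma trig_poly_sum:
  assumes "finite S" "\<And>i. i \<in> S \<Longrightarrow> trig_poly P (g i)"
  shows "trig_poly P (\<lambda>t. \<Sum>i\<in>S. g i t)"
  using assms
proof (induction S)
  case empty
  show ?case unfolding trig_poly_def by (intro exI[of _ 0]) simp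
qed (simp add: trig_poly_add)

lemma trig_poly_basis: "trig_poly P (trig_basis P k)"
proof -
  have "trig_basis P k t = (\<Sum>i<Suc k. of_bool (i = k) * trig_basis P i t)" for t
    by (simp add: of_bool_def if_distrib[of "\<lambda>s. s * _"] cong: if_cong)
  then show ?thesis unfolding trig_poly_def by (intro exI[of _ "Suc k"] exI allI)
qed

lemma trig_poly_cos: "trig_poly P (\<lambda>t. cos (2 * pi * of_int k * t / P))"
proof -
  have "cos (2 * pi * of_int k * t / P) = cos (2 * pi * of_nat (nat \<bar>k\<bar>) * t / P)" for t
    using cos_minus[of "2 * pi * of_int k * t / P"] by (cases "0 \<le> k") simp_all
  moreover have "trig_poly P (\<lambda>t. cos (2 * pi * of_nat (nat \<bar>k\<bar>) * t / P))"
    using trig_poly_basis[of P "2 * nat \<bar>k\<bar>"] by (simp add: trig_basis_simps[abs_def])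
  ultimately show ?thesis by simp
qed

lemma trig_poly_sin: "trig_poly P (\<lambda>t. sin (2 * pi * of_int k * t / P))"
proof (cases "k = 0")
  case True
  then show ?thesis using trig_poly_scale[OF trig_poly_basis[of P 0], of 0] by simp
next
  case False
  \<comment> \<open>Sines start at frequency 1, which sits at index 1; hence the shift by
    one.\<close>
  define m where "m = nat (\<bar>k\<bar> - 1)"
  have m: "real m + 1 = \<bar>of_int k\<bar>" using False by (simp add: m_def)
  have "sin (2 * pi * of_int k * t / P) = of_int (sgn k) * sin (2 * pi * (real m + 1) * t / P)" for t
    unfolding m using False by (cases "0 < k") (simp_all add: abs_if)
  moreover have "trig_poly P (\<lambda>t. of_int (sgn k) * sin (2 * pi * (real m + 1) * t / P))"
    using trig_poly_scale[OF trig_poly_basis[of P "Suc (2 * m)"], of "of_int (sgn k)"]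
    by (simp add: trig_basis_simps[abs_def] add.commute)
  ultimately show ?thesis by simp
qed

lemma trig_basis_cases:
  obtains k :: int where "trig_basis P i = (\<lambda>t. cos (2 * pi * of_int k * t / P))"
  | k :: int where "trig_basis P i = (\<lambda>t. sin (2 * pi * of_int k * t / P))"
  using that[of "int (trig_freq i)"] unfolding trig_basis_def[abs_def] by (cases "even i") auto

lemma trig_poly_basis_mult: "trig_poly P (\<lambda>t. trig_basis P i t * trig_basis P j t)"
proof -
  have c: "trig_poly P (\<lambda>t. (cos (2 * pi * of_int k * t / P) + s * cos (2 * pi * of_int l * t / P)) / 2)" for k l s
    using trig_poly_scale[OF trig_poly_add[OF trig_poly_cos[of P k] trig_poly_scale[OF trig_poly_cos[of P l], of s]], of "1/2"] by simp
  have s: "trig_poly P (\<lambda>t. (sin (2 * pi * of_int k * t / P) + s * sin (2 * pi * of_int l * t / P)) / 2)" for k l s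
    using trig_poly_scale[OF trig_poly_add[OF trig_poly_sin[of P k] trig_poly_scale[OF trig_poly_sin[of P l], of s]], of "1/2"] by simp
  have e: "2 * pi * of_int k * t / P + 2 * pi * of_int l * t / P = 2 * pi * of_int (k + l) * t / P"
    "2 * pi * of_int k * t / P - 2 * pi * of_int l * t / P = 2 * pi * of_int (k - l) * t / P" for k l t
    by (simp_all add: field_simps diff_divide_distrib add_divide_distrib)
  have "trig_poly P (\<lambda>t. cos (2 * pi * of_int k * t / P) * cos (2 * pi * of_int l * t / P))" for k l
    unfolding cos_times_cos e using c[of "k - l" 1 "k + l"] by simp
  moreover have "trig_poly P (\<lambda>t. cos (2 * pi * of_int k * t / P) * sin (2 * pi * of_int l * t / P))" for k l
    unfolding cos_times_sin e using s[of "k + l" "-1" "k - l"] by simp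
  moreover have "trig_poly P (\<lambda>t. sin (2 * pi * of_int k * t / P) * cos (2 * pi * of_int l * t / P))" for k l
    unfolding sin_times_cos e using s[of "k + l" 1 "k - l"] by simp
  moreover have "trig_poly P (\<lambda>t. sin (2 * pi * of_int k * t / P) * sin (2 * pi * of_int l * t / P))" for k l
    unfolding sin_times_sin e using c[of "k - l" "-1" "k + l"] by simp
  ultimately show ?thesis
    by (cases i rule: trig_basis_cases[of P]; cases j rule: trig_basis_cases[of P]) simp_all
qed

lemma trig_poly_mult:
  assumes "trig_poly P g" "trig_poly P h"
  shows "trig_poly P (\<lambda>t. g t * h t)"
proof -
  obtain n c where c: "\<And>t. g t = (\<Sum>i<n. c i * trig_basis P i t)"
    using assms(1) unfolding trig_poly_def by blast
  obtain m d where d: "\<And>t. h t = (\<Sum>i<m. d i * trig_basis P i t)"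
    using assms(2) unfolding trig_poly_def by blast
  have "g t * h t = (\<Sum>i<n. \<Sum>j<m. (c i * d j) * (trig_basis P i t * trig_basis P j t))" for t
    unfolding c d sum_product by (simp add: mult_ac)
  then show ?thesis
    by (simp del: sum_product) (intro trig_poly_sum trig_poly_scale trig_poly_basis_mult finite_lessThan)
qed

text \<open>On the unit circle a real-linear function is a combination of cosine and sine, and
  trigonometric polynomials are closed under sums and products.\<close>

lemma trig_poly_real_polynomial_function:
  fixes g :: "complex \<Rightarrow> real"
  assumes "real_polynomial_function g"
  shows "trig_poly P (\<lambda>t. g (cis (2 * pi * t / P)))"
  using assms
proof induction
  case (linear f)
  interpret bounded_linear f by fact
  have "f (cis x) = f 1 * cos x + f \<i> * sin x" for x
  proof -
    have "cis x = cos x *\<^sub>R 1 + sin x *\<^sub>R \<i>" by (simp add: complex_eq_iff)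
    then show ?thesis by (simp add: add scaleR mult.commute)
  qed
  then show ?case
    using trig_poly_add[OF trig_poly_scale[OF trig_poly_cos[of P 1], of "f 1"] trig_poly_scale[OF trig_poly_sin[of P 1], of "f \<i>"]]
    by simp
next
  case (const c)
  show ?case using trig_poly_scale[OF trig_poly_cos[of P 0], of c] by simp
qed (auto intro: trig_poly_add trig_poly_mult)

text \<open>The condition \<open>k 0 = k P\<close> lets \<open>k\<close> descend to the unit circle,
  where Stone-Weierstrass for real polynomials in the plane applies.\<close>

lemma trig_poly_uniform_approx:
  assumes P: "0 < P" and k: "continuous_on {0..P} k" "k 0 = k P" and e: "0 < e"
  obtains q where "trig_poly P q" "\<And>t. t \<in> {0..P} \<Longrightarrow> \<bar>k t - q t\<bar> < e"
proof -
  define E where "E t = cis (2 * pi * t / P)" for t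
  define F where "F z = k (P * Arg2pi z / (2 * pi))" for z
  have FE: "F (E t) = k t" if t: "t \<in> {0..P}" for t
  proof (cases "t = P")
    case True
    then have "E t = 1" using P by (simp add: E_def complex_eq_iff)
    moreover have "Arg2pi 1 = 0" by (simp add: Arg2pi_eq_0)
    ultimately show ?thesis using True k(2) by (simp add: F_def)
  next
    case False
    then have "2 * pi * t / P < 2 * pi" "0 \<le> 2 * pi * t / P" using t P by (auto simp: field_simps)
    then have "Arg2pi (E t) = 2 * pi * t / P"
      using Arg2pi_unique[of 1 "2 * pi * t / P" "E t"] by (simp add: E_def cis_conv_exp)
    then show ?thesis using P by (simp add: F_def)
  qed
  have EI: "E ` {0..P} = sphere 0 1"
  proof (safe)
    fix z :: complex assume z: "z \<in> sphere 0 1"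
    then have "z = E (P * Arg2pi z / (2 * pi))"
      using P Arg2pi[of z] by (simp add: E_def cis_conv_exp is_Arg_def)
    moreover have "P * Arg2pi z / (2 * pi) \<in> {0..P}"
      using Arg2pi[of z] P by (auto simp: field_simps less_imp_le)
    ultimately show "z \<in> E ` {0..P}" by blast
  qed (simp add: E_def)
  have Ec: "continuous_on {0..P} E" unfolding E_def cis_conv_exp by (intro continuous_intros) (use P in auto)
  \<comment> \<open>\<open>Arg2pi\<close> jumps at 1, so continuity is not inherited through the
    formula for \<open>F\<close>. Instead, preimages of closed sets under \<open>F\<close> are
    images of compact sets under \<open>E\<close>.\<close>
  have "continuous_on (sphere 0 1) F"
    unfolding continuous_on_closed_vimage[OF closed_sphere]
  proof (intro allI impI)
    fix C :: "real set" assume "closed C"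
    then have "closed (k -` C \<inter> {0..P})"
      using k(1) by (simp add: continuous_on_closed_vimage)
    then have "compact ((k -` C \<inter> {0..P}) \<inter> {0..P})"
      by (rule closed_Int_compact) simp
    then have "compact (k -` C \<inter> {0..P})" by (simp add: Int_assoc)
    then have "compact (E ` (k -` C \<inter> {0..P}))"
      by (intro compact_continuous_image continuous_on_subset[OF Ec]) auto
    moreover have "E ` (k -` C \<inter> {0..P}) = F -` C \<inter> sphere 0 1"
      using FE unfolding EI[symmetric] by auto
    ultimately show "closed (F -` C \<inter> sphere 0 1)" using compact_imp_closed by simp
  qed
  then have "\<exists>g. real_polynomial_function g \<and> (\<forall>z\<in>sphere 0 1. \<bar>F z - g z\<bar> < e)"
    by (rule Stone_Weierstrass_real_polynomial_function[OF compact_sphere _ e]) blast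
  then obtain g where g: "real_polynomial_function g" "\<And>z. z \<in> sphere 0 1 \<Longrightarrow> \<bar>F z - g z\<bar> < e"
    by auto
  show ?thesis
  proof (rule that)
    show "trig_poly P (\<lambda>t. g (E t))"
      unfolding E_def by (rule trig_poly_real_polynomial_function[OF g(1)])
    fix t assume t: "t \<in> {0..P}"
    have "E t \<in> sphere 0 1" unfolding EI[symmetric] using t by blast
    then show "\<bar>k t - g (E t)\<bar> < e" using g(2)[of "E t"] FE[OF t] by simp
  qed
qed

section \<open>From uniform to mean square approximation\<close>

lemma L2_functionsD:
  assumes "f \<in> L2_functions P"
  shows "(\<lambda>t. indicator {0<..<P} t * f t) \<in> borel_measurable lborel"
    and "integrable lborel (\<lambda>t. (indicator {0<..<P} t * f t)\<^sup>2)"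
proof -
  have "(indicator {0<..<P} t * f t)\<^sup>2 = indicator {0<..<P} t *\<^sub>R (f t)\<^sup>2" for t
    by (simp add: indicator_def)
  then show "integrable lborel (\<lambda>t. (indicator {0<..<P} t * f t)\<^sup>2)"
    using assms by (simp add: L2_functions_def set_integrable_def)
  show "(\<lambda>t. indicator {0<..<P} t * f t) \<in> borel_measurable lborel"
    using assms by (simp add: L2_functions_def set_borel_measurable_def)
qed

lemma tendsto_integral_square_0:
  fixes g :: "nat \<Rightarrow> real \<Rightarrow> real"
  assumes "\<And>n. g n \<in> borel_measurable lborel" "integrable lborel w"
    and lim: "AE t in lborel. (\<lambda>n. g n t) \<longlonglongrightarrow> 0" and le: "\<And>n t. (g n t)\<^sup>2 \<le> w t"
  shows "(\<lambda>n. LINT t|lborel. (g n t)\<^sup>2) \<longlonglongrightarrow> 0"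
proof -
  have "(\<lambda>n. LINT t|lborel. (g n t)\<^sup>2) \<longlonglongrightarrow> (LINT t|(lborel :: real measure). 0)"
  proof (rule integral_dominated_convergence[of _ _ _ w])
    show "AE t in lborel. (\<lambda>n. (g n t)\<^sup>2) \<longlonglongrightarrow> 0"
      using lim
    proof eventually_elim
      case (elim t)
      show ?case using tendsto_power[OF elim, of 2] by simp
    qed
  qed (use assms in auto)
  then show ?thesis by simp
qed

lemma integrable_indicator_Ioo: "integrable lborel (indicator {a<..<b::real} :: real \<Rightarrow> real)"
  by (rule integrable_real_indicator) (cases "a \<le> b"; simp)+

lemma integrable_power2_bounded:
  fixes h :: "real \<Rightarrow> real"
  assumes "h \<in> borel_measurable lborel" "\<And>t. \<bar>h t\<bar> \<le> M" "\<And>t. t \<notin> {0<..<P} \<Longrightarrow> h t = 0"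
  shows "integrable lborel (\<lambda>t. (h t)\<^sup>2)"
proof (rule Bochner_Integration.integrable_bound)
  show "integrable lborel (\<lambda>t. M\<^sup>2 * indicator {0<..<P} t)" by (simp add: integrable_indicator_Ioo)
  show "AE t in lborel. norm ((h t)\<^sup>2) \<le> norm (M\<^sup>2 * indicator {0<..<P} t)"
    using assms(2,3) by (auto simp: indicator_def abs_le_square_iff[symmetric] intro!: AE_I2)
      (metis abs_ge_zero abs_of_nonneg order_trans)
qed (use assms(1) in simp)

text \<open>Three approximations in turn: truncation to bounded values, a continuous function
  vanishing at the endpoints, and a uniform approximation of the latter. Each costs less than
  \<open>e / 9\<close>, because the square of a sum of three terms is at most 3 times the sum of
  their squares.\<close>

lemma trig_poly_dense:
  assumes P: "0 < P" and f: "f \<in> L2_functions P" and e: "0 < e"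
  obtains q where "trig_poly P q" "(LINT t|lborel. (indicator {0<..<P} t * (f t - q t))\<^sup>2) < e"
    "integrable lborel (\<lambda>t. (indicator {0<..<P} t * (f t - q t))\<^sup>2)"
proof -
  define F where "F t = indicator {0<..<P} t * f t" for t
  have Fm: "F \<in> borel_measurable lborel" and FI: "integrable lborel (\<lambda>t. (F t)\<^sup>2)"
    using L2_functionsD[OF f] unfolding F_def[abs_def] .
  define clip :: "real \<Rightarrow> real \<Rightarrow> real" where "clip M s = max (- M) (min M s)" for M s
  have clip_meas: "(\<lambda>t. clip M (h t)) \<in> borel_measurable lborel" if "h \<in> borel_measurable lborel" for M h
    using that unfolding clip_def by measurable
  have clip_cont: "isCont (clip M) s" for M s unfolding clip_def[abs_def] by (intro continuous_intros)
  have clip_le: "\<bar>clip M s\<bar> \<le> M" if "0 \<le> M" for M s using that by (auto simp: clip_def)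
  have "(\<lambda>n. LINT t|lborel. (F t - clip (real n) (F t))\<^sup>2) \<longlonglongrightarrow> 0"
  proof (rule tendsto_integral_square_0[OF _ FI])
    show "(\<lambda>t. F t - clip (real n) (F t)) \<in> borel_measurable lborel" for n
      using Fm clip_meas[OF Fm] by measurable
    show "AE t in lborel. (\<lambda>n. F t - clip (real n) (F t)) \<longlonglongrightarrow> 0"
    proof (intro AE_I2 tendsto_eventually)
      fix t
      obtain n where n: "\<bar>F t\<bar> \<le> real n" using real_arch_simple by blast
      show "eventually (\<lambda>n. F t - clip (real n) (F t) = 0) sequentially"
        using eventually_ge_at_top[of n] by eventually_elim (use n in \<open>auto simp: clip_def\<close>)
    qed
    show "(F t - clip (real n) (F t))\<^sup>2 \<le> (F t)\<^sup>2" for n t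
      unfolding abs_le_square_iff[symmetric] by (auto simp: clip_def)
  qed
  then have "eventually (\<lambda>n. (LINT t|lborel. (F t - clip (real n) (F t))\<^sup>2) < e / 9) sequentially"
    by (rule order_tendstoD) (use e in simp)
  then obtain M :: nat where M: "(LINT t|lborel. (F t - clip (real M) (F t))\<^sup>2) < e / 9"
    by (auto simp: eventually_sequentially)
  define G where "G t = clip (real M) (F t)" for t
  have Gm: "G \<in> borel_measurable lborel" unfolding G_def[abs_def] by (rule clip_meas[OF Fm])
  have G0: "G t = 0" if "t \<notin> {0<..<P}" for t using that by (simp add: G_def F_def clip_def)
  have GM: "\<bar>G t\<bar> \<le> M" for t unfolding G_def by (rule clip_le) simp
  have FG_I: "integrable lborel (\<lambda>t. (F t - G t)\<^sup>2)"
  proof (rule Bochner_Integration.integrable_bound[OF FI])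
    show "AE t in lborel. norm ((F t - G t)\<^sup>2) \<le> norm ((F t)\<^sup>2)"
      by (intro AE_I2) (auto simp: abs_le_square_iff[symmetric] G_def clip_def)
  qed (use Fm Gm in measurable)
  \<comment> \<open>Measurability in the sense of \<open>measurable_on\<close> provides continuous
    functions converging to \<open>G\<close> almost everywhere.\<close>
  have "G \<in> borel_measurable (lebesgue_on UNIV)"
    using measurable_completion[OF Gm] by (simp add: lebesgue_on_UNIV_eq)
  then have "G measurable_on UNIV" by (subst measurable_on_iff_borel_measurable) auto
  then obtain N h where N: "negligible N" and hc: "\<And>n::nat. continuous_on UNIV (h n)"
    and hG: "\<And>t. t \<notin> N \<Longrightarrow> (\<lambda>n. h n t) \<longlonglongrightarrow> G t"
    unfolding measurable_on_def by auto
  have AE_h: "AE t in lborel. (\<lambda>n. h n t) \<longlonglongrightarrow> G t"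
  proof -
    have "N \<in> null_sets lebesgue" using N by (simp add: negligible_iff_null_sets)
    then have "AE t in lebesgue. t \<notin> N" by (rule AE_not_in)
    then have "AE t in lborel. t \<notin> N" by (simp add: AE_completion_iff)
    then show ?thesis by eventually_elim (rule hG)
  qed
  \<comment> \<open>A cut-off that is 0 outside \<open>(0, P)\<close> and eventually 1 at each
    interior point; it secures equal values at 0 and \<open>P\<close>, as approximation by periodic
    functions demands.\<close>
  define p where "p n t = max 0 (min 1 (real n * min t (P - t)))" for n t
  define k where "k n t = p n t * clip (real M) (h n t)" for n t
  have kc: "continuous_on UNIV (k n)" for n
    unfolding k_def[abs_def] p_def clip_def using hc[of n] by (intro continuous_intros)
  have km: "k n \<in> borel_measurable lborel" for n
    using borel_measurable_continuous_onI[OF kc[of n]] by simp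
  have k0: "k n t = 0" if "t \<notin> {0<..<P}" for n t
  proof -
    have "min t (P - t) \<le> 0" using that by auto
    then have "real n * min t (P - t) \<le> 0" by (simp add: mult_nonneg_nonpos)
    then show ?thesis by (simp add: k_def p_def)
  qed
  have kM: "\<bar>k n t\<bar> \<le> M" for n t
  proof -
    have "\<bar>p n t\<bar> * \<bar>clip (real M) (h n t)\<bar> \<le> 1 * real M"
      by (intro mult_mono clip_le) (auto simp: p_def)
    then show ?thesis by (simp add: k_def abs_mult)
  qed
  have "(\<lambda>n. LINT t|lborel. (G t - k n t)\<^sup>2) \<longlonglongrightarrow> 0"
  proof (rule tendsto_integral_square_0[of _ "\<lambda>t. (2 * real M)\<^sup>2 * indicator {0<..<P} t"])
    show "(\<lambda>t. G t - k n t) \<in> borel_measurable lborel" for n using Gm km[of n] by measurable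
    show "integrable lborel (\<lambda>t. (2 * real M)\<^sup>2 * indicator {0<..<P} t)" by (simp add: integrable_indicator_Ioo)
    show "(G t - k n t)\<^sup>2 \<le> (2 * real M)\<^sup>2 * indicator {0<..<P} t" for n t
    proof (cases "t \<in> {0<..<P}")
      case True
      have "\<bar>G t - k n t\<bar> \<le> \<bar>2 * real M\<bar>" using GM[of t] kM[of n t] by linarith
      then have "(G t - k n t)\<^sup>2 \<le> (2 * real M)\<^sup>2" by (simp only: abs_le_square_iff)
      then show ?thesis using True by simp
    qed (simp add: G0 k0)
    show "AE t in lborel. (\<lambda>n. G t - k n t) \<longlonglongrightarrow> 0"
      using AE_h
    proof eventually_elim
      case (elim t)
      show ?case
      proof (cases "t \<in> {0<..<P}")
        case True
        then have pos: "0 < min t (P - t)" by simp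
        obtain n0 :: nat where n0: "1 / min t (P - t) \<le> n0" using real_arch_simple by blast
        have "eventually (\<lambda>n. p n t = 1) sequentially"
          using eventually_ge_at_top[of n0]
        proof eventually_elim
          case (elim n)
          then have "1 / min t (P - t) \<le> real n" using n0 by linarith
          then have "1 \<le> real n * min t (P - t)" using pos by (simp only: pos_divide_le_eq)
          then show ?case by (simp add: p_def)
        qed
        then have "(\<lambda>n. p n t) \<longlonglongrightarrow> 1" by (rule tendsto_eventually)
        moreover have "(\<lambda>n. clip (real M) (h n t)) \<longlonglongrightarrow> clip (real M) (G t)"
          by (rule isCont_tendsto_compose[OF clip_cont elim])
        moreover have "clip (real M) (G t) = G t" using GM[of t] by (auto simp: clip_def)
        ultimately have "(\<lambda>n. k n t) \<longlonglongrightarrow> 1 * G t"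
          unfolding k_def by (metis tendsto_mult)
        then have "(\<lambda>n. G t - k n t) \<longlonglongrightarrow> G t - 1 * G t" by (intro tendsto_intros)
        then show ?thesis by simp
      qed (simp add: G0 k0)
    qed
  qed
  then have "eventually (\<lambda>n. (LINT t|lborel. (G t - k n t)\<^sup>2) < e / 9) sequentially"
    by (rule order_tendstoD) (use e in simp)
  then obtain n where n: "(LINT t|lborel. (G t - k n t)\<^sup>2) < e / 9"
    by (auto simp: eventually_sequentially)
  have Gk_I: "integrable lborel (\<lambda>t. (G t - k n t)\<^sup>2)"
  proof (rule integrable_power2_bounded[of _ "2 * real M" P])
    show "\<bar>G t - k n t\<bar> \<le> 2 * real M" for t using GM[of t] kM[of n t] by linarith
  qed (use Gm km[of n] G0 k0 in auto)
  \<comment> \<open>Then \<open>d\<^sup>2 * P = e / 18\<close> bounds the mean square cost of a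
    uniform error \<open>d\<close>.\<close>
  define d where "d = sqrt (e / (18 * P))"
  have d: "0 < d" "d\<^sup>2 * P < e / 9" using e P by (simp_all add: d_def field_simps)
  have "k n 0 = k n P" using k0[of 0 n] k0[of P n] by simp
  then obtain q where q: "trig_poly P q" "\<And>t. t \<in> {0..P} \<Longrightarrow> \<bar>k n t - q t\<bar> < d"
    using trig_poly_uniform_approx[OF P continuous_on_subset[OF kc] _ d(1)] by (metis subset_UNIV)
  obtain m c where c: "\<And>t. q t = (\<Sum>i<m. c i * trig_basis P i t)" using q(1) unfolding trig_poly_def by blast
  have qc: "continuous_on UNIV q"
  proof -
    have "continuous_on UNIV (trig_basis P i)" for i
      unfolding trig_basis_def[abs_def] by (cases "even i"; simp; intro continuous_intros) (use P in auto)
    then show ?thesis unfolding c[abs_def] by (intro continuous_intros)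
  qed
  have qm: "q \<in> borel_measurable lborel" using borel_measurable_continuous_onI[OF qc] by simp
  define Q where "Q t = indicator {0<..<P} t * (k n t - q t)" for t
  have Qm: "Q \<in> borel_measurable lborel" unfolding Q_def[abs_def] using km[of n] qm by measurable
  have Qd: "\<bar>Q t\<bar> \<le> d" for t
    using q(2)[of t] d(1) by (cases "t \<in> {0<..<P}") (auto simp: Q_def less_imp_le)
  have Q_I: "integrable lborel (\<lambda>t. (Q t)\<^sup>2)"
    by (rule integrable_power2_bounded[OF Qm Qd, where P = P]) (simp add: Q_def)
  have "(LINT t|lborel. (Q t)\<^sup>2) \<le> (LINT t|lborel. d\<^sup>2 * indicator {0<..<P} t)"
  proof (rule integral_mono[OF Q_I])
    show "(Q t)\<^sup>2 \<le> d\<^sup>2 * indicator {0<..<P} t" for t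
      using Qd[of t] d(1) by (cases "t \<in> {0<..<P}") (auto simp: abs_le_square_iff[symmetric] Q_def)
  qed (simp add: integrable_indicator_Ioo)
  also have "\<dots> = d\<^sup>2 * P" using P by simp
  finally have Q_le: "(LINT t|lborel. (Q t)\<^sup>2) < e / 9" using d(2) by linarith
  let ?D = "\<lambda>t. indicator {0<..<P} t * (f t - q t)"
  have D_eq: "?D t = (F t - G t) + (G t - k n t) + Q t" for t
    using G0[of t] k0[of t n] by (cases "t \<in> {0<..<P}") (auto simp: F_def Q_def)
  have sq3: "(x + y + z)\<^sup>2 \<le> 3 * (x\<^sup>2 + y\<^sup>2 + z\<^sup>2)" for x y z :: real
    using sum_squares_bound[of x y] sum_squares_bound[of y z] sum_squares_bound[of x z]
    by (simp add: power2_eq_square algebra_simps)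
  have le: "(?D t)\<^sup>2 \<le> 3 * ((F t - G t)\<^sup>2 + (G t - k n t)\<^sup>2 + (Q t)\<^sup>2)" for t
    unfolding D_eq by (rule sq3)
  have I3: "integrable lborel (\<lambda>t. 3 * ((F t - G t)\<^sup>2 + (G t - k n t)\<^sup>2 + (Q t)\<^sup>2))"
    using FG_I Gk_I Q_I by simp
  have Dm: "?D \<in> borel_measurable lborel"
    unfolding D_eq[abs_def] using Fm Gm km[of n] Qm by measurable
  have D_I: "integrable lborel (\<lambda>t. (?D t)\<^sup>2)"
  proof (rule Bochner_Integration.integrable_bound[OF I3])
    show "AE t in lborel. norm ((?D t)\<^sup>2) \<le> norm (3 * ((F t - G t)\<^sup>2 + (G t - k n t)\<^sup>2 + (Q t)\<^sup>2))"
      using le by (intro AE_I2) simp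
  qed (use Dm in measurable)
  have "(LINT t|lborel. (?D t)\<^sup>2) \<le> (LINT t|lborel. 3 * ((F t - G t)\<^sup>2 + (G t - k n t)\<^sup>2 + (Q t)\<^sup>2))"
    by (rule integral_mono[OF D_I I3 le])
  also have "\<dots> = 3 * ((LINT t|lborel. (F t - G t)\<^sup>2) + (LINT t|lborel. (G t - k n t)\<^sup>2) + (LINT t|lborel. (Q t)\<^sup>2))"
    using FG_I Gk_I Q_I by simp
  also have "\<dots> < e"
  proof -
    have "x < e / 9 \<Longrightarrow> y < e / 9 \<Longrightarrow> z < e / 9 \<Longrightarrow> 3 * (x + y + z) < e" for x y z using e by simp
    then show ?thesis using M[folded G_def] n Q_le by blast
  qed
  finally show ?thesis using that q(1) D_I by blast
qed

section \<open>Quadratic forms with a difference kernel\<close>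

definition kernel_form :: "(real \<Rightarrow> real) \<Rightarrow> (real \<Rightarrow> real) \<Rightarrow> (real \<Rightarrow> real) \<Rightarrow> real" where
  "kernel_form A F G = (LINT p|(lborel \<Otimes>\<^sub>M lborel). F (fst p) * G (snd p) * A (fst p - snd p))"

lemma integrable_shift:
  fixes A :: "real \<Rightarrow> real"
  assumes "integrable lborel A"
  shows "integrable lborel (\<lambda>s. A (s - t))" "(LINT s|lborel. A (s - t)) = (LINT s|lborel. A s)"
    "integrable lborel (\<lambda>s. A (t - s))" "(LINT s|lborel. A (t - s)) = (LINT s|lborel. A s)"
  using lborel_integrable_real_affine[OF assms, of 1 "- t"] lborel_integral_real_affine[of 1 A "- t"]
    lborel_integrable_real_affine[OF assms, of "-1" t] lborel_integral_real_affine[of "-1" A t]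
  by simp_all

lemma integrable_fst_kernel:
  fixes A F :: "real \<Rightarrow> real"
  assumes A: "integrable lborel A" and F: "integrable lborel F"
  shows "integrable (lborel \<Otimes>\<^sub>M lborel) (\<lambda>p. F (fst p) * A (fst p - snd p))"
    and "(LINT p|(lborel \<Otimes>\<^sub>M lborel). F (fst p) * A (fst p - snd p)) = (LINT s|lborel. F s) * (LINT s|lborel. A s)"
proof -
  have [measurable]: "A \<in> borel_measurable lborel" "F \<in> borel_measurable lborel" using A F by auto
  show i: "integrable (lborel \<Otimes>\<^sub>M lborel) (\<lambda>p. F (fst p) * A (fst p - snd p))"
  proof (rule lborel_pair.Fubini_integrable)
    have "(LINT t|lborel. norm (F (fst (s, t)) * A (fst (s, t) - snd (s, t)))) = \<bar>F s\<bar> * (LINT t|lborel. \<bar>A t\<bar>)" for s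
      using integrable_shift(4)[of "\<lambda>t. \<bar>A t\<bar>" s] A by (simp add: abs_mult)
    then show "integrable lborel (\<lambda>s. LINT t|lborel. norm (F (fst (s, t)) * A (fst (s, t) - snd (s, t))))"
      using F by simp
    show "AE s in lborel. integrable lborel (\<lambda>t. F (fst (s, t)) * A (fst (s, t) - snd (s, t)))"
      using integrable_shift(3)[OF A] by (intro AE_I2) simp
  qed measurable
  show "(LINT p|(lborel \<Otimes>\<^sub>M lborel). F (fst p) * A (fst p - snd p)) = (LINT s|lborel. F s) * (LINT s|lborel. A s)"
    using lborel_pair.integral_fst'[OF i] integrable_shift(4)[OF A] by simp
qed

lemma integrable_snd_kernel:
  fixes A F :: "real \<Rightarrow> real"
  assumes A: "integrable lborel A" and F: "integrable lborel F"
  shows "integrable (lborel \<Otimes>\<^sub>M lborel) (\<lambda>p. F (snd p) * A (fst p - snd p))"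
    and "(LINT p|(lborel \<Otimes>\<^sub>M lborel). F (snd p) * A (fst p - snd p)) = (LINT s|lborel. F s) * (LINT s|lborel. A s)"
proof -
  have A': "integrable lborel (\<lambda>s. A (- s))" "(LINT s|lborel. A (- s)) = (LINT s|lborel. A s)"
    using integrable_shift(3,4)[OF A, of 0] by simp_all
  note i = integrable_fst_kernel[OF A'(1) F]
  have eq: "(\<lambda>(x, y). (\<lambda>p. F (fst p) * A (- (fst p - snd p))) (y, x)) = (\<lambda>p. F (snd p) * A (fst p - snd p))"
    by (simp add: fun_eq_iff)
  show "integrable (lborel \<Otimes>\<^sub>M lborel) (\<lambda>p. F (snd p) * A (fst p - snd p))"
    using lborel_pair.integrable_product_swap[OF i(1)] unfolding eq .
  show "(LINT p|(lborel \<Otimes>\<^sub>M lborel). F (snd p) * A (fst p - snd p)) = (LINT s|lborel. F s) * (LINT s|lborel. A s)"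
    using lborel_pair.integral_product_swap[OF borel_measurable_integrable[OF i(1)]] i(2) A'(2)
    unfolding eq by simp
qed

text \<open>\<open>2 * \<bar>F\<bar> * \<bar>G\<bar> <= F^2 + G^2\<close> decouples the two
  variables, and translation invariance evaluates each integral. The bound is a sum, not a product
  of norms; where homogeneity matters, the arguments are rescaled first.\<close>

lemma kernel_form_Young:
  fixes A F G :: "real \<Rightarrow> real"
  assumes A: "integrable lborel A"
    and F: "F \<in> borel_measurable lborel" "integrable lborel (\<lambda>s. (F s)\<^sup>2)"
    and G: "G \<in> borel_measurable lborel" "integrable lborel (\<lambda>s. (G s)\<^sup>2)"
  shows "integrable (lborel \<Otimes>\<^sub>M lborel) (\<lambda>p. F (fst p) * G (snd p) * A (fst p - snd p))"
    and "\<bar>kernel_form A F G\<bar> \<le> (LINT s|lborel. \<bar>A s\<bar>) * ((LINT s|lborel. (F s)\<^sup>2) + (LINT s|lborel. (G s)\<^sup>2)) / 2"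
proof -
  have [measurable]: "A \<in> borel_measurable lborel" using A by auto
  note [measurable] = F(1) G(1)
  let ?g = "\<lambda>p. ((F (fst p))\<^sup>2 * \<bar>A (fst p - snd p)\<bar> + (G (snd p))\<^sup>2 * \<bar>A (fst p - snd p)\<bar>) / 2"
  have A': "integrable lborel (\<lambda>s. \<bar>A s\<bar>)" using A by simp
  have g: "integrable (lborel \<Otimes>\<^sub>M lborel) ?g"
    using integrable_fst_kernel(1)[OF A' F(2)] integrable_snd_kernel(1)[OF A' G(2)] by simp
  have gi: "(LINT p|(lborel \<Otimes>\<^sub>M lborel). ?g p) = (LINT s|lborel. \<bar>A s\<bar>) * ((LINT s|lborel. (F s)\<^sup>2) + (LINT s|lborel. (G s)\<^sup>2)) / 2"
    using integrable_fst_kernel[OF A' F(2)] integrable_snd_kernel[OF A' G(2)] by (simp add: algebra_simps)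
  have le: "\<bar>F (fst p) * G (snd p) * A (fst p - snd p)\<bar> \<le> ?g p" for p
  proof -
    have "2 * \<bar>F (fst p)\<bar> * \<bar>G (snd p)\<bar> \<le> (F (fst p))\<^sup>2 + (G (snd p))\<^sup>2"
      using sum_squares_bound[of "\<bar>F (fst p)\<bar>" "\<bar>G (snd p)\<bar>"] by simp
    from mult_right_mono[OF this, of "\<bar>A (fst p - snd p)\<bar>"]
    show ?thesis by (simp add: abs_mult algebra_simps)
  qed
  show i: "integrable (lborel \<Otimes>\<^sub>M lborel) (\<lambda>p. F (fst p) * G (snd p) * A (fst p - snd p))"
  proof (rule Bochner_Integration.integrable_bound[OF g])
    show "AE p in (lborel \<Otimes>\<^sub>M lborel). norm (F (fst p) * G (snd p) * A (fst p - snd p)) \<le> norm (?g p)"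
      unfolding real_norm_def by (intro AE_I2 order_trans[OF le abs_ge_self])
  qed measurable
  show "\<bar>kernel_form A F G\<bar> \<le> (LINT s|lborel. \<bar>A s\<bar>) * ((LINT s|lborel. (F s)\<^sup>2) + (LINT s|lborel. (G s)\<^sup>2)) / 2"
    unfolding kernel_form_def gi[symmetric] by (rule integral_abs_bound_integral[OF i g le])
qed

text \<open>Substituting \<open>s = t + u\<close> separates the difference, on which alone the
  kernel depends. Boundedness of \<open>\<phi>\<close> and its support in \<open>t\<close> make both
  orders of integration absolutely convergent.\<close>

lemma kernel_integral_substitution:
  fixes A :: "real \<Rightarrow> real" and \<phi> :: "real \<Rightarrow> real \<Rightarrow> real"
  assumes A: "integrable lborel A" and \<phi>: "(\<lambda>p. \<phi> (fst p) (snd p)) \<in> borel_measurable (lborel \<Otimes>\<^sub>M lborel)"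
    and le: "\<And>s t. \<bar>\<phi> s t\<bar> \<le> M" and supp: "\<And>s t. t \<notin> {0<..<P} \<Longrightarrow> \<phi> s t = 0"
  shows "integrable (lborel \<Otimes>\<^sub>M lborel) (\<lambda>p. \<phi> (fst p) (snd p) * A (fst p - snd p))"
    and "(LINT p|(lborel \<Otimes>\<^sub>M lborel). \<phi> (fst p) (snd p) * A (fst p - snd p))
      = (LINT u|lborel. A u * (LINT t|lborel. \<phi> (t + u) t))"
proof -
  have [measurable]: "A \<in> borel_measurable lborel" using A by auto
  note [measurable] = \<phi>
  have M: "0 \<le> M" using le[of 0 0] by simp
  let ?I = "indicator {0<..<P} :: real \<Rightarrow> real"
  have \<phi>le: "\<bar>\<phi> s t\<bar> \<le> M * ?I t" for s t
    using le[of s t] supp[of t s] by (cases "t \<in> {0<..<P}") auto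
  have MI: "integrable lborel (\<lambda>t. M * ?I t)" by (simp add: integrable_indicator_Ioo)
  show i: "integrable (lborel \<Otimes>\<^sub>M lborel) (\<lambda>p. \<phi> (fst p) (snd p) * A (fst p - snd p))"
  proof (rule Bochner_Integration.integrable_bound[OF integrable_snd_kernel(1)[OF A MI]])
    show "AE p in (lborel \<Otimes>\<^sub>M lborel). norm (\<phi> (fst p) (snd p) * A (fst p - snd p)) \<le> norm (M * ?I (snd p) * A (fst p - snd p))"
      using \<phi>le M by (intro AE_I2) (simp add: abs_mult mult_right_mono)
  qed measurable
  have [measurable]: "(\<lambda>p. \<phi> (snd p + fst p) (snd p)) \<in> borel_measurable (lborel \<Otimes>\<^sub>M lborel)"
  proof -
    have "(\<lambda>p. (snd p + fst p, snd p)) \<in> (lborel \<Otimes>\<^sub>M lborel) \<rightarrow>\<^sub>M (lborel \<Otimes>\<^sub>M (lborel :: real measure))"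
      for p :: "real \<times> real" by measurable
    from measurable_compose[OF this \<phi>] show ?thesis by simp
  qed
  have AI: "integrable (lborel \<Otimes>\<^sub>M lborel) (\<lambda>p. A (fst p) * (M * ?I (snd p)))"
  proof (rule lborel_pair.Fubini_integrable)
    have eq: "(LINT t|lborel. norm (A (fst (s, t)) * (M * ?I (snd (s, t))))) = \<bar>A s\<bar> * (LINT t|lborel. M * ?I t)" for s
      using M by (simp add: abs_mult)
    show "integrable lborel (\<lambda>s. LINT t|lborel. norm (A (fst (s, t)) * (M * ?I (snd (s, t)))))"
      unfolding eq using A by simp
    show "AE s in lborel. integrable lborel (\<lambda>t. A (fst (s, t)) * (M * ?I (snd (s, t))))"
      using MI by (intro AE_I2) simp
  qed measurable
  have i2: "integrable (lborel \<Otimes>\<^sub>M lborel) (\<lambda>p. A (fst p) * \<phi> (snd p + fst p) (snd p))"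
  proof (rule Bochner_Integration.integrable_bound[OF AI])
    show "AE p in (lborel \<Otimes>\<^sub>M lborel). norm (A (fst p) * \<phi> (snd p + fst p) (snd p)) \<le> norm (A (fst p) * (M * ?I (snd p)))"
      using \<phi>le M by (intro AE_I2) (simp add: abs_mult mult_left_mono)
  qed measurable
  have "(LINT p|(lborel \<Otimes>\<^sub>M lborel). \<phi> (fst p) (snd p) * A (fst p - snd p))
      = (LINT t|lborel. LINT s|lborel. \<phi> s t * A (s - t))"
    using lborel_pair.integral_snd[of "\<lambda>s t. \<phi> s t * A (s - t)"] i by (simp add: case_prod_unfold)
  also have "\<dots> = (LINT t|lborel. LINT u|lborel. A u * \<phi> (t + u) t)"
  proof -
    have "(LINT s|lborel. \<phi> s t * A (s - t)) = (LINT u|lborel. A u * \<phi> (t + u) t)" for t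
      using lborel_integral_real_affine[of 1 "\<lambda>s. \<phi> s t * A (s - t)" t] by (simp add: mult.commute)
    then show ?thesis by simp
  qed
  also have "(LINT t|lborel. LINT u|lborel. A u * \<phi> (t + u) t) = (LINT u|lborel. LINT t|lborel. A u * \<phi> (t + u) t)"
    using lborel_pair.Fubini_integral[of "\<lambda>u t. A u * \<phi> (t + u) t"] i2 by (simp add: case_prod_unfold)
  finally show "(LINT p|(lborel \<Otimes>\<^sub>M lborel). \<phi> (fst p) (snd p) * A (fst p - snd p))
      = (LINT u|lborel. A u * (LINT t|lborel. \<phi> (t + u) t))" by simp
qed

section \<open>Positivity of periodic kernels\<close>

lemma AE_not_in_lborel: "AE t::real in lborel. t \<noteq> a"
  using AE_lborel_singleton[of a] by simp

section \<open>Integrals over one period\<close>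

lemma integral_Ioo_FTC:
  fixes f F :: "real \<Rightarrow> real"
  assumes "a \<le> b" "\<And>x. (F has_real_derivative f x) (at x)" "continuous_on UNIV f"
  shows "(LINT t|lborel. indicator {a<..<b} t * f t) = F b - F a"
proof -
  have "(LINT t|lborel. indicator {a<..<b} t * f t) = (LINT t|lborel. f t * indicator {a..b} t)"
  proof (rule integral_cong_AE)
    have "f \<in> borel_measurable borel" by (rule borel_measurable_continuous_onI[OF assms(3)])
    then show "(\<lambda>t. indicator {a<..<b} t * f t) \<in> borel_measurable lborel"
      "(\<lambda>t. f t * indicator {a..b} t) \<in> borel_measurable lborel" by measurable
    show "AE t in lborel. indicator {a<..<b} t * f t = f t * indicator {a..b} t"
      using AE_not_in_lborel[of a] AE_not_in_lborel[of b]
      by eventually_elim (auto simp: indicator_def)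
  qed
  also have "\<dots> = F b - F a"
    using assms by (intro integral_FTC_Icc_real) (auto simp: continuous_on_eq_continuous_at)
  finally show ?thesis .
qed

lemma integral_cos_period:
  assumes P: "0 < P"
  shows "(LINT t|lborel. indicator {0<..<P} t * cos (2 * pi * of_int n * t / P)) = (if n = 0 then P else 0)"
proof (cases "n = 0")
  case False
  define w where "w = 2 * pi * of_int n / P"
  have w: "w \<noteq> 0" using False P by (simp add: w_def)
  have "(LINT t|lborel. indicator {0<..<P} t * cos (w * t)) = sin (w * P) / w - sin (w * 0) / w"
    using P w by (intro integral_Ioo_FTC) (auto intro!: derivative_eq_intros continuous_intros)
  also have "w * P = of_int n * (2 * pi)" using P by (simp add: w_def)
  also have "sin (of_int n * (2 * pi)) / w - sin (w * 0) / w = 0"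
    by (simp add: sin_int_2pin mult.commute[of "of_int n"])
  finally show ?thesis using False by (simp add: w_def)
qed (use P in \<open>simp add: integrable_indicator_Ioo\<close>)

lemma integral_sin_period:
  assumes P: "0 < P"
  shows "(LINT t|lborel. indicator {0<..<P} t * sin (2 * pi * of_int n * t / P)) = 0"
proof (cases "n = 0")
  case False
  define w where "w = 2 * pi * of_int n / P"
  have w: "w \<noteq> 0" using False P by (simp add: w_def)
  have "(LINT t|lborel. indicator {0<..<P} t * sin (w * t)) = - cos (w * P) / w - (- cos (w * 0) / w)"
    using P w by (intro integral_Ioo_FTC) (auto intro!: derivative_eq_intros continuous_intros)
  also have "w * P = of_int n * (2 * pi)" using P by (simp add: w_def)
  also have "- cos (of_int n * (2 * pi)) / w - (- cos (w * 0) / w) = 0"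
    by (simp add: cos_int_2pin mult.commute[of "of_int n"])
  finally show ?thesis using False by (simp add: w_def)
qed simp

definition trig_fun :: "real \<Rightarrow> nat \<Rightarrow> real \<Rightarrow> real" where
  "trig_fun P i t = indicator {0<..<P} t * trig_basis P i t"

text \<open>For \<open>0 < P\<close> the squared L2 norm of \<open>trig_fun P i\<close>; the
  constant function is the exception.\<close>

definition trig_square :: "real \<Rightarrow> nat \<Rightarrow> real" where
  "trig_square P i = (if i = 0 then P else P / 2)"

lemma trig_basis_continuous: "continuous_on UNIV (trig_basis P i)"
  by (cases "P = 0"; cases "even i") (auto simp: trig_basis_def[abs_def] intro!: continuous_intros)

lemma trig_basis_measurable [measurable]: "trig_basis P i \<in> borel_measurable borel"
  by (rule borel_measurable_continuous_onI[OF trig_basis_continuous])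

lemma trig_basis_le: "\<bar>trig_basis P i t\<bar> \<le> 1"
  by (simp add: trig_basis_def)

lemma trig_fun_measurable [measurable]: "trig_fun P i \<in> borel_measurable borel"
  unfolding trig_fun_def[abs_def] by measurable

lemma trig_fun_le: "\<bar>trig_fun P i t\<bar> \<le> 1"
  using trig_basis_le[of P i t] by (simp add: trig_fun_def indicator_def)

lemma integrable_Ioo_bounded:
  fixes f :: "real \<Rightarrow> real"
  assumes "f \<in> borel_measurable borel" "\<And>t. \<bar>f t\<bar> \<le> M"
  shows "integrable lborel (\<lambda>t. indicator {a<..<b} t * f t)"
proof (rule Bochner_Integration.integrable_bound)
  show "integrable lborel (\<lambda>t. M * indicator {a<..<b} t)" by (simp add: integrable_indicator_Ioo)
  show "AE t in lborel. norm (indicator {a<..<b} t * f t) \<le> norm (M * indicator {a<..<b} t)"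
    using order_trans[OF assms(2) abs_ge_self] by (intro AE_I2) (simp add: indicator_def)
qed (use assms(1) in measurable)

lemma trig_fun_square_integrable: "integrable lborel (\<lambda>t. (trig_fun P i t)\<^sup>2)"
  by (rule integrable_power2_bounded[OF _ trig_fun_le, where P = P]) (simp_all add: trig_fun_def)

lemma trig_fun_orthogonal:
  assumes P: "0 < P"
  shows "(LINT t|lborel. trig_fun P i t * trig_basis P j t) = (if i = j then trig_square P i else 0)"
proof -
  let ?I = "indicator {0<..<P} :: real \<Rightarrow> real"
  let ?c = "\<lambda>n::int. \<lambda>t. ?I t * cos (2 * pi * of_int n * t / P)"
  let ?s = "\<lambda>n::int. \<lambda>t. ?I t * sin (2 * pi * of_int n * t / P)"
  define k l where "k = int (trig_freq i)" and "l = int (trig_freq j)"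
  have ci: "integrable lborel (?c n)" and si: "integrable lborel (?s n)" for n
    by (rule integrable_Ioo_bounded[where M = 1]; simp)+
  have e: "2 * pi * of_int k * t / P + 2 * pi * of_int l * t / P = 2 * pi * of_int (k + l) * t / P"
    "2 * pi * of_int k * t / P - 2 * pi * of_int l * t / P = 2 * pi * of_int (k - l) * t / P" for t
    by (simp_all add: field_simps diff_divide_distrib add_divide_distrib)
  have kl: "real (trig_freq i) = of_int k" "real (trig_freq j) = of_int l" by (simp_all add: k_def l_def)
  consider "even i" "even j" | "even i" "odd j" | "odd i" "even j" | "odd i" "odd j" by blast
  then show ?thesis
  proof cases
    case 1
    have "(LINT t|lborel. trig_fun P i t * trig_basis P j t) = (LINT t|lborel. (?c (k - l) t + ?c (k + l) t) / 2)"
      using 1 by (intro Bochner_Integration.integral_cong refl)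
        (simp only: trig_fun_def trig_basis_def kl if_True mult.assoc[of "?I _"] cos_times_cos e distrib_left times_divide_eq_right)
    also have "\<dots> = ((LINT t|lborel. ?c (k - l) t) + (LINT t|lborel. ?c (k + l) t)) / 2"
      by (simp only: integral_divide_zero Bochner_Integration.integral_add[OF ci ci])
    also have "\<dots> = (if i = j then trig_square P i else 0)"
      unfolding integral_cos_period[OF P] using 1
      by (auto simp: k_def l_def trig_freq_def trig_square_def elim!: evenE)
    finally show ?thesis .
  next
    case 2
    have "(LINT t|lborel. trig_fun P i t * trig_basis P j t) = (LINT t|lborel. (?s (k + l) t - ?s (k - l) t) / 2)"
      using 2 by (intro Bochner_Integration.integral_cong refl)
        (simp only: trig_fun_def trig_basis_def kl if_True if_False mult.assoc[of "?I _"] cos_times_sin e right_diff_distrib times_divide_eq_right)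
    also have "\<dots> = 0"
      by (simp only: integral_divide_zero Bochner_Integration.integral_diff[OF si si] integral_sin_period[OF P]) simp
    finally show ?thesis using 2 by auto
  next
    case 3
    have "(LINT t|lborel. trig_fun P i t * trig_basis P j t) = (LINT t|lborel. (?s (k + l) t + ?s (k - l) t) / 2)"
      using 3 by (intro Bochner_Integration.integral_cong refl)
        (simp only: trig_fun_def trig_basis_def kl if_True if_False mult.assoc[of "?I _"] sin_times_cos e distrib_left times_divide_eq_right)
    also have "\<dots> = 0"
      by (simp only: integral_divide_zero Bochner_Integration.integral_add[OF si si] integral_sin_period[OF P]) simp
    finally show ?thesis using 3 by auto
  next
    case 4
    have "(LINT t|lborel. trig_fun P i t * trig_basis P j t) = (LINT t|lborel. (?c (k - l) t - ?c (k + l) t) / 2)"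
      using 4 by (intro Bochner_Integration.integral_cong refl)
        (simp only: trig_fun_def trig_basis_def kl if_False mult.assoc[of "?I _"] sin_times_sin e right_diff_distrib times_divide_eq_right)
    also have "\<dots> = ((LINT t|lborel. ?c (k - l) t) - (LINT t|lborel. ?c (k + l) t)) / 2"
      by (simp only: integral_divide_zero Bochner_Integration.integral_diff[OF ci ci])
    also have "\<dots> = (if i = j then trig_square P i else 0)"
      unfolding integral_cos_period[OF P] using 4
      by (auto simp: k_def l_def trig_freq_def trig_square_def elim!: oddE)
    finally show ?thesis .
  qed
qed


lemma sin_cos_nat_2pi: "sin (real m * (2 * pi)) = 0" "cos (real m * (2 * pi)) = 1"
  using sin_int_2pin[of "int m"] cos_int_2pin[of "int m"] by (simp_all add: mult.commute)

lemma trig_basis_periodic: "P \<noteq> 0 \<Longrightarrow> trig_basis P i (t + P) = trig_basis P i t"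
proof -
  assume P: "P \<noteq> 0"
  have "2 * pi * real (trig_freq i) * (t + P) / P = 2 * pi * real (trig_freq i) * t / P + of_nat (trig_freq i) * (2 * pi)"
    using P by (simp add: field_simps)
  then show ?thesis
    by (simp only: trig_basis_def) (simp add: sin_add cos_add sin_cos_nat_2pi)
qed

section \<open>Diagonalization of a periodic kernel by the trigonometric system\<close>

definition cos_coeff :: "(real \<Rightarrow> real) \<Rightarrow> real \<Rightarrow> nat \<Rightarrow> real" where
  "cos_coeff A P m = (LINT u|lborel. indicator {0<..<P} u * A u * cos (2 * pi * real m * u / P))"

text \<open>An even \<open>P\<close>-periodic kernel restricted to \<open>(- P, P)\<close> and cut
  to 0 elsewhere, so as to be integrable on the line; differences of points of \<open>(0, P)\<close>
  never leave that interval.\<close>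

locale periodic_kernel =
  fixes A :: "real \<Rightarrow> real" and P :: real
  assumes P: "0 < P" and A: "integrable lborel A" and supp: "\<And>u. P \<le> \<bar>u\<bar> \<Longrightarrow> A u = 0"
    and even: "\<And>u. A (- u) = A u" and per: "\<And>u. - P < u \<Longrightarrow> u < 0 \<Longrightarrow> A (u + P) = A u"
begin

lemma A_measurable [measurable]: "A \<in> borel_measurable borel"
  using A by auto

lemma reflect: "0 < u \<Longrightarrow> u < P \<Longrightarrow> A (P - u) = A u"
  using per[of "- u"] even[of u] by simp

lemma integrable_A_mult:
  assumes "f \<in> borel_measurable borel" "\<And>t. \<bar>f t\<bar> \<le> 1"
  shows "integrable lborel (\<lambda>u. A u * f u)"
proof (rule Bochner_Integration.integrable_bound[OF A])
  show "AE u in lborel. norm (A u * f u) \<le> norm (A u)"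
    using assms(2) by (intro AE_I2) (simp add: abs_mult mult_left_le)
qed (use assms(1) in measurable)

text \<open>The reflection of \<open>u\<close> to \<open>P - u\<close> preserves the kernel and
  changes the sign of the sine.\<close>

lemma sin_coeff: "(LINT u|lborel. indicator {0<..<P} u * A u * sin (2 * pi * real m * u / P)) = 0" (is "?I = 0")
proof -
  let ?f = "\<lambda>u. indicator {0<..<P} u * A u * sin (2 * pi * real m * u / P)"
  have "?f (P - u) = - ?f u" for u
  proof (cases "u \<in> {0<..<P}")
    case True
    have "2 * pi * real m * (P - u) / P = of_nat m * (2 * pi) - 2 * pi * real m * u / P"
      using P by (simp add: field_simps)
    then have "sin (2 * pi * real m * (P - u) / P) = - sin (2 * pi * real m * u / P)"
      by (simp only: sin_diff sin_cos_nat_2pi mult_zero_left mult_1 diff_0)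
    then show ?thesis using True reflect[of u] by simp
  qed auto
  then have "?I = - ?I"
    using lborel_integral_real_affine[of "-1" ?f P] by simp
  then show ?thesis by simp
qed

text \<open>For \<open>t\<close> in the period the relevant differences fill
  \<open>(- t, P - t)\<close>. Moving the negative part by \<open>P\<close> gives a full period, and
  in the addition theorem the sine coefficient drops out, so the trigonometric functions are
  eigenfunctions.\<close>

lemma convolution_trig:
  assumes t: "0 < t" "t < P"
  shows "(LINT s|lborel. trig_fun P i s * A (s - t)) = cos_coeff A P (trig_freq i) * trig_basis P i t"
proof -
  let ?e = "trig_basis P i"
  let ?g = "\<lambda>u. A u * ?e (t + u)"
  let ?J = "\<lambda>a b u. indicator {a<..<b::real} u * ?g u :: real"
  have em: "(\<lambda>u. ?e (t + u)) \<in> borel_measurable borel" by measurable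
  have gi: "integrable lborel ?g" by (rule integrable_A_mult[OF em trig_basis_le])
  have Ji: "integrable lborel (?J a b)" for a b
    using integrable_mult_indicator[OF _ gi, of "{a<..<b}"] by simp
  have "(LINT s|lborel. trig_fun P i s * A (s - t)) = (LINT u|lborel. trig_fun P i (t + u) * A u)"
    using lborel_integral_real_affine[of 1 "\<lambda>s. trig_fun P i s * A (s - t)" t] by simp
  also have "\<dots> = (LINT u|lborel. ?J (- t) 0 u + ?J 0 (P - t) u)"
  proof (rule integral_cong_AE)
    show "AE u in lborel. trig_fun P i (t + u) * A u = ?J (- t) 0 u + ?J 0 (P - t) u"
      using AE_not_in_lborel[of 0] by eventually_elim (use t in \<open>auto simp: trig_fun_def indicator_def\<close>)
  qed (use em in measurable)
  also have "\<dots> = (LINT u|lborel. ?J (- t) 0 u) + (LINT u|lborel. ?J 0 (P - t) u)"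
    by (rule Bochner_Integration.integral_add[OF Ji Ji])
  also have "(LINT u|lborel. ?J (- t) 0 u) = (LINT u|lborel. ?J (- t) 0 (u - P))"
    using lborel_integral_real_affine[of 1 "?J (- t) 0" "- P"] by simp
  also have "\<dots> = (LINT u|lborel. ?J (P - t) P u)"
  proof (intro Bochner_Integration.integral_cong refl)
    fix u
    show "?J (- t) 0 (u - P) = ?J (P - t) P u"
    proof (cases "P - t < u \<and> u < P")
      case True
      then have "A (u - P) = A u" using per[of "u - P"] t by simp
      moreover have "?e (t + u) = ?e (t + (u - P))"
        using trig_basis_periodic[of P i "t + (u - P)"] P by (simp add: algebra_simps)
      ultimately show ?thesis using True by (simp add: indicator_def)
    qed (auto simp: indicator_def)
  qed
  also have "(LINT u|lborel. ?J (P - t) P u) + (LINT u|lborel. ?J 0 (P - t) u) = (LINT u|lborel. ?J (P - t) P u + ?J 0 (P - t) u)"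
    by (rule Bochner_Integration.integral_add[OF Ji Ji, symmetric])
  also have "\<dots> = (LINT u|lborel. ?J 0 P u)"
  proof (rule integral_cong_AE)
    show "AE u in lborel. ?J (P - t) P u + ?J 0 (P - t) u = ?J 0 P u"
      using AE_not_in_lborel[of "P - t"] by eventually_elim (use t in \<open>auto simp: indicator_def\<close>)
  qed (use em in measurable)
  also have "\<dots> = cos_coeff A P (trig_freq i) * ?e t"
  proof -
    let ?w = "2 * pi * real (trig_freq i) / P"
    let ?C = "\<lambda>u. indicator {0<..<P} u * A u * cos (2 * pi * real (trig_freq i) * u / P)"
    let ?S = "\<lambda>u. indicator {0<..<P} u * A u * sin (2 * pi * real (trig_freq i) * u / P)"
    have Ci: "integrable lborel ?C" and Si: "integrable lborel ?S"
      using integrable_mult_indicator[OF _ integrable_A_mult[of "\<lambda>u. cos (2 * pi * real (trig_freq i) * u / P)"], of "{0<..<P}"]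
        integrable_mult_indicator[OF _ integrable_A_mult[of "\<lambda>u. sin (2 * pi * real (trig_freq i) * u / P)"], of "{0<..<P}"]
      by (simp_all add: mult.assoc)
    have add: "2 * pi * real (trig_freq i) * (t + u) / P = 2 * pi * real (trig_freq i) * t / P + 2 * pi * real (trig_freq i) * u / P" for u
      by (simp add: add_divide_distrib distrib_left)
    obtain d where d: "?J 0 P u = ?e t * ?C u + d * ?S u" for u
    proof (cases "even i")
      case True
      have "?J 0 P u = ?e t * ?C u + (- sin (2 * pi * real (trig_freq i) * t / P)) * ?S u" for u
        by (simp only: trig_basis_def True if_True add cos_add) (simp add: algebra_simps)
      then show ?thesis by (rule that)
    next
      case False
      have "?J 0 P u = ?e t * ?C u + cos (2 * pi * real (trig_freq i) * t / P) * ?S u" for u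
        by (simp only: trig_basis_def False if_False add sin_add) (simp add: algebra_simps)
      then show ?thesis by (rule that)
    qed
    have "(LINT u|lborel. ?J 0 P u) = ?e t * (LINT u|lborel. ?C u) + d * (LINT u|lborel. ?S u)"
      unfolding d using Ci Si by simp
    then show ?thesis by (simp add: sin_coeff cos_coeff_def)
  qed
  finally show ?thesis .
qed

lemma kernel_form_trig:
  "kernel_form A (trig_fun P i) (trig_fun P j) = (if i = j then cos_coeff A P (trig_freq i) * trig_square P i else 0)"
proof -
  have i: "integrable (lborel \<Otimes>\<^sub>M lborel) (\<lambda>p. trig_fun P i (fst p) * trig_fun P j (snd p) * A (fst p - snd p))"
    by (rule kernel_form_Young[OF A]) (simp_all add: trig_fun_square_integrable)
  have "kernel_form A (trig_fun P i) (trig_fun P j) = (LINT t|lborel. LINT s|lborel. trig_fun P i s * trig_fun P j t * A (s - t))"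
    unfolding kernel_form_def
    using lborel_pair.integral_snd[of "\<lambda>s t. trig_fun P i s * trig_fun P j t * A (s - t)"] i by (simp add: case_prod_unfold)
  also have "\<dots> = (LINT t|lborel. cos_coeff A P (trig_freq i) * (trig_fun P j t * trig_basis P i t))"
  proof (intro Bochner_Integration.integral_cong refl)
    fix t
    have "(LINT s|lborel. trig_fun P i s * trig_fun P j t * A (s - t)) = trig_fun P j t * (LINT s|lborel. trig_fun P i s * A (s - t))"
      unfolding integral_mult_right_zero[symmetric] by (simp add: mult_ac)
    also have "\<dots> = cos_coeff A P (trig_freq i) * (trig_fun P j t * trig_basis P i t)"
      using convolution_trig[of t i] by (cases "t \<in> {0<..<P}") (auto simp: trig_fun_def)
    finally show "(LINT s|lborel. trig_fun P i s * trig_fun P j t * A (s - t))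
      = cos_coeff A P (trig_freq i) * (trig_fun P j t * trig_basis P i t)" .
  qed
  also have "\<dots> = (if i = j then cos_coeff A P (trig_freq i) * trig_square P i else 0)"
    using trig_fun_orthogonal[OF P, of j i] by simp
  finally show ?thesis .
qed

lemma kernel_form_trig_poly_nonneg:
  assumes coeff: "\<And>m. 0 \<le> cos_coeff A P m"
  shows "0 \<le> kernel_form A (\<lambda>t. \<Sum>i<n. c i * trig_fun P i t) (\<lambda>t. \<Sum>i<n. c i * trig_fun P i t)"
proof -
  have i: "integrable (lborel \<Otimes>\<^sub>M lborel) (\<lambda>p. trig_fun P i (fst p) * trig_fun P j (snd p) * A (fst p - snd p))" for i j
    by (rule kernel_form_Young[OF A]) (simp_all add: trig_fun_square_integrable)
  have "kernel_form A (\<lambda>t. \<Sum>i<n. c i * trig_fun P i t) (\<lambda>t. \<Sum>i<n. c i * trig_fun P i t)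
    = (LINT p|(lborel \<Otimes>\<^sub>M lborel). (\<Sum>i<n. \<Sum>j<n. c i * c j * (trig_fun P i (fst p) * trig_fun P j (snd p) * A (fst p - snd p))))"
    unfolding kernel_form_def
  proof (intro Bochner_Integration.integral_cong refl)
    fix p :: "real \<times> real"
    have "(\<Sum>i<n. X i) * (\<Sum>j<n. Y j) * a = (\<Sum>i<n. \<Sum>j<n. X i * Y j * a)" for X Y :: "nat \<Rightarrow> real" and a
      unfolding sum_product by (simp only: sum_distrib_right)
    then show "(\<Sum>i<n. c i * trig_fun P i (fst p)) * (\<Sum>i<n. c i * trig_fun P i (snd p)) * A (fst p - snd p)
      = (\<Sum>i<n. \<Sum>j<n. c i * c j * (trig_fun P i (fst p) * trig_fun P j (snd p) * A (fst p - snd p)))"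
      by (simp add: mult_ac)
  qed
  also have "\<dots> = (\<Sum>i<n. \<Sum>j<n. c i * c j * kernel_form A (trig_fun P i) (trig_fun P j))"
    unfolding kernel_form_def using i by (simp add: Bochner_Integration.integral_sum)
  also have "\<dots> = (\<Sum>i<n. c i * c i * (cos_coeff A P (trig_freq i) * trig_square P i))"
    unfolding kernel_form_trig by (simp add: if_distrib[of "\<lambda>x. _ * x"] cong: if_cong)
  also have "\<dots> \<ge> 0"
    unfolding power2_eq_square[symmetric]
    using P by (intro sum_nonneg mult_nonneg_nonneg coeff zero_le_power2) (auto simp: trig_square_def)
  finally show ?thesis .
qed

text \<open>By the Young bound the form is continuous in mean square, so positivity passes from
  trigonometric polynomials to all square integrable functions on the period.\<close>

lemma kernel_form_nonneg:
  assumes coeff: "\<And>m. 0 \<le> cos_coeff A P m"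
    and F: "F \<in> borel_measurable borel" "integrable lborel (\<lambda>t. (F t)\<^sup>2)" "\<And>t. t \<notin> {0<..<P} \<Longrightarrow> F t = 0"
  shows "0 \<le> kernel_form A F F"
proof -
  define M where "M = (LINT s|lborel. \<bar>A s\<bar>)"
  define N where "N = (LINT s|lborel. (F s)\<^sup>2)"
  have MN: "0 \<le> M" "0 \<le> N" unfolding M_def N_def by simp_all
  have FL: "F \<in> L2_functions P"
  proof -
    have eq: "(\<lambda>t. indicator {0<..<P} t *\<^sub>R F t) = F" "(\<lambda>t. indicator {0<..<P} t *\<^sub>R (F t)\<^sup>2) = (\<lambda>t. (F t)\<^sup>2)"
      using F(3) by (auto simp: fun_eq_iff indicator_def)
    show ?thesis
      unfolding L2_functions_def set_borel_measurable_def set_integrable_def mem_Collect_eq eq using F(1,2) by simp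
  qed
  have key: "- (M * (N + 2)) * \<eta> \<le> kernel_form A F F" if \<eta>: "0 < \<eta>" "\<eta> < 1" for \<eta>
  proof -
    obtain q where q: "trig_poly P q" "(LINT t|lborel. (indicator {0<..<P} t * (F t - q t))\<^sup>2) < \<eta>\<^sup>2"
      "integrable lborel (\<lambda>t. (indicator {0<..<P} t * (F t - q t))\<^sup>2)"
      using trig_poly_dense[OF P FL, of "\<eta>\<^sup>2"] \<eta> by auto
    obtain n c where c: "\<And>t. q t = (\<Sum>i<n. c i * trig_basis P i t)" using q(1) unfolding trig_poly_def by blast
    define Q where "Q t = (\<Sum>i<n. c i * trig_fun P i t)" for t
    define D where "D t = indicator {0<..<P} t * (F t - q t)" for t
    have DQ: "D t = F t - Q t" for t
      using F(3)[of t] by (cases "t \<in> {0<..<P}") (auto simp: D_def Q_def c trig_fun_def)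
    have Qm: "Q \<in> borel_measurable borel" unfolding Q_def[abs_def] by measurable
    have Dm: "D \<in> borel_measurable borel" unfolding DQ[abs_def] using F(1) Qm by measurable
    have D2: "integrable lborel (\<lambda>t. (D t)\<^sup>2)" "(LINT t|lborel. (D t)\<^sup>2) < \<eta>\<^sup>2"
      using q(2,3) by (simp_all add: D_def)
    \<comment> \<open>Multiplying \<open>F\<close> and dividing \<open>D\<close> by this root leaves
      the mixed forms unchanged and makes both squared norms of order \<open>\<eta>\<close>, since
      that of \<open>D\<close> is below \<open>\<eta>\<^sup>2\<close>.\<close>
    let ?r = "sqrt \<eta>"
    have r: "0 < ?r" using \<eta> by simp
    have scale: "kernel_form A X Y = kernel_form A (\<lambda>t. ?r * X t) (\<lambda>t. Y t / ?r)" for X Y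
      unfolding kernel_form_def using r by (simp add: field_simps)
    have scale': "kernel_form A X Y = kernel_form A (\<lambda>t. X t / ?r) (\<lambda>t. ?r * Y t)" for X Y
      unfolding kernel_form_def using r by (simp add: field_simps)
    have rF: "(\<lambda>t. ?r * F t) \<in> borel_measurable lborel" "integrable lborel (\<lambda>t. (?r * F t)\<^sup>2)"
      "(LINT t|lborel. (?r * F t)\<^sup>2) = \<eta> * N"
      using F \<eta> by (simp_all add: power_mult_distrib N_def)
    have rD: "(\<lambda>t. D t / ?r) \<in> borel_measurable lborel" "integrable lborel (\<lambda>t. (D t / ?r)\<^sup>2)"
      "(LINT t|lborel. (D t / ?r)\<^sup>2) = (LINT t|lborel. (D t)\<^sup>2) / \<eta>"
      using Dm D2(1) \<eta> by (simp_all add: power_divide)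
    have rD_le: "(LINT t|lborel. (D t / ?r)\<^sup>2) \<le> \<eta>"
      unfolding rD(3) using D2(2) \<eta> by (simp add: divide_le_eq power2_eq_square)
    have "\<bar>kernel_form A F D\<bar> \<le> M * (\<eta> * N + (LINT t|lborel. (D t / ?r)\<^sup>2)) / 2"
      using kernel_form_Young(2)[OF A rF(1,2) rD(1,2)] unfolding scale[of F D] rF(3) M_def .
    also have "\<dots> \<le> M * (\<eta> * N + \<eta>) / 2"
      using rD_le MN(1) by (intro divide_right_mono mult_left_mono) auto
    finally have b1: "\<bar>kernel_form A F D\<bar> \<le> M * (\<eta> * N + \<eta>) / 2" .
    have "\<bar>kernel_form A D F\<bar> \<le> M * ((LINT t|lborel. (D t / ?r)\<^sup>2) + \<eta> * N) / 2"
      using kernel_form_Young(2)[OF A rD(1,2) rF(1,2)] unfolding scale'[of D F] rF(3) M_def .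
    also have "\<dots> \<le> M * (\<eta> + \<eta> * N) / 2"
      using rD_le MN(1) by (intro divide_right_mono mult_left_mono) auto
    finally have b2: "\<bar>kernel_form A D F\<bar> \<le> M * (\<eta> * N + \<eta>) / 2" by (simp add: add.commute)
    have Dm': "D \<in> borel_measurable lborel" using Dm by simp
    have "\<bar>kernel_form A D D\<bar> \<le> M * (LINT t|lborel. (D t)\<^sup>2)"
      using kernel_form_Young(2)[OF A Dm' D2(1) Dm' D2(1)] by (simp add: M_def)
    also have "\<dots> \<le> M * \<eta>"
    proof (intro mult_left_mono MN)
      have "\<eta>\<^sup>2 \<le> \<eta>" using \<eta> by (simp add: power2_eq_square mult_left_le)
      then show "(LINT t|lborel. (D t)\<^sup>2) \<le> \<eta>" using D2(2) by linarith
    qed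
    finally have b3: "\<bar>kernel_form A D D\<bar> \<le> M * \<eta>" .
    have Fm': "F \<in> borel_measurable lborel" using F(1) by simp
    note iFF = kernel_form_Young(1)[OF A Fm' F(2) Fm' F(2)]
    note iFD = kernel_form_Young(1)[OF A Fm' F(2) Dm' D2(1)]
    note iDF = kernel_form_Young(1)[OF A Dm' D2(1) Fm' F(2)]
    note iDD = kernel_form_Young(1)[OF A Dm' D2(1) Dm' D2(1)]
    have Qeq: "Q t = F t - D t" for t by (simp add: DQ)
    have "kernel_form A Q Q = (LINT p|(lborel \<Otimes>\<^sub>M lborel). F (fst p) * F (snd p) * A (fst p - snd p)
        - F (fst p) * D (snd p) * A (fst p - snd p) - D (fst p) * F (snd p) * A (fst p - snd p)
        + D (fst p) * D (snd p) * A (fst p - snd p))"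
      unfolding kernel_form_def Qeq by (intro Bochner_Integration.integral_cong refl) (simp add: algebra_simps)
    also have "\<dots> = kernel_form A F F - kernel_form A F D - kernel_form A D F + kernel_form A D D"
      unfolding kernel_form_def using iFF iFD iDF iDD by simp
    finally have "kernel_form A F F = kernel_form A Q Q + kernel_form A F D + kernel_form A D F - kernel_form A D D"
      by simp
    moreover have "0 \<le> kernel_form A Q Q"
      unfolding Q_def by (rule kernel_form_trig_poly_nonneg[OF coeff])
    ultimately have "- (M * (\<eta> * N + \<eta>)) - M * \<eta> \<le> kernel_form A F F"
      using b1 b2 b3 by linarith
    then show ?thesis by (simp add: algebra_simps)
  qed
  show ?thesis
  proof (rule ccontr)
    assume neg: "\<not> 0 \<le> kernel_form A F F"
    define C where "C = M * (N + 2)"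
    have C: "0 \<le> C" using MN by (simp add: C_def)
    \<comment> \<open>\<open>key\<close> bounds the form below by \<open>- C * \<eta>\<close>. The
      choice makes \<open>C * \<eta>\<close> smaller than the modulus of the supposed negative
      value, and \<open>\<eta> < 1\<close> as \<open>key\<close> demands; \<open>C + 1\<close>
      avoids a zero denominator.\<close>
    define \<eta> where "\<eta> = min (1 / 2) (- kernel_form A F F / (C + 1) / 2)"
    have \<eta>: "0 < \<eta>" "\<eta> < 1" using neg C by (auto simp: \<eta>_def divide_neg_pos)
    have "C * \<eta> \<le> C * (- kernel_form A F F / (C + 1) / 2)" using C by (intro mult_left_mono) (auto simp: \<eta>_def)
    also have "\<dots> = (C / (C + 1)) * (- kernel_form A F F / 2)" by simp
    also have "\<dots> \<le> 1 * (- kernel_form A F F / 2)" using C neg by (intro mult_right_mono) auto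
    also have "\<dots> < - kernel_form A F F" using neg by simp
    finally show False using key[OF \<eta>] by (simp add: C_def)
  qed
qed

end

text \<open>By the addition theorem the kernel has rank two on functions supported in
  \<open>(0, P)\<close>, whose differences never reach the cut-off.\<close>

lemma kernel_form_cos:
  assumes F: "F \<in> borel_measurable borel" "integrable lborel (\<lambda>t. (F t)\<^sup>2)" "\<And>t. t \<notin> {0<..<P} \<Longrightarrow> F t = 0"
  shows "kernel_form (\<lambda>u. indicator {-P<..<P} u * cos (w * u)) F F
    = (LINT t|lborel. F t * cos (w * t))\<^sup>2 + (LINT t|lborel. F t * sin (w * t))\<^sup>2"
proof -
  let ?c = "\<lambda>u. indicator {-P<..<P} u * cos (w * u)"
  have Fi: "integrable lborel (\<lambda>t. F t * f t)" if "f \<in> borel_measurable borel" "\<And>t. \<bar>f t\<bar> \<le> 1" for f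
  proof (rule Bochner_Integration.integrable_bound)
    show "integrable lborel (\<lambda>t. (F t)\<^sup>2 + indicator {0<..<P} t)"
      using F(2) by (simp add: integrable_indicator_Ioo)
    show "AE t in lborel. norm (F t * f t) \<le> norm ((F t)\<^sup>2 + indicator {0<..<P} t)"
    proof (rule AE_I2)
      fix t
      have "\<bar>F t\<bar> * \<bar>f t\<bar> \<le> \<bar>F t\<bar> * 1" using that(2) by (intro mult_left_mono) auto
      moreover have "\<bar>F t\<bar> \<le> (F t)\<^sup>2 + indicator {0<..<P} t"
      proof (cases "t \<in> {0<..<P}")
        case True
        have "2 * \<bar>F t\<bar> \<le> \<bar>F t\<bar>\<^sup>2 + 1" using sum_squares_bound[of "\<bar>F t\<bar>" 1] by simp
        then show ?thesis using True by simp
      qed (simp add: F(3))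
      ultimately show "norm (F t * f t) \<le> norm ((F t)\<^sup>2 + indicator {0<..<P} t)"
        by (simp add: abs_mult)
    qed
  qed (use F(1) that(1) in measurable)
  have ci: "integrable lborel ?c" by (rule integrable_Ioo_bounded[where M = 1]) simp_all
  have Fm: "F \<in> borel_measurable lborel" using F(1) by simp
  let ?C = "LINT t|lborel. F t * cos (w * t)" and ?S = "LINT t|lborel. F t * sin (w * t)"
  have "kernel_form ?c F F = (LINT t|lborel. LINT s|lborel. F s * F t * ?c (s - t))"
    unfolding kernel_form_def
    using lborel_pair.integral_snd[of "\<lambda>s t. F s * F t * ?c (s - t)"] kernel_form_Young(1)[OF ci Fm F(2) Fm F(2)]
    by (simp add: case_prod_unfold)
  also have "\<dots> = (LINT t|lborel. F t * cos (w * t) * ?C + F t * sin (w * t) * ?S)"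
  proof (intro Bochner_Integration.integral_cong refl)
    fix t
    have "F s * F t * ?c (s - t) = (F t * cos (w * t)) * (F s * cos (w * s)) + (F t * sin (w * t)) * (F s * sin (w * s))" for s
    proof (cases "s \<in> {0<..<P} \<and> t \<in> {0<..<P}")
      case True
      then have "s - t \<in> {-P<..<P}" by auto
      then show ?thesis by (simp add: right_diff_distrib cos_diff algebra_simps)
    qed (use F(3) in auto)
    then show "(LINT s|lborel. F s * F t * ?c (s - t)) = F t * cos (w * t) * ?C + F t * sin (w * t) * ?S"
      using Fi[of "\<lambda>t. cos (w * t)"] Fi[of "\<lambda>t. sin (w * t)"] by simp
  qed
  also have "\<dots> = ?C\<^sup>2 + ?S\<^sup>2"
    using Fi[of "\<lambda>t. cos (w * t)"] Fi[of "\<lambda>t. sin (w * t)"] by (simp add: power2_eq_square)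
  finally show ?thesis .
qed

text \<open>Subtracting the multiple of \<open>cos (w * u)\<close> that cancels the
  \<open>m\<close>-th coefficient leaves the other coefficients unchanged. The remaining kernel is
  still positive, so the form dominates the rank-two form of what was subtracted.\<close>

lemma (in periodic_kernel) kernel_form_lower:
  fixes m :: nat
  assumes coeff: "\<And>m. 0 \<le> cos_coeff A P m"
    and F: "F \<in> borel_measurable borel" "integrable lborel (\<lambda>t. (F t)\<^sup>2)" "\<And>t. t \<notin> {0<..<P} \<Longrightarrow> F t = 0"
  defines "w \<equiv> 2 * pi * real m / P"
  shows "cos_coeff A P m / trig_square P m * ((LINT t|lborel. F t * cos (w * t))\<^sup>2 + (LINT t|lborel. F t * sin (w * t))\<^sup>2)
    \<le> kernel_form A F F"
proof -
  let ?c = "\<lambda>u. indicator {-P<..<P} u * cos (w * u)"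
  define r where "r = cos_coeff A P m / trig_square P m"
  define D where "D u = A u - r * ?c u" for u
  have ci: "integrable lborel ?c" by (rule integrable_Ioo_bounded[where M = 1]) simp_all
  have D: "integrable lborel D" unfolding D_def[abs_def] using A ci by simp
  have cos_per: "cos (w * (u + P)) = cos (w * u)" for u
  proof -
    have "w * (u + P) = w * u + real m * (2 * pi)" using P by (simp add: w_def field_simps)
    then show ?thesis by (simp add: cos_add sin_cos_nat_2pi)
  qed
  interpret D: periodic_kernel D P
    by unfold_locales
      (use P D supp even per cos_per in \<open>auto simp: D_def indicator_def abs_le_iff\<close>)
  have Dcoeff: "0 \<le> cos_coeff D P n" for n
  proof -
    let ?I = "indicator {0<..<P} :: real \<Rightarrow> real"
    have iA: "integrable lborel (\<lambda>u. ?I u * A u * cos (2 * pi * real n * u / P))"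
      using integrable_mult_indicator[OF _ integrable_A_mult[of "\<lambda>u. cos (2 * pi * real n * u / P)"], of "{0<..<P}"]
      by (simp add: mult.assoc)
    have ic: "integrable lborel (\<lambda>u. ?I u * (cos (w * u) * cos (2 * pi * real n * u / P)))"
    proof (rule integrable_Ioo_bounded[where M = 1])
      show "\<bar>cos (w * u) * cos (2 * pi * real n * u / P)\<bar> \<le> 1" for u
        unfolding abs_mult by (rule mult_le_one) auto
    qed measurable
    have "cos_coeff D P n = (LINT u|lborel. ?I u * A u * cos (2 * pi * real n * u / P)
       - r * (?I u * (cos (w * u) * cos (2 * pi * real n * u / P))))"
      unfolding cos_coeff_def
      by (intro Bochner_Integration.integral_cong refl) (auto simp: D_def indicator_def algebra_simps)
    also have "\<dots> = cos_coeff A P n - r * (LINT u|lborel. ?I u * (cos (w * u) * cos (2 * pi * real n * u / P)))"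
      unfolding cos_coeff_def using iA ic by simp
    also have "(LINT u|lborel. ?I u * (cos (w * u) * cos (2 * pi * real n * u / P)))
        = (LINT u|lborel. trig_fun P (2 * m) u * trig_basis P (2 * n) u)"
      by (simp add: trig_fun_def trig_basis_simps w_def mult.assoc)
    also have "\<dots> = (if m = n then trig_square P m else 0)"
      using trig_fun_orthogonal[OF P, of "2 * m" "2 * n"] by (simp add: trig_square_def)
    finally show ?thesis using coeff[of n] P by (auto simp: r_def trig_square_def)
  qed
  have Fm: "F \<in> borel_measurable lborel" using F(1) by simp
  have "0 \<le> kernel_form D F F" by (rule D.kernel_form_nonneg[OF Dcoeff F])
  also have "kernel_form D F F = (LINT p|(lborel \<Otimes>\<^sub>M lborel). F (fst p) * F (snd p) * A (fst p - snd p)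
      - r * (F (fst p) * F (snd p) * ?c (fst p - snd p)))"
    unfolding kernel_form_def D_def by (intro Bochner_Integration.integral_cong refl) (simp add: algebra_simps)
  also have "\<dots> = kernel_form A F F - r * kernel_form ?c F F"
    unfolding kernel_form_def
    using kernel_form_Young(1)[OF A Fm F(2) Fm F(2)] kernel_form_Young(1)[OF ci Fm F(2) Fm F(2)] by simp
  finally have "r * kernel_form ?c F F \<le> kernel_form A F F" by simp
  moreover have "kernel_form ?c F F = (LINT t|lborel. F t * cos (w * t))\<^sup>2 + (LINT t|lborel. F t * sin (w * t))\<^sup>2"
    by (rule kernel_form_cos) (rule F | simp add: F(3))+
  ultimately show ?thesis unfolding r_def by simp
qed

section \<open>Cosine integrals of convex functions\<close>

lemma convex_on_three_points:
  fixes f :: "real \<Rightarrow> real"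
  assumes f: "convex_on S f" and S: "x \<in> S" "z \<in> S" and xyz: "x < y" "y < z"
  shows "(z - x) * f y \<le> (z - y) * f x + (y - x) * f z"
proof -
  define t where "t = (y - x) / (z - x)"
  have t: "0 \<le> t" "t \<le> 1" using xyz by (auto simp: t_def)
  have "t * (z - x) = y - x" using xyz by (simp add: t_def)
  then have "(1 - t) * x + t * z = y" by (simp add: algebra_simps)
  then have "f y \<le> (1 - t) * f x + t * f z"
    using convex_onD[OF f t S] by simp
  then have "(z - x) * f y \<le> (z - x) * ((1 - t) * f x + t * f z)"
    using xyz by (intro mult_left_mono) auto
  also have "\<dots> = ((z - x) - t * (z - x)) * f x + t * (z - x) * f z" by (simp add: algebra_simps)
  also have "\<dots> = (z - y) * f x + (y - x) * f z" unfolding \<open>t * (z - x) = y - x\<close> by simp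
  finally show ?thesis .
qed

definition secant :: "(real \<Rightarrow> real) \<Rightarrow> real \<Rightarrow> real \<Rightarrow> real \<Rightarrow> real" where
  "secant f c d v = f c + (v - c) * ((f d - f c) / (d - c))"

lemma convex_secant:
  fixes f :: "real \<Rightarrow> real"
  assumes f: "convex_on S f" and S: "c \<in> S" "d \<in> S" "v \<in> S" and cd: "c < d"
  shows "c \<le> v \<Longrightarrow> v \<le> d \<Longrightarrow> f v \<le> secant f c d v"
    and "v \<le> c \<or> d \<le> v \<Longrightarrow> secant f c d v \<le> f v"
proof -
  have eq: "(d - c) * secant f c d v = (d - v) * f c + (v - c) * f d" for v
    using cd by (simp add: secant_def field_simps)
  {
    assume v: "c \<le> v" "v \<le> d"
    have "(d - c) * f v \<le> (d - c) * secant f c d v"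
      unfolding eq using convex_on_three_points[OF f S(1,2), of v] v
      by (cases "v = c \<or> v = d") auto
    then show "f v \<le> secant f c d v" using cd by simp
  next
    assume v: "v \<le> c \<or> d \<le> v"
    have "(d - c) * secant f c d v \<le> (d - c) * f v"
      unfolding eq
      using convex_on_three_points[OF f S(3,2), of c] convex_on_three_points[OF f S(1,3), of d] v cd
      by (cases "v = c \<or> v = d") (auto simp: algebra_simps)
    then show "secant f c d v \<le> f v" using cd by simp
  }
qed

text \<open>Although the affine factor is not periodic, the boundary values of the antiderivative
  \<open>(b + v * m) * sin (w * v) / w + m * cos (w * v) / w^2\<close> agree over whole
  periods.\<close>

lemma has_integral_cos_affine:
  fixes w :: real
  assumes "w \<noteq> 0" "0 \<le> p" and p: "w * p = 2 * pi * real n"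
  shows "((\<lambda>v. (b + v * m) * cos (w * v)) has_integral 0) {0..p}"
proof -
  have "((\<lambda>v. (b + v * m) * cos (w * v)) has_integral
      ((b + p * m) * sin (w * p) / w + m * cos (w * p) / w\<^sup>2) - ((b + 0 * m) * sin (w * 0) / w + m * cos (w * 0) / w\<^sup>2)) {0..p}"
    using assms(1,2)
    by (intro fundamental_theorem_of_calculus)
      (auto intro!: derivative_eq_intros simp: has_real_derivative_iff_has_vector_derivative[symmetric] power2_eq_square field_simps)
  moreover have "sin (w * p) = 0" "cos (w * p) = 1"
    unfolding p using sin_cos_nat_2pi[of n] by (simp_all add: mult_ac)
  ultimately show ?thesis by simp
qed

lemma cos_sign:
  assumes "0 < p" "0 \<le> v" "v \<le> p"
  shows "p / 4 \<le> v \<Longrightarrow> v \<le> 3 * p / 4 \<Longrightarrow> cos (2 * pi * v / p) \<le> 0"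
    and "v \<le> p / 4 \<or> 3 * p / 4 \<le> v \<Longrightarrow> 0 \<le> cos (2 * pi * v / p)"
proof -
  let ?x = "2 * pi * v / p"
  assume v: "p / 4 \<le> v" "v \<le> 3 * p / 4"
  have "pi / 2 \<le> ?x" "?x \<le> 3 * pi / 2" using v assms pi_gt_zero by (simp_all add: field_simps)
  then have "0 \<le> cos (?x - pi)" by (intro cos_ge_zero) auto
  then show "cos ?x \<le> 0" by (simp add: cos_diff)
next
  let ?x = "2 * pi * v / p"
  assume v: "v \<le> p / 4 \<or> 3 * p / 4 \<le> v"
  show "0 \<le> cos ?x"
  proof (cases "v \<le> p / 4")
    case True
    have "0 \<le> ?x" using assms by simp
    moreover have "?x \<le> pi / 2" using True assms pi_gt_zero by (simp add: field_simps)
    ultimately show ?thesis using pi_gt_zero by (intro cos_ge_zero) linarith+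
  next
    case False
    have "3 * pi / 2 \<le> ?x" "?x \<le> 2 * pi" using v False assms pi_gt_zero by (simp_all add: field_simps)
    then have "0 \<le> cos (?x - 2 * pi)" by (intro cos_ge_zero) auto
    then show ?thesis by (simp add: cos_diff)
  qed
qed

text \<open>Subtracting the secant through the zeros of the cosine makes the integrand nonnegative and
  does not change the integral.\<close>

lemma convex_cos_period_pointwise:
  fixes f :: "real \<Rightarrow> real"
  assumes p: "0 < p" and f: "convex_on {0<..<p} f" and v: "0 < v" "v < p"
  shows "0 \<le> (f v - secant f (p / 4) (3 * p / 4) v) * cos (2 * pi * v / p)"
proof (cases "p / 4 \<le> v \<and> v \<le> 3 * p / 4")
  case True
  then have "f v - secant f (p / 4) (3 * p / 4) v \<le> 0"
    using convex_secant(1)[OF f, of "p / 4" "3 * p / 4" v] p v by simp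
  then show ?thesis using cos_sign(1)[of p v] p v True by (intro mult_nonpos_nonpos) auto
next
  case False
  then have "0 \<le> f v - secant f (p / 4) (3 * p / 4) v"
    using convex_secant(2)[OF f, of "p / 4" "3 * p / 4" v] p v by auto
  then show ?thesis using cos_sign(2)[of p v] p v False by (intro mult_nonneg_nonneg) auto
qed

lemma convex_cos_period:
  fixes f :: "real \<Rightarrow> real"
  assumes p: "0 < p" and f: "convex_on {0<..<p} f"
    and I: "((\<lambda>v. f v * cos (2 * pi * v / p)) has_integral I) {0..p}"
  defines "g \<equiv> \<lambda>v. (f v - secant f (p / 4) (3 * p / 4) v) * cos (2 * pi * v / p)"
  shows "(g has_integral I) {0..p}" "0 \<le> I"
proof -
  define m where "m = (f (3 * p / 4) - f (p / 4)) / (3 * p / 4 - p / 4)"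
  have sec: "secant f (p / 4) (3 * p / 4) v = (f (p / 4) - p / 4 * m) + v * m" for v
    unfolding secant_def m_def[symmetric] by (simp add: algebra_simps)
  have "((\<lambda>v. ((f (p / 4) - p / 4 * m) + v * m) * cos ((2 * pi / p) * v)) has_integral 0) {0..p}"
    by (rule has_integral_cos_affine[where n = 1]) (use p in auto)
  from has_integral_diff[OF I this]
  show g: "(g has_integral I) {0..p}"
    unfolding g_def sec left_diff_distrib by simp
  \<comment> \<open>Convexity is known on the open interval only; the values of \<open>f\<close> at
    the endpoints are arbitrary.\<close>
  have "(g has_integral I) {0<..<p}" using g by (simp add: has_integral_Icc_iff_Ioo)
  then show "0 \<le> I"
    by (rule has_integral_nonneg) (use convex_cos_period_pointwise[OF p f] in \<open>auto simp: g_def\<close>)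
qed

lemma convex_on_translate:
  fixes f :: "real \<Rightarrow> real"
  assumes "convex_on {a<..<b} f"
  shows "convex_on {a - c<..<b - c} (\<lambda>v. f (v + c))"
proof (rule convex_onI)
  fix t x y :: real assume t: "0 < t" "t < 1" and xy: "x \<in> {a - c<..<b - c}" "y \<in> {a - c<..<b - c}"
  have "f ((1 - t) *\<^sub>R (x + c) + t *\<^sub>R (y + c)) \<le> (1 - t) * f (x + c) + t * f (y + c)"
    by (rule convex_onD[OF assms]) (use t xy in auto)
  then show "f ((1 - t) *\<^sub>R x + t *\<^sub>R y + c) \<le> (1 - t) * f (x + c) + t * f (y + c)"
    by (simp add: algebra_simps)
qed simp

text \<open>Each further period contributes a nonnegative integral, since translates of convex
  functions are convex and the cosine repeats.\<close>

lemma convex_cos_integral_mono: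
  fixes f :: "real \<Rightarrow> real"
  assumes p: "0 < p" and f: "convex_on {0<..<real n * p} f"
    and I: "(\<lambda>v. f v * cos (2 * pi * v / p)) integrable_on {0..real n * p}"
    and n: "1 \<le> n"
  shows "integral {0..p} (\<lambda>v. f v * cos (2 * pi * v / p)) \<le> integral {0..real n * p} (\<lambda>v. f v * cos (2 * pi * v / p))"
proof -
  let ?g = "\<lambda>v. f v * cos (2 * pi * v / p)"
  have "Suc k \<le> n \<Longrightarrow> integral {0..p} ?g \<le> integral {0..real (Suc k) * p} ?g" for k
  proof (induction k)
    case (Suc k')
    define k where "k = Suc k'"
    define a where "a = real k * p"
    have "real (Suc k) * p \<le> real n * p" using Suc.prems p by (intro mult_right_mono) (auto simp: k_def)
    then have le: "a + p \<le> real n * p" by (simp add: a_def algebra_simps)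
    have a: "0 \<le> a" using p by (simp add: a_def)
    have int: "?g integrable_on {0..a + p}" "?g integrable_on {a..a + p}"
      using integrable_subinterval_real[OF I] le a by auto
    have per: "cos (2 * pi * (v + a) / p) = cos (2 * pi * v / p)" for v
    proof -
      have "2 * pi * (v + a) / p = 2 * pi * v / p + real k * (2 * pi)" using p by (simp add: a_def field_simps)
      then show ?thesis by (simp add: cos_add sin_cos_nat_2pi)
    qed
    have "(?g has_integral integral {a..a + p} ?g) {a..a + p}" using int(2) by (rule integrable_integral)
    then have "((\<lambda>v. ?g (v + a)) has_integral integral {a..a + p} ?g) {0..p}"
      using has_integral_affinity[of ?g "integral {a..a + p} ?g" a "a + p" 1 a]
      by (simp add: cbox_interval image_iff image_diff_atLeastAtMost add.commute)
    then have "0 \<le> integral {a..a + p} ?g"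
    proof (intro convex_cos_period(2)[OF p, of "\<lambda>v. f (v + a)"])
      have "convex_on {a<..<p + a} f" by (intro convex_on_subset[OF f]) (use a le in auto)
      from convex_on_translate[OF this, of a] show "convex_on {0<..<p} (\<lambda>v. f (v + a))" by simp
    qed (simp add: per)
    moreover have "integral {0..a} ?g + integral {a..a + p} ?g = integral {0..a + p} ?g"
      using int(1) a p by (intro Henstock_Kurzweil_Integration.integral_combine) auto
    ultimately show ?case using Suc by (simp add: a_def k_def algebra_simps)
  qed simp
  from this[of "n - 1"] show ?thesis using n by simp
qed

lemma convex_cos_integral_nonneg:
  fixes f :: "real \<Rightarrow> real"
  assumes p: "0 < p" and f: "convex_on {0<..<real n * p} f"
    and I: "(\<lambda>v. f v * cos (2 * pi * v / p)) integrable_on {0..real n * p}"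
    and n: "1 \<le> n"
  shows "0 \<le> integral {0..real n * p} (\<lambda>v. f v * cos (2 * pi * v / p))"
proof -
  have le: "p \<le> real n * p" using n p by simp
  have sub: "{0<..<p} \<subseteq> {0<..<real n * p}"
  proof
    fix v assume "v \<in> {0<..<p}"
    then have "0 < v" "v < real n * p" using le by (simp, simp only: greaterThanLessThan_iff, linarith)
    then show "v \<in> {0<..<real n * p}" by simp
  qed
  from le have "(\<lambda>v. f v * cos (2 * pi * v / p)) integrable_on {0..p}"
    using integrable_subinterval_real[OF I] p by auto
  then have "0 \<le> integral {0..p} (\<lambda>v. f v * cos (2 * pi * v / p))"
    using convex_cos_period(2)[OF p convex_on_subset[OF f sub] integrable_integral] by blast
  then show ?thesis using convex_cos_integral_mono[OF p f I n] by linarith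
qed

section \<open>The logarithmic kernel\<close>

text \<open>The number \<open>\<delta>\<close> is small enough for the monotonicity statements about
  \<open>t ln\<^sup>\<alpha> (1/t)\<close> below.\<close>

locale log_kernel =
  fixes \<alpha> T \<delta> :: real and B :: "real \<Rightarrow> real"
  assumes \<alpha>: "1 < \<alpha>"
    and B_even: "\<And>t. t \<noteq> 0 \<Longrightarrow> B (- t) = B t"
    and B_nonneg: "\<And>t. 0 < t \<Longrightarrow> 0 \<le> B t"
    and B_antimono: "\<And>s t. 0 < s \<Longrightarrow> s \<le> t \<Longrightarrow> B t \<le> B s"
    and B_convex: "convex_on {0<..} B"
    and T: "0 < T" and \<delta>: "0 < \<delta>" "\<delta> \<le> T / 2" "\<delta> \<le> exp (- 2 * (\<alpha> + 1))"
    and B_near: "\<And>t. 0 < t \<Longrightarrow> t \<le> \<delta> \<Longrightarrow> B t = 1 / (t * (- ln t) powr \<alpha>)"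
begin

lemma ln_le: "0 < t \<Longrightarrow> t \<le> \<delta> \<Longrightarrow> 2 * (\<alpha> + 1) \<le> - ln t"
  using \<delta> ln_mono[of t "exp (- 2 * (\<alpha> + 1))"] by simp

lemma ln_pos: "0 < t \<Longrightarrow> t \<le> \<delta> \<Longrightarrow> 1 < - ln t"
  using ln_le[of t] \<alpha> by simp

lemma ln_gt_0: "0 < t \<Longrightarrow> t \<le> \<delta> \<Longrightarrow> 0 < - ln t"
  by (rule order.strict_trans[OF zero_less_one ln_pos])

lemma ln_ge: "0 < t \<Longrightarrow> t \<le> \<delta> \<Longrightarrow> \<alpha> + 1 \<le> - ln t"
  using \<alpha> by (intro order_trans[OF _ ln_le]) auto

lemma B_continuous: "continuous_on {0<..} B"
  by (rule convex_on_continuous[OF open_greaterThan B_convex])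

text \<open>The antiderivative of \<open>B\<close> on \<open>(0, \<delta>]\<close> that vanishes at
  0. Since \<alpha> > 1, the power of \<open>- ln t\<close> is negative and tends to 0 there; this
  is what makes the singularity integrable.\<close>

definition H :: "real \<Rightarrow> real" where
  "H t = (if t \<le> 0 then 0 else (- ln t) powr (1 - \<alpha>) / (\<alpha> - 1))"

lemma B_has_integral:
  assumes "0 \<le> b" "b \<le> \<delta>"
  shows "(B has_integral H b) {0..b}"
proof (cases "b = 0")
  case True
  then show ?thesis using has_integral_refl(2)[of B 0] by (simp add: H_def)
next
  case False
  then have "0 < b" using assms by simp
  have "(B has_integral H b - H 0) {0..b}"
  proof (rule fundamental_theorem_of_calculus_interior[OF assms(1)])
    have at0: "(H \<longlongrightarrow> 0) (at_right 0)"
    proof -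
      have "LIM t at_right (0::real). - ln t :> at_top"
        using ln_at_0 by (simp add: filterlim_uminus_at_top)
      then have "((\<lambda>t::real. (- ln t) powr (1 - \<alpha>) / (\<alpha> - 1)) \<longlongrightarrow> 0 / (\<alpha> - 1)) (at_right 0)"
        using \<alpha> by (intro tendsto_divide tendsto_neg_powr tendsto_const) auto
      moreover have "eventually (\<lambda>t. (- ln t) powr (1 - \<alpha>) / (\<alpha> - 1) = H t) (at_right 0)"
        using eventually_at_right_less[of "0::real"] by eventually_elim (simp add: H_def)
      ultimately show ?thesis by (simp add: tendsto_cong)
    qed
    show "continuous_on {0..b} H"
      unfolding continuous_on_def
    proof
      fix t assume t: "t \<in> {0..b}"
      show "(H \<longlongrightarrow> H t) (at t within {0..b})"
      proof (cases "t = 0")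
        case True
        then show ?thesis using at0 \<open>0 < b\<close> by (simp add: at_within_Icc_at_right H_def)
      next
        case False
        then have "0 < t" "t \<le> \<delta>" using t assms by auto
        then have t0: "0 < t" "- ln t > 0" using ln_pos[of t] by linarith+
        have "((\<lambda>t. (- ln t) powr (1 - \<alpha>) / (\<alpha> - 1)) \<longlongrightarrow> (- ln t) powr (1 - \<alpha>) / (\<alpha> - 1)) (at t)"
          using t0 \<alpha> by (intro tendsto_intros) auto
        moreover have "eventually (\<lambda>s. (- ln s) powr (1 - \<alpha>) / (\<alpha> - 1) = H s) (at t)"
          using t0(1) by (intro eventually_at_topological[THEN iffD2] exI[of _ "{0<..}"]) (auto simp: H_def)
        ultimately have "(H \<longlongrightarrow> (- ln t) powr (1 - \<alpha>) / (\<alpha> - 1)) (at t)"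
          by (rule Lim_transform_eventually)
        then have "(H \<longlongrightarrow> H t) (at t)" using t0 by (simp add: H_def)
        then show ?thesis by (rule tendsto_within_subset) simp
      qed
    qed
    fix t assume t: "t \<in> {0<..<b}"
    then have "0 < t" "t \<le> \<delta>" using assms by auto
    then have t0: "0 < t" "- ln t > 0" "t \<le> \<delta>" using ln_pos[of t] by linarith+
    have "((\<lambda>t. (- ln t) powr (1 - \<alpha>) / (\<alpha> - 1)) has_real_derivative B t) (at t)"
    proof -
      have "((\<lambda>t. - ln t) has_real_derivative - (1 / t)) (at t)"
        using t0 by (auto intro!: derivative_eq_intros)
      from DERIV_cdivide[OF DERIV_fun_powr[OF this t0(2), of "1 - \<alpha>"], of "\<alpha> - 1"]
      have "((\<lambda>t. (- ln t) powr (1 - \<alpha>) / (\<alpha> - 1)) has_real_derivative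
        (1 - \<alpha>) * (- ln t) powr (- \<alpha>) * - (1 / t) / (\<alpha> - 1)) (at t)" by simp
      moreover have "(1 - \<alpha>) * (- ln t) powr (- \<alpha>) * - (1 / t) / (\<alpha> - 1) = B t"
        unfolding B_near[OF t0(1,3)] powr_minus_divide using \<alpha> by (simp add: divide_simps)
      ultimately show ?thesis by simp
    qed
    moreover have "eventually (\<lambda>s. (- ln s) powr (1 - \<alpha>) / (\<alpha> - 1) = H s) (nhds t)"
      using t0(1) by (intro eventually_nhds[THEN iffD2] exI[of _ "{0<..}"]) (auto simp: H_def)
    ultimately have "(H has_real_derivative B t) (at t)"
      by (simp add: DERIV_cong_ev)
    then show "(H has_vector_derivative B t) (at t)"
      by (simp add: has_real_derivative_iff_has_vector_derivative)
  qed
  then show ?thesis by (simp add: H_def)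
qed

lemma B_measurable_Ioo [measurable]: "(\<lambda>t. indicator {0<..<c} t * B t) \<in> borel_measurable borel"
proof -
  have "(\<lambda>t. indicator {0<..<c} t *\<^sub>R B t) \<in> borel_measurable borel"
    by (rule borel_measurable_continuous_on_indicator) (auto intro: continuous_on_subset[OF B_continuous])
  then show ?thesis by simp
qed

lemma B_integrable_on: "B integrable_on {0..c}"
proof -
  consider "c \<le> 0" | "0 < c" "c \<le> \<delta>" | "\<delta> < c" by linarith
  then show ?thesis
  proof cases
    case 1
    then show ?thesis by (cases "c = 0") (use has_integral_refl(2)[of B 0] in \<open>auto simp: integrable_on_empty\<close>)
  next
    case 2
    then show ?thesis using B_has_integral[of c] by auto
  next
    case 3
    have "B integrable_on {0..\<delta>}" using B_has_integral[of \<delta>] \<delta> by auto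
    moreover have "B integrable_on {\<delta>..c}"
      using \<delta> by (intro integrable_continuous_real continuous_on_subset[OF B_continuous]) auto
    ultimately show ?thesis
      using 3 \<delta> by (intro Henstock_Kurzweil_Integration.integrable_combine[of 0 \<delta> c]) auto
  qed
qed

lemma B_integrable: "integrable lborel (\<lambda>t. indicator {0<..<c} t * B t)"
proof -
  have "B integrable_on {0<..<c}"
    using B_integrable_on by (simp add: integrable_on_Icc_iff_Ioo)
  then have "B absolutely_integrable_on {0<..<c}"
    by (rule nonnegative_absolutely_integrable_1) (auto intro: B_nonneg)
  then have "integrable lebesgue (\<lambda>t. indicator {0<..<c} t * B t)"
    by (simp add: set_integrable_def)
  then show ?thesis by (simp add: integrable_completion)
qed

lemma B_mult_integrable:
  assumes "f \<in> borel_measurable borel" "\<And>t. \<bar>f t\<bar> \<le> 1"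
  shows "integrable lborel (\<lambda>t. indicator {0<..<c} t * (B t * f t))"
proof (rule Bochner_Integration.integrable_bound[OF B_integrable[of c]])
  have "(\<lambda>t. (indicator {0<..<c} t * B t) * f t) \<in> borel_measurable borel" using assms(1) by measurable
  then show "(\<lambda>t. indicator {0<..<c} t * (B t * f t)) \<in> borel_measurable lborel"
    by (simp add: mult.assoc)
  show "AE t in lborel. norm (indicator {0<..<c} t * (B t * f t)) \<le> norm (indicator {0<..<c} t * B t)"
    using assms(2) by (intro AE_I2) (auto simp: abs_mult indicator_def mult_left_le)
qed

lemma lborel_integral_eq_integral:
  fixes g :: "real \<Rightarrow> real"
  assumes "integrable lborel (\<lambda>t. indicator {a<..<b} t * g t)"
  shows "g integrable_on {a..b}" "(LINT t|lborel. indicator {a<..<b} t * g t) = integral {a..b} g"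
proof -
  have "set_integrable lborel {a<..<b} g" using assms by (simp add: set_integrable_def)
  from set_borel_integral_eq_integral[OF this] 
  show "g integrable_on {a..b}" "(LINT t|lborel. indicator {a<..<b} t * g t) = integral {a..b} g"
    by (simp_all add: integrable_on_Icc_iff_Ioo integral_open_interval_real set_lebesgue_integral_def)
qed

lemma B_mult_integrable_on:
  assumes "f \<in> borel_measurable borel" "\<And>t. \<bar>f t\<bar> \<le> 1" "0 \<le> a"
  shows "(\<lambda>t. B t * f t) integrable_on {a..b}"
proof (cases "a \<le> b")
  case True
  show ?thesis
    using lborel_integral_eq_integral(1)[OF B_mult_integrable[OF assms(1,2), of b]]
    by (rule integrable_subinterval_real) (use True assms(3) in auto)
qed (auto simp: integrable_on_empty)

section \<open>The periodized kernel and its cosine coefficients\<close>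

definition cos_int :: "nat \<Rightarrow> real" where
  "cos_int k = integral {0..T} (\<lambda>v. B v * cos (2 * pi * real k * v / T))"

text \<open>The \<open>2 T\<close>-periodic extension of \<open>B\<close> from \<open>(-T, T)\<close>, cut off to
  make it integrable.\<close>

definition ker :: "real \<Rightarrow> real" where
  "ker u = (if \<bar>u\<bar> < T then B \<bar>u\<bar> else if \<bar>u\<bar> < 2 * T then B (2 * T - \<bar>u\<bar>) else 0)"

lemma ker_integrable: "integrable lborel ker"
proof -
  let ?b = "\<lambda>t. indicator {0<..<T} t * B t"
  have b: "integrable lborel ?b" by (rule B_integrable)
  have i: "integrable lborel (\<lambda>u. ?b u + ?b (- u) + ?b (2 * T - u) + ?b (2 * T + u))"
    using b lborel_integrable_real_affine[OF b, of "-1" 0] lborel_integrable_real_affine[OF b, of "-1" "2 * T"]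
      lborel_integrable_real_affine[OF b, of 1 "2 * T"]
    by (intro Bochner_Integration.integrable_add) simp_all
  have meas: "ker \<in> borel_measurable borel"
  proof -
    have "ker = (\<lambda>u. (indicator {0<..<T} \<bar>u\<bar> * B \<bar>u\<bar> + indicator {0<..<2 * T} (2 * T - \<bar>u\<bar>) * B (2 * T - \<bar>u\<bar>)
        * indicator {T..<2 * T} \<bar>u\<bar>) + indicator {0} u * B 0)"
      using T by (auto simp: ker_def fun_eq_iff indicator_def)
    moreover have "(\<lambda>u. indicator {0<..<T} \<bar>u\<bar> * B \<bar>u\<bar>) \<in> borel_measurable borel"
      using measurable_compose[OF _ B_measurable_Ioo[of T], of "\<lambda>u. \<bar>u\<bar>" borel] by simp
    moreover have "(\<lambda>u. indicator {0<..<2 * T} (2 * T - \<bar>u\<bar>) * B (2 * T - \<bar>u\<bar>)) \<in> borel_measurable borel"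
      using measurable_compose[OF _ B_measurable_Ioo[of "2 * T"], of "\<lambda>u. 2 * T - \<bar>u\<bar>" borel] by simp
    ultimately show ?thesis by simp
  qed
  have "AE u in lborel. ?b u + ?b (- u) + ?b (2 * T - u) + ?b (2 * T + u) = ker u"
    using AE_not_in_lborel[of 0] AE_not_in_lborel[of T] AE_not_in_lborel[of "- T"]
  proof eventually_elim
    case (elim u)
    then show ?case using T by (auto simp: ker_def indicator_def abs_if)
  qed
  then show ?thesis using i meas by (subst integrable_cong_AE[symmetric]) (auto dest: borel_measurable_integrable)
qed

sublocale ker: periodic_kernel ker "2 * T"
proof
  fix u assume "- (2 * T) < u" "u < 0"
  then consider "u < - T" | "u = - T" | "- T < u" by linarith
  then show "ker (u + 2 * T) = ker u"
    using T \<open>- (2 * T) < u\<close> \<open>u < 0\<close> by cases (auto simp: ker_def add.commute)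
qed (use T ker_integrable in \<open>auto simp: ker_def\<close>)

text \<open>As \<open>B\<close> is decreasing, the kernel is the maximum of \<open>B u\<close> and
  \<open>B (2 * T - u)\<close>, hence convex even across the reflection point
  \<open>T\<close>.\<close>

lemma ker_convex: "convex_on {0<..<2 * T} ker"
proof -
  have eq: "ker u = max (B u) (B (2 * T - u))" if "u \<in> {0<..<2 * T}" for u
    using that B_antimono[of u "2 * T - u"] B_antimono[of "2 * T - u" u] by (auto simp: ker_def max_def)
  show ?thesis
  proof (rule convex_onI)
    fix t x y :: real assume t: "0 < t" "t < 1" and xy: "x \<in> {0<..<2 * T}" "y \<in> {0<..<2 * T}"
    let ?z = "(1 - t) *\<^sub>R x + t *\<^sub>R y"
    have z: "?z \<in> {0<..<2 * T}"
      using convex_real_interval(8)[of 0 "2 * T"] t xy unfolding convex_alt by auto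
    have "B ?z \<le> (1 - t) * B x + t * B y"
      by (rule convex_onD[OF B_convex]) (use t xy in auto)
    also have "\<dots> \<le> (1 - t) * ker x + t * ker y"
      using t xy by (intro add_mono mult_left_mono) (auto simp: eq)
    finally have 1: "B ?z \<le> (1 - t) * ker x + t * ker y" .
    have "2 * T - ?z = (1 - t) *\<^sub>R (2 * T - x) + t *\<^sub>R (2 * T - y)" by (simp add: algebra_simps)
    then have "B (2 * T - ?z) \<le> (1 - t) * B (2 * T - x) + t * B (2 * T - y)"
      using convex_onD[OF B_convex, of t "2 * T - x" "2 * T - y"] t xy by auto
    also have "\<dots> \<le> (1 - t) * ker x + t * ker y"
      using t xy by (intro add_mono mult_left_mono) (auto simp: eq)
    finally have 2: "B (2 * T - ?z) \<le> (1 - t) * ker x + t * ker y" .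
    show "ker ?z \<le> (1 - t) * ker x + t * ker y" using 1 2 unfolding eq[OF z] by simp
  qed simp
qed

lemma ker_mult_integrable:
  assumes "f \<in> borel_measurable borel" "\<And>t. \<bar>f t\<bar> \<le> 1"
  shows "integrable lborel (\<lambda>t. indicator {0<..<c} t * (ker t * f t))"
  using integrable_mult_indicator[OF _ ker.integrable_A_mult[OF assms], of "{0<..<c}"] by simp

text \<open>For \<open>m > 0\<close> the interval \<open>(0, 2 * T)\<close> consists of
  \<open>m\<close> full periods of the cosine, and the kernel is convex on it.\<close>

lemma cos_coeff_ker_nonneg: "0 \<le> cos_coeff ker (2 * T) m"
proof (cases "m = 0")
  case True
  \<comment> \<open>\<open>B 0\<close> is arbitrary and may make \<open>ker 0\<close> negative; the
    open interval of integration excludes this point.\<close>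
  have "0 \<le> ker u" if "u \<noteq> 0" for u using that B_nonneg[of "\<bar>u\<bar>"] B_nonneg[of "2 * T - \<bar>u\<bar>"] by (auto simp: ker_def)
  then have "0 \<le> indicator {0<..<2 * T} u * ker u" for u by (cases "u = 0") auto
  then show ?thesis using True by (simp add: cos_coeff_def)
next
  case False
  define p where "p = 2 * T / real m"
  have p: "0 < p" "real m * p = 2 * T" using False T by (simp_all add: p_def)
  have eq: "cos (2 * pi * real m * u / (2 * T)) = cos (2 * pi * u / p)" for u
    using False T by (simp add: p_def field_simps)
  have i: "integrable lborel (\<lambda>t. indicator {0<..<2 * T} t * (ker t * cos (2 * pi * t / p)))"
    by (rule ker_mult_integrable) simp_all
  have "0 \<le> integral {0..real m * p} (\<lambda>v. ker v * cos (2 * pi * v / p))"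
    using lborel_integral_eq_integral(1)[OF i] ker_convex False
    by (intro convex_cos_integral_nonneg p(1)) (simp_all add: p(2))
  also have "\<dots> = cos_coeff ker (2 * T) m"
    unfolding cos_coeff_def eq p(2) lborel_integral_eq_integral(2)[OF i, symmetric]
    by (intro Bochner_Integration.integral_cong refl) (rule mult.assoc[symmetric])
  finally show ?thesis .
qed

text \<open>Frequency \<open>k\<close> for the period \<open>T\<close> is frequency
  \<open>2 * k\<close> for \<open>2 * T\<close>. The halves \<open>(0, T)\<close> and
  \<open>(T, 2 * T)\<close> are mirror images and contribute equally.\<close>

lemma cos_coeff_ker_even: "cos_coeff ker (2 * T) (2 * k) = 2 * cos_int k"
proof -
  let ?f = "\<lambda>u. indicator {0<..<T} u * (B u * cos (2 * pi * real k * u / T))"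
  have f: "integrable lborel ?f" by (rule B_mult_integrable) simp_all
  have f': "integrable lborel (\<lambda>u. ?f (2 * T - u))"
    using lborel_integrable_real_affine[OF f, of "-1" "2 * T"] by simp
  have cos: "cos (2 * pi * real k * (2 * T - u) / T) = cos (2 * pi * real k * u / T)" for u
  proof -
    have "2 * pi * real k * (2 * T - u) / T = real (2 * k) * (2 * pi) - 2 * pi * real k * u / T"
      using T by (simp add: field_simps)
    then show ?thesis by (simp only: cos_diff sin_cos_nat_2pi)
  qed
  have "cos_coeff ker (2 * T) (2 * k) = (LINT u|lborel. ?f u + ?f (2 * T - u))"
    unfolding cos_coeff_def
  proof (rule integral_cong_AE)
    show "(\<lambda>u. indicator {0<..<2 * T} u * ker u * cos (2 * pi * real (2 * k) * u / (2 * T))) \<in> borel_measurable lborel"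
      by simp
    show "(\<lambda>u. ?f u + ?f (2 * T - u)) \<in> borel_measurable lborel" using f f' by (auto dest: borel_measurable_integrable)
    have eq: "2 * pi * real (2 * k) * u / (2 * T) = 2 * pi * real k * u / T" for u by simp
    show "AE u in lborel. indicator {0<..<2 * T} u * ker u * cos (2 * pi * real (2 * k) * u / (2 * T)) = ?f u + ?f (2 * T - u)"
      using AE_not_in_lborel[of T]
    proof eventually_elim
      case (elim u)
      then show ?case unfolding eq cos by (auto simp: ker_def indicator_def)
    qed
  qed
  also have "\<dots> = (LINT u|lborel. ?f u) + (LINT u|lborel. ?f (2 * T - u))"
    by (rule Bochner_Integration.integral_add[OF f f'])
  also have "(LINT u|lborel. ?f (2 * T - u)) = (LINT u|lborel. ?f u)"
    using lborel_integral_real_affine[of "-1" ?f "2 * T"] by simp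
  also have "(LINT u|lborel. ?f u) = cos_int k"
    unfolding cos_int_def by (rule lborel_integral_eq_integral(2)[OF f])
  finally show ?thesis by simp
qed

end

context log_kernel
begin

section \<open>Lower bound for the cosine integrals\<close>

text \<open>The derivative is \<open>(- ln v) powr \<alpha> * (- ln v - (\<alpha> + 1))\<close>, and
  \<open>\<delta>\<close> is so small that \<open>- ln v\<close> is at least
  \<open>\<alpha> + 1\<close>.\<close>

lemma mult_ln_powr_mono:
  assumes "0 < s" "s \<le> t" "t \<le> \<delta>"
  shows "s * (- ln s) powr (\<alpha> + 1) \<le> t * (- ln t) powr (\<alpha> + 1)"
proof (rule DERIV_nonneg_imp_nondecreasing[OF assms(2)])
  fix v assume v: "s \<le> v" "v \<le> t"
  then have v0: "0 < v" "v \<le> \<delta>" using assms by auto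
  have L: "0 < - ln v" "\<alpha> + 1 \<le> - ln v" using ln_gt_0[OF v0] ln_ge[OF v0] by blast+
  have "((\<lambda>t. - ln t) has_real_derivative - (1 / v)) (at v)"
    using v0 by (auto intro!: derivative_eq_intros)
  from DERIV_mult[OF DERIV_ident DERIV_fun_powr[OF this L(1), of "\<alpha> + 1"]]
  have "((\<lambda>v. v * (- ln v) powr (\<alpha> + 1)) has_real_derivative
      (- ln v) powr (\<alpha> + 1) - (\<alpha> + 1) * (- ln v) powr \<alpha>) (at v)"
    using v0 by (simp add: algebra_simps)
  moreover have "0 \<le> (- ln v) powr (\<alpha> + 1) - (\<alpha> + 1) * (- ln v) powr \<alpha>"
  proof -
    have "(\<alpha> + 1) * (- ln v) powr \<alpha> \<le> - ln v * (- ln v) powr \<alpha>" using L by (intro mult_right_mono) auto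
    also have "\<dots> = (- ln v) powr (\<alpha> + 1)" using L by (simp add: powr_add)
    finally show ?thesis by simp
  qed
  ultimately show "\<exists>y. ((\<lambda>v. v * (- ln v) powr (\<alpha> + 1)) has_real_derivative y) (at v) \<and> 0 \<le> y" by blast
qed

text \<open>By monotonicity the maximum of \<open>t * (- ln t) powr (\<alpha> + 1)\<close> over
  \<open>(0, \<delta>]\<close>; it allows a factor \<open>t\<close> to absorb logarithms.\<close>

definition K0 :: real where
  "K0 = \<delta> * (- ln \<delta>) powr (\<alpha> + 1)"

lemma K0_pos: "0 < K0"
  unfolding K0_def using \<delta>(1) ln_pos[of \<delta>] by (intro mult_pos_pos) auto

lemma mult_ln_powr_le: "0 < t \<Longrightarrow> t \<le> \<delta> \<Longrightarrow> t * (- ln t) powr (\<alpha> + 1) \<le> K0"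
  unfolding K0_def by (rule mult_ln_powr_mono) auto

text \<open>The maximum property of \<open>K0\<close> gives \<open>B t >= - ln t / K0\<close>, and
  the witness makes the right-hand side reach \<open>\<bar>M\<bar>\<close>.\<close>

lemma B_unbounded:
  obtains \<eta> where "0 < \<eta>" "\<eta> \<le> \<delta>" "\<And>t. 0 < t \<Longrightarrow> t \<le> \<eta> \<Longrightarrow> M \<le> B t"
proof
  let ?\<eta> = "min \<delta> (exp (- (K0 * \<bar>M\<bar>)))"
  show "0 < ?\<eta>" "?\<eta> \<le> \<delta>" using \<delta> by auto
  fix t assume t: "0 < t" "t \<le> ?\<eta>"
  have "ln t \<le> - (K0 * \<bar>M\<bar>)" using t ln_mono[of t "exp (- (K0 * \<bar>M\<bar>))"] by simp
  then have 1: "K0 * \<bar>M\<bar> \<le> - ln t" by simp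
  have L: "0 < - ln t" using t by (intro ln_gt_0) auto
  have "t * (- ln t) powr \<alpha> * - ln t \<le> K0"
    using mult_ln_powr_le[of t] t L by (simp add: powr_add mult.assoc)
  then have "- ln t / K0 \<le> B t"
    using t L K0_pos by (simp add: B_near field_simps)
  moreover have "\<bar>M\<bar> \<le> - ln t / K0" using 1 K0_pos by (simp add: field_simps)
  ultimately show "M \<le> B t" by linarith
qed

text \<open>Of the whole integral only the first period is kept, and of that only
  \<open>(0, b)\<close>: after subtraction of the secant the integrand is nonnegative, so discarding
  the rest can only decrease it. On \<open>(0, b)\<close> the secant is at most twice the value of
  \<open>B\<close> at a quarter period.\<close>

lemma cos_int_lower:
  assumes k: "1 \<le> k" and b: "0 < b" "b \<le> T / (8 * real k)" "b \<le> \<delta>"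
  shows "(H b - 2 * B (T / (4 * real k)) * b) / 2 \<le> cos_int k"
proof -
  define p where "p = T / real k"
  have p: "0 < p" "real k * p = T" using k T by (auto simp: p_def)
  have bp: "b \<le> p / 8" "T / (4 * real k) = p / 4" using b by (simp_all add: p_def)
  let ?g = "\<lambda>v. B v * cos (2 * pi * v / p)"
  let ?h = "\<lambda>v. (B v - secant B (p / 4) (3 * p / 4) v) * cos (2 * pi * v / p)"
  have eq: "cos (2 * pi * real k * v / T) = cos (2 * pi * v / p)" for v
    using k by (simp add: p_def field_simps)
  have gi: "?g integrable_on {0..c}" for c by (rule B_mult_integrable_on) auto
  have cvx: "convex_on {0<..<c} B" for c by (rule convex_on_subset[OF B_convex]) auto
  have "integral {0..p} ?g \<le> integral {0..real k * p} ?g"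
    by (rule convex_cos_integral_mono[OF p(1) cvx gi]) (use k in simp)
  then have 1: "integral {0..p} ?g \<le> cos_int k" by (simp add: cos_int_def eq p(2))
  have "(?g has_integral integral {0..p} ?g) {0..p}" using gi by (rule integrable_integral)
  then have h: "(?h has_integral integral {0..p} ?g) {0..p}"
    by (rule convex_cos_period(1)[OF p(1) cvx])
  have h0: "(?h has_integral integral {0..p} ?g) {0<..<p}" using h by (simp add: has_integral_Icc_iff_Ioo)
  have hb: "?h integrable_on {0..b}"
    using integrable_subinterval_real[of ?h 0 p 0 b] h b(1) bp(1) p by auto
  have "integral {0<..<b} ?h \<le> integral {0<..<p} ?h"
  proof (rule integral_subset_le)
    show "?h integrable_on {0<..<b}" using hb by (simp add: integrable_on_Icc_iff_Ioo)
    show "?h integrable_on {0<..<p}" using h0 by blast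
    show "\<forall>v\<in>{0<..<p}. 0 \<le> ?h v"
      using convex_cos_period_pointwise[OF p(1) cvx] by simp
  qed (use bp(1) b(1) p in auto)
  also have "\<dots> = integral {0..p} ?g" using h0 by (rule integral_unique)
  finally have 2: "integral {0<..<b} ?h \<le> integral {0..p} ?g" .
  define \<beta> where "\<beta> = B (p / 4)"
  have "B integrable_on {0<..<b}" using B_integrable_on[of b] by (simp add: integrable_on_Icc_iff_Ioo)
  moreover have "integral {0<..<b} B = H b"
    using B_has_integral[of b] b by (simp add: integral_open_interval_real[symmetric] integral_unique)
  ultimately have "((\<lambda>v. (1 / 2) * (B v - 2 * \<beta>)) has_integral (1 / 2) * (H b - 2 * \<beta> * b)) {0<..<b}"
    using has_integral_mult_right[OF has_integral_diff, of B "H b" "{0<..<b}" "\<lambda>_. 2 * \<beta>" "2 * \<beta> * b" "1 / 2"]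
      has_integral_const_real[of "2 * \<beta>" 0 b] b(1)
    by (simp add: has_integral_Icc_iff_Ioo[symmetric] has_integral_integral mult.commute)
  then have "(1 / 2) * (H b - 2 * \<beta> * b) \<le> integral {0<..<b} ?h"
  proof (rule has_integral_le)
    show "(?h has_integral integral {0<..<b} ?h) {0<..<b}"
      using hb by (intro integrable_integral) (simp add: integrable_on_Icc_iff_Ioo)
    fix v assume v: "v \<in> {0<..<b}"
    have \<beta>: "0 \<le> B (3 * p / 4)" "B (3 * p / 4) \<le> \<beta>"
      unfolding \<beta>_def using B_nonneg[of "3 * p / 4"] B_antimono[of "p / 4" "3 * p / 4"] p by auto
    have vp: "0 < v" "v \<le> p / 8" using v bp by auto
    \<comment> \<open>Going left from \<open>p / 4\<close>, the secant gains at most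
      \<open>(p / 4) * (\<beta> / (p / 2)) = \<beta> / 2\<close>.\<close>
    have "secant B (p / 4) (3 * p / 4) v = \<beta> + (p / 4 - v) * ((\<beta> - B (3 * p / 4)) / (p / 2))"
      by (simp add: secant_def \<beta>_def field_simps)
    also have "\<dots> \<le> \<beta> + (p / 4) * (\<beta> / (p / 2))"
      using vp p \<beta> by (intro add_left_mono mult_mono divide_right_mono) auto
    also have "\<dots> \<le> 2 * \<beta>" using p \<beta> by (simp add: field_simps)
    finally have s: "secant B (p / 4) (3 * p / 4) v \<le> 2 * \<beta>" .
    have s0: "0 \<le> B v - secant B (p / 4) (3 * p / 4) v"
      using convex_secant(2)[OF cvx[of p], of "p / 4" "3 * p / 4" v] vp p by auto
    \<comment> \<open>\<open>v <= p / 8\<close> even gives \<open>pi / 4\<close>; the bound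
      \<open>pi / 3\<close> is convenient because its cosine is 1/2.\<close>
    have "2 * pi * v / p \<le> pi / 3" using vp p pi_gt_zero by (simp add: field_simps)
    then have "cos (pi / 3) \<le> cos (2 * pi * v / p)"
      using vp p pi_gt_zero by (intro cos_monotone_0_pi_le) (auto simp: field_simps)
    then have "(B v - secant B (p / 4) (3 * p / 4) v) * (1 / 2) \<le> ?h v"
      using s0 by (intro mult_left_mono) (auto simp: cos_60)
    then show "(1 / 2) * (B v - 2 * \<beta>) \<le> ?h v" using s by simp
  qed
  then show ?thesis using 1 2 by (simp add: bp(2) \<beta>_def)
qed

text \<open>For a fixed frequency the singularity of \<open>B\<close> exceeds the constant
  \<open>2 * \<beta>\<close> on a short interval. This covers the finitely many frequencies that the
  asymptotic bound misses.\<close>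

lemma cos_int_pos: "0 < cos_int k"
proof (cases "k = 0")
  case True
  have "0 < H \<delta>" using \<alpha> \<delta>(1) ln_gt_0[of \<delta>] by (simp add: H_def)
  also have "H \<delta> = integral {0<..<\<delta>} B"
    using B_has_integral[of \<delta>] \<delta> by (simp add: integral_open_interval_real[symmetric] integral_unique)
  also have "\<dots> \<le> integral {0<..<T} B"
    using \<delta> T B_integrable_on by (intro integral_subset_le) (auto simp: integrable_on_Icc_iff_Ioo[symmetric] intro: B_nonneg)
  also have "\<dots> = cos_int k" using True by (simp add: cos_int_def integral_open_interval_real[symmetric])
  finally show ?thesis .
next
  case False
  define \<beta> where "\<beta> = B (T / (4 * real k))"
  obtain \<eta> where \<eta>: "0 < \<eta>" "\<eta> \<le> \<delta>" "\<And>t. 0 < t \<Longrightarrow> t \<le> \<eta> \<Longrightarrow> 2 * \<beta> + 1 \<le> B t"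
    using B_unbounded by metis
  define b where "b = min \<eta> (T / (8 * real k))"
  have b: "0 < b" "b \<le> T / (8 * real k)" "b \<le> \<delta>" "b \<le> \<eta>" using \<eta> T False by (auto simp: b_def)
  have "((\<lambda>_. 2 * \<beta> + 1) has_integral (2 * \<beta> + 1) * b) {0<..<b}"
    using has_integral_const_real[of "2 * \<beta> + 1" 0 b] b(1) by (simp add: has_integral_Icc_iff_Ioo[symmetric] mult.commute)
  moreover have "(B has_integral H b) {0<..<b}"
    using B_has_integral[of b] b by (simp add: has_integral_Icc_iff_Ioo)
  ultimately have "(2 * \<beta> + 1) * b \<le> H b"
    by (rule has_integral_le) (use \<eta>(3) b in auto)
  then have "0 < (H b - 2 * \<beta> * b) / 2" using b(1) by (simp add: algebra_simps)
  then show ?thesis using cos_int_lower[of k b] b False unfolding \<beta>_def by simp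
qed

text \<open>Take \<open>b\<close> of order \<open>1 / k\<close> and \<open>l = - ln b\<close>. The
  gain \<open>H b\<close> is of order \<open>l powr (1 - \<alpha>)\<close>, the subtracted term of
  order \<open>l powr (- \<alpha>)\<close>, one logarithm smaller; for large \<open>k\<close> it
  consumes at most half of the gain.\<close>

lemma cos_int_ln_bound:
  obtains c where "0 < c" "\<And>k. c * ln (real k + 2) powr (1 - \<alpha>) \<le> cos_int k"
proof -
  \<comment> \<open>\<open>1 / b >= E\<close> ensures in turn \<open>b <= \<delta>\<close>, then
    \<open>2 * ln 2 <= l\<close> (so that \<open>- ln (2 * b) >= l / 2\<close>), and finally
    \<open>2 powr \<alpha> / l <= 1 / (2 * (\<alpha> - 1))\<close>.\<close>
  define E where "E = max (1 / \<delta>) (max (exp (2 * ln 2)) (exp (2 powr (\<alpha> + 1) * (\<alpha> - 1))))"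
  \<comment> \<open>The term \<open>E * T\<close> controls \<open>1 / b\<close> and
    \<open>1 / (2 * b)\<close>; \<open>8 / T\<close> gives \<open>1 / b <= k^2\<close> and hence
    \<open>l <= 2 * ln (k + 2)\<close>.\<close>
  obtain k0 :: nat where k0: "E * T + 8 / T + 1 \<le> real k0" using real_arch_simple by blast
  have E0: "0 < E" using \<delta> by (simp add: E_def less_max_iff_disj)
  define c1 where "c1 = 2 powr (1 - \<alpha>) / (4 * (\<alpha> - 1))"
  have c1: "0 < c1" using \<alpha> by (simp add: c1_def)
  have large: "c1 * ln (real k + 2) powr (1 - \<alpha>) \<le> cos_int k" if k: "k0 \<le> k" for k
  proof -
    have kk: "E * T + 8 / T + 1 \<le> real k" using k0 k by linarith
    have pos: "0 \<le> E * T" "0 \<le> 8 / T" using E0 T by auto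
    then have k1: "1 \<le> real k" "E * T \<le> real k" "8 / T \<le> real k" using kk by linarith+
    define b where "b = T / (8 * real k)"
    have b0: "0 < b" using T k1 by (simp add: b_def)
    have Eb: "E \<le> 1 / b"
    proof -
      have "E * T \<le> 8 * real k" using k1 by linarith
      then show ?thesis using T k1 by (simp add: b_def field_simps)
    qed
    define l where "l = - ln b"
    have l: "l = ln (1 / b)" using b0 by (simp add: l_def ln_div)
    have "1 / \<delta> \<le> 1 / b" "exp (2 * ln 2) \<le> 1 / b" "exp (2 powr (\<alpha> + 1) * (\<alpha> - 1)) \<le> 1 / b"
      using Eb by (simp_all add: E_def)
    then have b\<delta>: "b \<le> \<delta>" and l1: "2 * ln 2 \<le> l" and l2: "2 powr (\<alpha> + 1) * (\<alpha> - 1) \<le> l"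
      unfolding l using b0 \<delta>(1) ln_ge_iff[of "1 / b"] by (simp add: field_simps, simp_all only: zero_less_divide_1_iff)
    have lpos: "0 < l" using l1 ln_gt_zero[of "2::real"] by linarith
    have "1 / (2 * b) \<ge> 1 / \<delta>"
    proof -
      have "E * T \<le> real k" by (rule k1)
      moreover have "1 / \<delta> \<le> E" by (simp add: E_def)
      ultimately have "1 / \<delta> * T \<le> real k" using T by (meson mult_right_mono order_trans less_imp_le)
      then show ?thesis using T k1 \<delta> by (simp add: b_def field_simps)
    qed
    then have "2 * b \<le> \<delta>" using b0 \<delta> by (simp add: field_simps)
    have "2 * B (T / (4 * real k)) * b = (- ln (2 * b)) powr (- \<alpha>)"
    proof -
      have "T / (4 * real k) = 2 * b" by (simp add: b_def)
      then show ?thesis using B_near[of "2 * b"] b0 \<open>2 * b \<le> \<delta>\<close> by (simp add: powr_minus_divide)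
    qed
    also have "\<dots> \<le> (l / 2) powr (- \<alpha>)"
    proof (rule powr_mono2')
      show "l / 2 \<le> - ln (2 * b)" using l1 b0 by (simp add: l_def ln_mult)
    qed (use \<alpha> lpos in auto)
    also have "\<dots> = 2 powr \<alpha> / l * l powr (1 - \<alpha>)"
      using lpos by (simp add: powr_divide powr_minus_divide powr_diff)
    also have "\<dots> \<le> 1 / (2 * (\<alpha> - 1)) * l powr (1 - \<alpha>)"
    proof (rule mult_right_mono)
      show "2 powr \<alpha> / l \<le> 1 / (2 * (\<alpha> - 1))"
        using l2 lpos \<alpha> by (simp add: field_simps powr_add)
    qed simp
    finally have "H b - 2 * B (T / (4 * real k)) * b \<ge> l powr (1 - \<alpha>) / (\<alpha> - 1) - 1 / (2 * (\<alpha> - 1)) * l powr (1 - \<alpha>)"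
      using b0 by (simp add: H_def l_def)
    also have "x / d - 1 / (2 * d) * x = x / (2 * d)" for x d :: real
      by (cases "d = 0") (simp_all add: field_simps)
    finally have "l powr (1 - \<alpha>) / (2 * (\<alpha> - 1)) / 2 \<le> (H b - 2 * B (T / (4 * real k)) * b) / 2"
      by (rule divide_right_mono) simp
    moreover have "x / (2 * d) / 2 = x / (4 * d)" for x d :: real by simp
    ultimately have "l powr (1 - \<alpha>) / (4 * (\<alpha> - 1)) \<le> (H b - 2 * B (T / (4 * real k)) * b) / 2"
      by (simp only:)
    also have "\<dots> \<le> cos_int k"
      using k1 b0 b\<delta> by (intro cos_int_lower) (auto simp: b_def)
    finally have 1: "l powr (1 - \<alpha>) / (4 * (\<alpha> - 1)) \<le> cos_int k" .
    have "l \<le> 2 * ln (real k + 2)"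
    proof -
      have "1 / b = 8 / T * real k" using T k1 by (simp add: b_def field_simps)
      also have "\<dots> \<le> real k * real k" using k1 by (intro mult_right_mono) auto
      also have "\<dots> \<le> (real k + 2) * (real k + 2)" by (intro mult_mono) auto
      finally have "l \<le> ln ((real k + 2) * (real k + 2))" unfolding l using b0 by (intro ln_mono) auto
      then show ?thesis by (simp add: ln_mult)
    qed
    then have "(2 * ln (real k + 2)) powr (1 - \<alpha>) \<le> l powr (1 - \<alpha>)"
      using lpos \<alpha> by (intro powr_mono2') auto
    then have "c1 * ln (real k + 2) powr (1 - \<alpha>) \<le> l powr (1 - \<alpha>) / (4 * (\<alpha> - 1))"
      using \<alpha> by (simp add: c1_def powr_mult divide_right_mono)
    then show ?thesis using 1 by linarith
  qed
  define q where "q k = cos_int k / ln (real k + 2) powr (1 - \<alpha>)" for k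
  have Lp: "0 < ln (real k + 2) powr (1 - \<alpha>)" for k by simp
  have q: "0 < q k" for k unfolding q_def using cos_int_pos Lp by (rule divide_pos_pos)
  define c where "c = Min (insert c1 (q ` {..<k0}))"
  have "0 < c" unfolding c_def using c1 q by (subst Min_gr_iff) auto
  moreover have "c * ln (real k + 2) powr (1 - \<alpha>) \<le> cos_int k" for k
  proof (cases "k < k0")
    case True
    then have "c \<le> q k" unfolding c_def by (intro Min_le) auto
    then show ?thesis using Lp[of k] by (simp add: q_def field_simps)
  next
    case False
    have "c \<le> c1" unfolding c_def by (intro Min_le) auto
    then have "c * ln (real k + 2) powr (1 - \<alpha>) \<le> c1 * ln (real k + 2) powr (1 - \<alpha>)" by (intro mult_right_mono) auto
    then show ?thesis using large[of k] False by linarith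
  qed
  ultimately show ?thesis by (rule that)
qed

end

section \<open>Upper bounds for the sine integrals\<close>

lemma integral_sin_le:
  fixes x :: real
  assumes "0 < x"
  shows "\<bar>integral {c..d} (\<lambda>v. sin (x * v))\<bar> \<le> 2 / x"
proof (cases "c \<le> d")
  case True
  have "((\<lambda>v. sin (x * v)) has_integral (- cos (x * d) / x - (- cos (x * c) / x))) {c..d}"
    using assms True
    by (intro fundamental_theorem_of_calculus)
      (auto intro!: derivative_eq_intros simp: has_real_derivative_iff_has_vector_derivative[symmetric])
  then have "integral {c..d} (\<lambda>v. sin (x * v)) = (cos (x * c) - cos (x * d)) / x"
    using assms by (simp add: integral_unique diff_divide_distrib)
  moreover have "\<bar>cos (x * c) - cos (x * d)\<bar> \<le> 2"
    using abs_cos_le_one[of "x * c"] abs_cos_le_one[of "x * d"] by linarith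
  ultimately show ?thesis using assms by (simp add: divide_right_mono)
qed (use assms in simp)

text \<open>The second mean value theorem reduces the integral to pure sine integrals over
  subintervals, each at most \<open>2 / x\<close>. That theorem is about nondecreasing functions,
  hence the change of sign of \<open>g\<close>.\<close>

lemma antimono_sin_integral:
  fixes g :: "real \<Rightarrow> real"
  assumes "a \<le> b" "0 < x" and g: "\<And>s t. a \<le> s \<Longrightarrow> s \<le> t \<Longrightarrow> t \<le> b \<Longrightarrow> g t \<le> g s"
  shows "\<bar>integral {a..b} (\<lambda>v. g v * sin (x * v))\<bar> \<le> 2 * (\<bar>g a\<bar> + \<bar>g b\<bar>) / x"
    and "(\<lambda>v. g v * sin (x * v)) integrable_on {a..b}"
proof -
  let ?s = "\<lambda>v. sin (x * v)"
  have "?s integrable_on {a..b}" by (intro integrable_continuous_real continuous_intros)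
  then obtain c where c: "((\<lambda>v. - g v * ?s v) has_integral (- g a * integral {a..c} ?s + - g b * integral {c..b} ?s)) {a..b}"
    by (rule second_mean_value_theorem_full[OF _ assms(1), of ?s "\<lambda>v. - g v"]) (use g in auto)
  then have "((\<lambda>v. g v * ?s v) has_integral (g a * integral {a..c} ?s + g b * integral {c..b} ?s)) {a..b}"
    using has_integral_neg[OF c] by (simp add: add.commute)
  then show "(\<lambda>v. g v * sin (x * v)) integrable_on {a..b}"
    and "\<bar>integral {a..b} (\<lambda>v. g v * sin (x * v))\<bar> \<le> 2 * (\<bar>g a\<bar> + \<bar>g b\<bar>) / x"
  proof -
    assume h: "((\<lambda>v. g v * ?s v) has_integral (g a * integral {a..c} ?s + g b * integral {c..b} ?s)) {a..b}"
    have "\<bar>g a * integral {a..c} ?s + g b * integral {c..b} ?s\<bar> \<le> \<bar>g a\<bar> * \<bar>integral {a..c} ?s\<bar> + \<bar>g b\<bar> * \<bar>integral {c..b} ?s\<bar>"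
      by (rule order_trans[OF abs_triangle_ineq]) (simp add: abs_mult)
    also have "\<dots> \<le> \<bar>g a\<bar> * (2 / x) + \<bar>g b\<bar> * (2 / x)"
      by (intro add_mono mult_left_mono integral_sin_le assms) auto
    also have "\<dots> = 2 * (\<bar>g a\<bar> + \<bar>g b\<bar>) / x" by (simp add: add_divide_distrib mult.commute)
    finally show "\<bar>integral {a..b} (\<lambda>v. g v * sin (x * v))\<bar> \<le> 2 * (\<bar>g a\<bar> + \<bar>g b\<bar>) / x"
      using h by (simp add: integral_unique)
  qed blast
qed

context log_kernel
begin

definition sin_int :: "real \<Rightarrow> real" where
  "sin_int x = integral {0..T} (\<lambda>v. B v * sin (x * v))"

lemma B_sin_integrable_on: "0 \<le> a \<Longrightarrow> (\<lambda>v. B v * sin (x * v)) integrable_on {a..b}"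
  by (rule B_mult_integrable_on) auto

text \<open>Split at \<open>a = 1 / x\<close>. Below,
  \<open>\<bar>sin (x * v)\<bar> <= x * v\<close> compensates the pole and leaves
  \<open>x * (- ln v) powr (- \<alpha>)\<close>; above, monotonicity of \<open>B\<close> gives
  \<open>4 * B a / x\<close>. The two parts contribute 1 and 4 to the constant.\<close>

lemma sin_int_le:
  assumes x: "1 / \<delta> \<le> x"
  shows "\<bar>sin_int x\<bar> \<le> 5 * ln x powr (- \<alpha>)"
proof -
  define a where "a = 1 / x"
  have "0 < 1 / \<delta>" using \<delta> by simp
  then have x0: "0 < x" using x by linarith
  have a: "0 < a" "a \<le> \<delta>" "a \<le> T" "x * a = 1" "- ln a = ln x"
  proof -
    show "0 < a" "x * a = 1" "- ln a = ln x" using x0 by (simp_all add: a_def ln_div)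
    show "a \<le> \<delta>" using x x0 \<delta>(1) by (simp add: a_def field_simps)
    then show "a \<le> T" using \<delta>(2) T by linarith
  qed
  have L: "0 < ln x" using ln_gt_0[OF a(1,2)] a(5) by simp
  have aB: "a * B a = ln x powr (- \<alpha>)"
    using a by (simp add: B_near powr_minus_divide)
  let ?g = "\<lambda>v. B v * sin (x * v)"
  have "norm (integral (cbox 0 a) ?g) \<le> (x * ln x powr (- \<alpha>)) * measure lborel (cbox 0 a)"
  proof (rule has_integral_bound)
    show "(?g has_integral integral (cbox 0 a) ?g) (cbox 0 a)"
      using B_sin_integrable_on[of 0 x a] by (simp add: integrable_integral)
    show "0 \<le> x * ln x powr (- \<alpha>)" using x0 by simp
    fix v assume v: "v \<in> cbox 0 a"
    show "norm (?g v) \<le> x * ln x powr (- \<alpha>)"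
    proof (cases "v = 0")
      case False
      then have v0: "0 < v" "v \<le> a" "v \<le> \<delta>" using v a by auto
      have "\<bar>sin (x * v)\<bar> \<le> x * v" using abs_sin_x_le_abs_x[of "x * v"] x0 v0 by simp
      then have "norm (?g v) \<le> B v * (x * v)"
        using B_nonneg[OF v0(1)] by (simp add: abs_mult mult_left_mono)
      also have "\<dots> = x * (- ln v) powr (- \<alpha>)"
        using v0 by (simp add: B_near powr_minus_divide)
      also have "\<dots> \<le> x * (ln x) powr (- \<alpha>)"
      proof (intro mult_left_mono powr_mono2')
        show "ln x \<le> - ln v" unfolding a(5)[symmetric] using v0 a(1) by simp
      qed (use L \<alpha> x0 in auto)
      finally show ?thesis .
    qed (use x0 in simp)
  qed
  also have "(x * ln x powr (- \<alpha>)) * measure lborel (cbox 0 a) = ln x powr (- \<alpha>) * (x * a)" using a by simp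
  finally have 1: "\<bar>integral {0..a} ?g\<bar> \<le> ln x powr (- \<alpha>)" by (simp add: a(4))
  have "\<bar>integral {a..T} ?g\<bar> \<le> 2 * (\<bar>B a\<bar> + \<bar>B T\<bar>) / x"
    using a x0 B_antimono by (intro antimono_sin_integral) auto
  also have "\<dots> \<le> 4 * B a / x"
    using a B_antimono[of a T] B_nonneg[of T] T x0 by (intro divide_right_mono) auto
  also have "\<dots> = 4 * (a * B a)" by (simp add: a_def)
  finally have 2: "\<bar>integral {a..T} ?g\<bar> \<le> 4 * ln x powr (- \<alpha>)" by (simp add: aB)
  have "sin_int x = integral {0..a} ?g + integral {a..T} ?g"
    unfolding sin_int_def using a B_sin_integrable_on
    by (intro Henstock_Kurzweil_Integration.integral_combine[symmetric]) auto
  then show ?thesis using 1 2 by linarith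
qed

lemma sin_int_bounded: "\<bar>sin_int x\<bar> \<le> integral {0..T} B"
proof -
  have "\<bar>integral {0..T} (\<lambda>v. B v * sin (x * v))\<bar> \<le> integral {0..T} B"
  proof -
    have "norm (integral {0<..<T} (\<lambda>v. B v * sin (x * v))) \<le> integral {0<..<T} B"
    proof (rule integral_norm_bound_integral)
      show "(\<lambda>v. B v * sin (x * v)) integrable_on {0<..<T}" "B integrable_on {0<..<T}"
        using B_sin_integrable_on[of 0 x T] B_integrable_on[of T] by (simp_all add: integrable_on_Icc_iff_Ioo)
      show "norm (B v * sin (x * v)) \<le> B v" if "v \<in> {0<..<T}" for v
        using that B_nonneg[of v] by (simp add: abs_mult mult_left_le)
    qed
    then show ?thesis by (simp add: integral_open_interval_real)
  qed
  then show ?thesis by (simp add: sin_int_def)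
qed

text \<open>For increments the part of \<open>B\<close> given by a formula is isolated. Lowering it
  by \<open>B \<delta>\<close> makes it vanish at \<open>\<delta>\<close>; what is left out is the
  bounded decreasing function \<open>B (max v \<delta>)\<close>, whose sine integral is of order
  \<open>1 / x\<close>.\<close>

definition sin_sing :: "real \<Rightarrow> real" where
  "sin_sing x = integral {0..\<delta>} (\<lambda>v. (B v - B \<delta>) * sin (x * v))"

lemma sin_int_minus_sing:
  assumes "0 < x"
  shows "\<bar>sin_int x - sin_sing x\<bar> \<le> 4 * B \<delta> / x"
proof -
  let ?c = "\<lambda>v. B (max v \<delta>)"
  let ?g = "\<lambda>v. ?c v * sin (x * v)"
  have B\<delta>: "0 \<le> B \<delta>" "0 \<le> B T" "B T \<le> B \<delta>" using B_nonneg \<delta> T B_antimono[of \<delta> T] by auto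
  have \<delta>T: "\<delta> \<le> T" using \<delta> T by simp
  have anti: "?c t \<le> ?c s" if "s \<le> t" for s t
    using that \<delta> by (intro B_antimono) auto
  note g = antimono_sin_integral[of 0 T x ?c, OF less_imp_le[OF T] assms anti]
  have "integral {0..T} ?g = integral {0..\<delta>} ?g + integral {\<delta>..T} ?g"
    using g(2) \<delta> \<delta>T by (intro Henstock_Kurzweil_Integration.integral_combine[symmetric]) auto
  also have "integral {0..\<delta>} ?g = integral {0..\<delta>} (\<lambda>v. B \<delta> * sin (x * v))"
    by (intro Henstock_Kurzweil_Integration.integral_cong) (auto simp: max_def)
  also have "integral {\<delta>..T} ?g = integral {\<delta>..T} (\<lambda>v. B v * sin (x * v))"
    by (intro Henstock_Kurzweil_Integration.integral_cong) (auto simp: max_def)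
  finally have 1: "integral {0..T} ?g = integral {0..\<delta>} (\<lambda>v. B \<delta> * sin (x * v)) + integral {\<delta>..T} (\<lambda>v. B v * sin (x * v))" .
  have "sin_sing x = integral {0..\<delta>} (\<lambda>v. B v * sin (x * v)) - integral {0..\<delta>} (\<lambda>v. B \<delta> * sin (x * v))"
    unfolding sin_sing_def left_diff_distrib
    by (intro Henstock_Kurzweil_Integration.integral_diff B_sin_integrable_on integrable_continuous_real continuous_intros) simp
  moreover have "sin_int x = integral {0..\<delta>} (\<lambda>v. B v * sin (x * v)) + integral {\<delta>..T} (\<lambda>v. B v * sin (x * v))"
    unfolding sin_int_def using \<delta> \<delta>T
    by (intro Henstock_Kurzweil_Integration.integral_combine[symmetric] B_sin_integrable_on) auto
  ultimately have "sin_int x - sin_sing x = integral {0..T} ?g" using 1 by simp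
  also have "\<bar>\<dots>\<bar> \<le> 2 * (\<bar>?c 0\<bar> + \<bar>?c T\<bar>) / x" by (rule g(1))
  also have "\<dots> \<le> 4 * B \<delta> / x"
    using B\<delta> \<delta> \<delta>T assms by (intro divide_right_mono) (auto simp: max_def)
  finally show ?thesis .
qed

text \<open>The amplitude \<open>v * (B v - B \<delta>)\<close> that appears when the integrand of
  \<open>sin_sing\<close> is differentiated in the frequency, in a form continuous at 0.\<close>

definition reg :: "real \<Rightarrow> real" where
  "reg v = (if v \<le> 0 then 0 else (- ln v) powr (- \<alpha>) - B \<delta> * v)"

lemma reg_eq: "0 < v \<Longrightarrow> v \<le> \<delta> \<Longrightarrow> reg v = v * (B v - B \<delta>)"
  by (simp add: reg_def B_near powr_minus_divide right_diff_distrib)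

lemma reg_bounds: "0 \<le> v \<Longrightarrow> v \<le> \<delta> \<Longrightarrow> 0 \<le> reg v" "0 < v \<Longrightarrow> v \<le> \<delta> \<Longrightarrow> reg v \<le> (- ln v) powr (- \<alpha>)"
proof -
  assume "0 \<le> v" "v \<le> \<delta>"
  then show "0 \<le> reg v"
    using reg_eq[of v] B_antimono[of v \<delta>] by (cases "v = 0") (auto simp: reg_def)
next
  assume "0 < v" "v \<le> \<delta>"
  then show "reg v \<le> (- ln v) powr (- \<alpha>)" using B_nonneg[of \<delta>] \<delta> by (simp add: reg_def)
qed

lemma reg_continuous: "continuous_on {0..\<delta>} reg"
  unfolding continuous_on_def
proof
  fix t assume t: "t \<in> {0..\<delta>}"
  show "(reg \<longlongrightarrow> reg t) (at t within {0..\<delta>})"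
  proof (cases "t = 0")
    case True
    have "LIM t at_right (0::real). - ln t :> at_top"
      using ln_at_0 by (simp add: filterlim_uminus_at_top)
    then have "((\<lambda>v::real. (- ln v) powr (- \<alpha>) - B \<delta> * v) \<longlongrightarrow> 0 - B \<delta> * 0) (at_right 0)"
      using \<alpha> by (intro tendsto_diff tendsto_neg_powr tendsto_mult tendsto_const tendsto_ident_at) auto
    moreover have "eventually (\<lambda>v. (- ln v) powr (- \<alpha>) - B \<delta> * v = reg v) (at_right 0)"
      using eventually_at_right_less[of "0::real"] by eventually_elim (simp add: reg_def)
    ultimately have "(reg \<longlongrightarrow> 0 - B \<delta> * 0) (at_right 0)" by (rule Lim_transform_eventually)
    then show ?thesis using True \<delta> by (simp add: at_within_Icc_at_right reg_def)
  next
    case False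
    then have "0 < t" "t \<le> \<delta>" using t by auto
    then have t0: "0 < t" "- ln t > 0" using ln_gt_0[of t] by blast+
    have "((\<lambda>v. (- ln v) powr (- \<alpha>) - B \<delta> * v) \<longlongrightarrow> (- ln t) powr (- \<alpha>) - B \<delta> * t) (at t)"
      using t0 by (intro tendsto_intros) auto
    moreover have "eventually (\<lambda>v. (- ln v) powr (- \<alpha>) - B \<delta> * v = reg v) (at t)"
      using t0(1) by (intro eventually_at_topological[THEN iffD2] exI[of _ "{0<..}"]) (auto simp: reg_def)
    ultimately have "(reg \<longlongrightarrow> (- ln t) powr (- \<alpha>) - B \<delta> * t) (at t)"
      by (rule Lim_transform_eventually)
    then have "(reg \<longlongrightarrow> reg t) (at t)" using t0 by (simp add: reg_def)
    then show ?thesis by (rule tendsto_within_subset) simp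
  qed
qed

definition reg' :: "real \<Rightarrow> real" where
  "reg' v = \<alpha> * (- ln v) powr (- \<alpha> - 1) / v - B \<delta>"

lemma reg_deriv:
  assumes "0 < v" "v \<le> \<delta>"
  shows "(reg has_real_derivative reg' v) (at v)"
proof -
  have "((\<lambda>t. - ln t) has_real_derivative - (1 / v)) (at v)"
    using assms by (auto intro!: derivative_eq_intros)
  from DERIV_diff[OF DERIV_fun_powr[OF this ln_gt_0[OF assms], of "- \<alpha>"] DERIV_cmult[OF DERIV_ident, of "B \<delta>"]]
  have "((\<lambda>v. (- ln v) powr (- \<alpha>) - B \<delta> * v) has_real_derivative reg' v) (at v)"
    by (simp add: reg'_def)
  moreover have "eventually (\<lambda>v. (- ln v) powr (- \<alpha>) - B \<delta> * v = reg v) (nhds v)"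
    using assms(1) by (intro eventually_nhds[THEN iffD2] exI[of _ "{0<..}"]) (auto simp: reg_def)
  ultimately show ?thesis by (simp add: DERIV_cong_ev)
qed

text \<open>The variable part is \<alpha> divided by
  \<open>v * (- ln v) powr (\<alpha> + 1)\<close>, which increases with \<open>v\<close>.
  Monotonicity opens \<open>reg'\<close> to the second mean value theorem.\<close>

lemma reg'_antimono:
  assumes "0 < s" "s \<le> t" "t \<le> \<delta>"
  shows "reg' t \<le> reg' s"
proof -
  have eq: "(- ln v) powr (- \<alpha> - 1) / v = 1 / (v * (- ln v) powr (\<alpha> + 1))" if "0 < v" "v \<le> \<delta>" for v
  proof -
    have e: "- \<alpha> - 1 = - (\<alpha> + 1)" by simp
    show ?thesis unfolding e powr_minus_divide by simp
  qed
  have "0 < s * (- ln s) powr (\<alpha> + 1)" using assms ln_gt_0[of s] by (intro mult_pos_pos) auto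
  then have "1 / (t * (- ln t) powr (\<alpha> + 1)) \<le> 1 / (s * (- ln s) powr (\<alpha> + 1))"
    using mult_ln_powr_mono[OF assms] assms ln_gt_0[of t] by (intro divide_left_mono mult_pos_pos) auto
  then have "(- ln t) powr (- \<alpha> - 1) / t \<le> (- ln s) powr (- \<alpha> - 1) / s"
    using eq[of s] eq[of t] assms by simp
  then have "\<alpha> * ((- ln t) powr (- \<alpha> - 1) / t) \<le> \<alpha> * ((- ln s) powr (- \<alpha> - 1) / s)"
    using \<alpha> by (intro mult_left_mono) auto
  then show ?thesis unfolding reg'_def times_divide_eq_right by linarith
qed

text \<open>In the bound below, 2 comes from \<open>(0, 1 / z)\<close> and the boundary term at
  \<open>1 / z\<close>, \<open>2 * \<alpha>\<close> from the leading part of \<open>reg'\<close> at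
  \<open>1 / z\<close>, and the rest from the constants \<open>B \<delta>\<close> and
  \<open>reg' \<delta>\<close>.\<close>

definition reg_const :: real where
  "reg_const = 2 + 2 * \<alpha> + 2 * K0 * (B \<delta> + \<bar>reg' \<delta>\<bar>)"

lemma reg_const_nonneg: "0 \<le> reg_const"
  unfolding reg_const_def using \<alpha> K0_pos B_nonneg[OF \<delta>(1)] by (intro add_nonneg_nonneg mult_nonneg_nonneg) auto

text \<open>Split at \<open>a = 1 / z\<close>: below it \<open>reg\<close> is at most
  \<open>l\<close>; above it integration by parts gains a factor \<open>1 / z\<close> and leaves a
  sine integral of the monotone \<open>reg'\<close>. The boundary term at \<open>\<delta>\<close>
  vanishes because \<open>reg \<delta> = 0\<close>.\<close>

lemma reg_cos_integral:
  assumes z: "1 / \<delta> \<le> z"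
  shows "\<bar>integral {0..\<delta>} (\<lambda>v. reg v * cos (z * v))\<bar> \<le> reg_const * ln z powr (- \<alpha>) / z"
proof -
  define a where "a = 1 / z"
  have "0 < 1 / \<delta>" using \<delta> by simp
  then have z0: "0 < z" using z by linarith
  have a: "0 < a" "a \<le> \<delta>" "z * a = 1" "- ln a = ln z"
    using z z0 \<delta>(1) by (simp_all add: a_def ln_div field_simps)
  define l where "l = ln z powr (- \<alpha>)"
  have L: "1 < ln z" using ln_pos[OF a(1,2)] a(4) by simp
  have l0: "0 \<le> l" by (simp add: l_def)
  let ?g = "\<lambda>v. reg v * cos (z * v)"
  have gc: "continuous_on {0..\<delta>} ?g" by (intro continuous_intros reg_continuous)
  have reg_le: "\<bar>reg v\<bar> \<le> l" if "0 \<le> v" "v \<le> a" for v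
  proof (cases "v = 0")
    case False
    then have v: "0 < v" "v \<le> \<delta>" using that a by auto
    have "reg v \<le> (- ln v) powr (- \<alpha>)" by (rule reg_bounds(2)[OF v])
    also have "\<dots> \<le> l"
      unfolding l_def
    proof (rule powr_mono2')
      show "ln z \<le> - ln v" unfolding a(4)[symmetric] using that v a(1) by simp
    qed (use L \<alpha> in auto)
    finally show ?thesis using reg_bounds(1)[of v] v by simp
  qed (simp add: reg_def l0)
  have "norm (integral {0..a} ?g) \<le> l * (a - 0)"
  proof (rule integral_bound)
    show "continuous_on {0..a} ?g" by (rule continuous_on_subset[OF gc]) (use a in auto)
    show "norm (?g v) \<le> l" if "v \<in> {0..a}" for v
    proof -
      have "\<bar>reg v\<bar> * \<bar>cos (z * v)\<bar> \<le> l * 1" using that reg_le l0 by (intro mult_mono) auto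
      then show ?thesis by (simp add: abs_mult)
    qed
  qed (use a in simp)
  then have 1: "\<bar>integral {0..a} ?g\<bar> \<le> l / z" by (simp add: a_def)
  let ?h = "\<lambda>v. reg' v * sin (z * v)"
  have h: "\<bar>integral {a..\<delta>} ?h\<bar> \<le> 2 * (\<bar>reg' a\<bar> + \<bar>reg' \<delta>\<bar>) / z" "?h integrable_on {a..\<delta>}"
    using antimono_sin_integral[OF a(2) z0, of reg'] reg'_antimono a(1) by auto
  have "((\<lambda>v. reg' v * sin (z * v) / z + reg v * cos (z * v)) has_integral
      (reg \<delta> * sin (z * \<delta>) / z - reg a * sin (z * a) / z)) {a..\<delta>}"
  proof (rule fundamental_theorem_of_calculus[OF a(2)])
    fix v assume v: "v \<in> {a..\<delta>}"
    have r: "(reg has_real_derivative reg' v) (at v)" using v a(1) by (intro reg_deriv) auto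
    have "((\<lambda>v. reg v * sin (z * v) / z) has_real_derivative reg' v * sin (z * v) / z + reg v * cos (z * v)) (at v)"
      using z0 by (auto intro!: derivative_eq_intros r simp: field_simps)
    then show "((\<lambda>v. reg v * sin (z * v) / z) has_vector_derivative reg' v * sin (z * v) / z + reg v * cos (z * v)) (at v within {a..\<delta>})"
      by (simp add: has_real_derivative_iff_has_vector_derivative has_vector_derivative_at_within)
  qed
  moreover have "((\<lambda>v. reg' v * sin (z * v) / z) has_integral integral {a..\<delta>} ?h / z) {a..\<delta>}"
    using h(2) by (intro has_integral_divide integrable_integral)
  ultimately have "((\<lambda>v. reg' v * sin (z * v) / z + reg v * cos (z * v) - reg' v * sin (z * v) / z) has_integral
      (reg \<delta> * sin (z * \<delta>) / z - reg a * sin (z * a) / z) - integral {a..\<delta>} ?h / z) {a..\<delta>}"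
    by (rule has_integral_diff)
  moreover have "reg \<delta> = 0" using reg_eq[of \<delta>] \<delta> by simp
  ultimately have "integral {a..\<delta>} ?g = - (reg a * sin (z * a) / z) - integral {a..\<delta>} ?h / z"
    by (simp add: integral_unique)
  then have "\<bar>integral {a..\<delta>} ?g\<bar> \<le> \<bar>reg a * sin (z * a) / z\<bar> + \<bar>integral {a..\<delta>} ?h / z\<bar>" by linarith
  also have "\<bar>reg a * sin (z * a) / z\<bar> \<le> l / z"
  proof -
    have "\<bar>reg a\<bar> * \<bar>sin (z * a)\<bar> \<le> l * 1" using reg_le[of a] a l0 by (intro mult_mono) auto
    then show ?thesis using z0 by (simp add: abs_mult divide_right_mono)
  qed
  also have "\<bar>integral {a..\<delta>} ?h / z\<bar> \<le> (2 * \<alpha> * l + 2 * K0 * (B \<delta> + \<bar>reg' \<delta>\<bar>) * l) / z"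
  proof -
    have "\<bar>reg' a\<bar> \<le> \<alpha> * l * z + B \<delta>"
    proof -
      have "ln z powr (- \<alpha> - 1) \<le> l" unfolding l_def using L by (intro powr_mono) auto
      then have "\<alpha> * ln z powr (- \<alpha> - 1) * z \<le> \<alpha> * l * z" using \<alpha> z0 by (intro mult_right_mono mult_left_mono) auto
      moreover have "reg' a = \<alpha> * ln z powr (- \<alpha> - 1) * z - B \<delta>"
        unfolding reg'_def a(4) by (simp add: a_def)
      moreover have "0 \<le> \<alpha> * ln z powr (- \<alpha> - 1) * z" using \<alpha> z0 by simp
      ultimately show ?thesis using B_nonneg[OF \<delta>(1)] by linarith
    qed
    \<comment> \<open>The maximum property of \<open>K0\<close> at \<open>a\<close> bounds
      \<open>l * z\<close> from below, so that fixed constants can be absorbed into multiples of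
      it.\<close>
    moreover have zl: "1 \<le> K0 * l * z"
    proof -
      have "a * (ln z) powr (\<alpha> + 1) \<le> K0" using mult_ln_powr_le[OF a(1,2)] by (simp add: a(4))
      moreover have "ln z powr \<alpha> \<le> ln z powr (\<alpha> + 1)" using L by (intro powr_mono) auto
      ultimately have "a * ln z powr \<alpha> \<le> K0" using a(1) by (meson mult_left_mono less_imp_le order_trans)
      moreover have "0 < ln z powr \<alpha>" using L by simp
      ultimately show ?thesis using z0 by (simp add: a_def l_def powr_minus_divide field_simps)
    qed
    have "B \<delta> + \<bar>reg' \<delta>\<bar> \<le> (B \<delta> + \<bar>reg' \<delta>\<bar>) * (K0 * l * z)"
      using mult_left_mono[OF zl, of "B \<delta> + \<bar>reg' \<delta>\<bar>"] B_nonneg[OF \<delta>(1)] by simp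
    ultimately have "2 * (\<bar>reg' a\<bar> + \<bar>reg' \<delta>\<bar>) \<le> (2 * \<alpha> * l + 2 * K0 * (B \<delta> + \<bar>reg' \<delta>\<bar>) * l) * z"
      by (simp add: algebra_simps)
    then have "2 * (\<bar>reg' a\<bar> + \<bar>reg' \<delta>\<bar>) / z \<le> 2 * \<alpha> * l + 2 * K0 * (B \<delta> + \<bar>reg' \<delta>\<bar>) * l"
      using z0 by (simp add: divide_le_eq)
    then have "\<bar>integral {a..\<delta>} ?h\<bar> \<le> 2 * \<alpha> * l + 2 * K0 * (B \<delta> + \<bar>reg' \<delta>\<bar>) * l" using h(1) by linarith
    then show ?thesis using z0 by (simp add: divide_right_mono)
  qed
  finally have 2: "\<bar>integral {a..\<delta>} ?g\<bar> \<le> l / z + (2 * \<alpha> * l + 2 * K0 * (B \<delta> + \<bar>reg' \<delta>\<bar>) * l) / z" by simp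
  have "integral {0..\<delta>} ?g = integral {0..a} ?g + integral {a..\<delta>} ?g"
    using a gc by (intro Henstock_Kurzweil_Integration.integral_combine[symmetric] integrable_continuous_real) auto
  then have "\<bar>integral {0..\<delta>} ?g\<bar> \<le> l / z + (l / z + (2 * \<alpha> * l + 2 * K0 * (B \<delta> + \<bar>reg' \<delta>\<bar>) * l) / z)"
    using 1 2 by linarith
  also have "\<dots> = reg_const * l / z" by (simp add: reg_const_def add_divide_distrib[symmetric] algebra_simps)
  finally show ?thesis by (simp add: l_def)
qed

text \<open>The difference is the integral over \<open>[y, x]\<close> of the derivative in the
  frequency, after an exchange of the two integrations; the bound on the inner integral is largest
  at \<open>y\<close>.\<close>

lemma sin_sing_diff:
  assumes y: "1 / \<delta> \<le> y" and xy: "y \<le> x"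
  shows "\<bar>sin_sing x - sin_sing y\<bar> \<le> (x - y) * (reg_const * ln y powr (- \<alpha>) / y)"
proof -
  have "0 < 1 / \<delta>" using \<delta> by simp
  then have y0: "0 < y" using y by linarith
  have int: "(\<lambda>v. (B v - B \<delta>) * sin (w * v)) integrable_on {0..\<delta>}" for w
    unfolding left_diff_distrib
    by (intro Henstock_Kurzweil_Integration.integrable_diff B_sin_integrable_on integrable_continuous_real continuous_intros) simp
  have inner: "(B v - B \<delta>) * sin (x * v) - (B v - B \<delta>) * sin (y * v) = integral (cbox y x) (\<lambda>z. reg v * cos (z * v))"
    if v: "v \<in> {0..\<delta>}" for v
  proof (cases "v = 0")
    case False
    then have v0: "0 < v" "v \<le> \<delta>" using v by auto
    have "((\<lambda>z. reg v * cos (z * v)) has_integral (reg v * (sin (x * v) / v) - reg v * (sin (y * v) / v))) {y..x}"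
      using xy v0
      by (intro fundamental_theorem_of_calculus)
        (auto intro!: derivative_eq_intros simp: has_real_derivative_iff_has_vector_derivative[symmetric])
    then have "integral {y..x} (\<lambda>z. reg v * cos (z * v)) = reg v * (sin (x * v) / v) - reg v * (sin (y * v) / v)"
      by (rule integral_unique)
    then show ?thesis using v0 by (simp add: reg_eq)
  qed (simp add: reg_def)
  have cont: "continuous_on (cbox (0, y) (\<delta>, x)) (\<lambda>(v, z). reg v * cos (z * v))"
    unfolding case_prod_unfold cbox_Pair_eq
    by (intro continuous_intros continuous_on_compose2[OF reg_continuous]) auto
  have cont': "continuous_on {y..x} (\<lambda>z. integral (cbox 0 \<delta>) (\<lambda>v. reg v * cos (z * v)))"
  proof (rule integral_continuous_on_param)
    have "continuous_on ({y..x} \<times> cbox 0 \<delta>) (\<lambda>p. reg (snd p) * cos (fst p * snd p))"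
      by (intro continuous_intros continuous_on_compose2[OF reg_continuous]) auto
    then show "continuous_on ({y..x} \<times> cbox 0 \<delta>) (\<lambda>(z, v). reg v * cos (z * v))"
      by (simp add: case_prod_unfold)
  qed
  have "sin_sing x - sin_sing y = integral {0..\<delta>} (\<lambda>v. (B v - B \<delta>) * sin (x * v) - (B v - B \<delta>) * sin (y * v))"
    unfolding sin_sing_def by (rule Henstock_Kurzweil_Integration.integral_diff[OF int int, symmetric])
  also have "\<dots> = integral {0..\<delta>} (\<lambda>v. integral (cbox y x) (\<lambda>z. reg v * cos (z * v)))"
    by (rule Henstock_Kurzweil_Integration.integral_cong) (rule inner)
  also have "\<dots> = integral {y..x} (\<lambda>z. integral (cbox 0 \<delta>) (\<lambda>v. reg v * cos (z * v)))"
    using integral_swap_continuous[OF cont] by simp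
  also have "norm \<dots> \<le> (reg_const * ln y powr (- \<alpha>) / y) * (x - y)"
  proof (rule integral_bound[OF xy cont'])
    fix z assume z: "z \<in> {y..x}"
    have "exp 0 < 1 / \<delta>"
    proof -
      have "\<delta> < 1" using ln_gt_0[of \<delta>] \<delta>(1) by simp
      then show ?thesis using \<delta>(1) by simp
    qed
    then have lny: "0 < ln y" using y y0 by simp
    have "norm (integral (cbox 0 \<delta>) (\<lambda>v. reg v * cos (z * v))) \<le> reg_const * ln z powr (- \<alpha>) / z"
      using reg_cos_integral[of z] y z by simp
    also have "\<dots> \<le> reg_const * ln y powr (- \<alpha>) / y"
      using reg_const_nonneg z y0 \<alpha> lny by (intro frac_le mult_left_mono powr_mono2' mult_nonneg_nonneg) auto
    finally show "norm (integral (cbox 0 \<delta>) (\<lambda>v. reg v * cos (z * v))) \<le> reg_const * ln y powr (- \<alpha>) / y" .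
  qed
  finally show ?thesis by (simp add: mult.commute)
qed

definition sin_seq :: "nat \<Rightarrow> real" where
  "sin_seq k = sin_int (2 * pi * real k / T)"

text \<open>For large \<open>k\<close> and \<open>j <= 2 * k\<close> the increment of the singular
  part is used, \<open>j\<close> and \<open>k\<close> being comparable; replacing
  \<open>sin_int\<close> by \<open>sin_sing\<close> costs order \<open>1 / k\<close> and produces
  the second term. Otherwise \<open>j - k\<close> is comparable to \<open>j\<close>, and the bound
  on the values suffices.\<close>

lemma sin_seq_bounds:
  obtains C where "0 \<le> C" "\<And>k. \<bar>sin_seq k\<bar> \<le> C * ln (real k + 2) powr (- \<alpha>)"
    "\<And>j k. k < j \<Longrightarrow> \<bar>sin_seq j - sin_seq k\<bar> / (real j - real k)
      \<le> C * ln (real k + 2) powr (- \<alpha>) / real j + C / ((real k + 1) * (real j - real k))"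
proof -
  define c where "c = 2 * pi / T"
  have c: "0 < c" using T by (simp add: c_def)
  define x where "x k = c * real k" for k :: nat
  have sx: "sin_seq k = sin_int (x k)" for k by (simp add: sin_seq_def x_def c_def)
  define L where "L k = ln (real k + 2)" for k :: nat
  have L0: "0 < L k" for k by (simp add: L_def)
  have Lmono: "L j powr (- \<alpha>) \<le> L k powr (- \<alpha>)" if "k \<le> j" for j k
    using that \<alpha> L0[of k] by (intro powr_mono2') (auto simp: L_def)
  \<comment> \<open>\<open>1 / (\<delta> * c)\<close> brings \<open>x k\<close> above
    \<open>1 / \<delta>\<close>; \<open>3 / c\<^sup>2\<close> gives
    \<open>k + 2 <= 3 * k <= (x k)^2\<close>, so \<open>ln (x k)\<close> is at least half of
    \<open>L k\<close>.\<close>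
  obtain k0 :: nat where k0: "1 + 1 / (\<delta> * c) + 3 / c\<^sup>2 \<le> real k0" using real_arch_simple by blast
  have "0 \<le> 1 / (\<delta> * c)" "0 \<le> 3 / c\<^sup>2" using \<delta>(1) c by auto
  then have k0': "1 \<le> real k0" "1 / (\<delta> * c) \<le> real k0" "3 / c\<^sup>2 \<le> real k0" using k0 by linarith+
  have big: "1 / \<delta> \<le> x k" "L k / 2 \<le> ln (x k)" if k: "k0 \<le> k" for k
  proof -
    have kk: "1 \<le> real k" "1 / (\<delta> * c) \<le> real k" "3 / c\<^sup>2 \<le> real k" using k0' k by linarith+
    show "1 / \<delta> \<le> x k" using kk(2) \<delta>(1) c by (simp add: x_def field_simps)
    have xp: "0 < x k" using c kk by (simp add: x_def)
    have "real k + 2 \<le> 3 * real k" using kk by simp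
    also have "\<dots> \<le> (c\<^sup>2 * real k) * real k" using kk(3) kk(1) c by (intro mult_right_mono) (auto simp: field_simps)
    also have "\<dots> = (x k)\<^sup>2" by (simp add: x_def power2_eq_square)
    finally have "L k \<le> ln ((x k)\<^sup>2)" unfolding L_def by (intro ln_mono) auto
    also have "\<dots> = 2 * ln (x k)" using xp by (simp add: ln_realpow)
    finally show "L k / 2 \<le> ln (x k)" by simp
  qed
  have lnx: "ln (x k) powr (- \<alpha>) \<le> 2 powr \<alpha> * L k powr (- \<alpha>)" if k: "k0 \<le> k" for k
  proof -
    have "ln (x k) powr (- \<alpha>) \<le> (L k / 2) powr (- \<alpha>)"
      using big(2)[OF k] L0[of k] \<alpha> by (intro powr_mono2') auto
    also have "\<dots> = 2 powr \<alpha> * L k powr (- \<alpha>)" using L0[of k] by (simp add: powr_divide powr_minus_divide)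
    finally show ?thesis .
  qed
  define I where "I = integral {0..T} B"
  have I0: "0 \<le> I" unfolding I_def using sin_int_bounded[of 0] by linarith
  define C1 where "C1 = 5 * 2 powr \<alpha> + I * L k0 powr \<alpha>"
  have C1: "0 \<le> C1" unfolding C1_def using I0 by simp
  have s1: "\<bar>sin_seq k\<bar> \<le> C1 * L k powr (- \<alpha>)" for k
  proof (cases "k0 \<le> k")
    case True
    have "\<bar>sin_seq k\<bar> \<le> 5 * ln (x k) powr (- \<alpha>)" unfolding sx by (rule sin_int_le[OF big(1)[OF True]])
    also have "\<dots> \<le> 5 * 2 powr \<alpha> * L k powr (- \<alpha>)" using lnx[OF True] by simp
    also have "\<dots> \<le> C1 * L k powr (- \<alpha>)" unfolding C1_def using I0 by (intro mult_right_mono) auto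
    finally show ?thesis .
  next
    case False
    have "\<bar>sin_seq k\<bar> \<le> I" unfolding sx I_def by (rule sin_int_bounded)
    also have "\<dots> = I * (L k0 powr \<alpha> * L k0 powr (- \<alpha>))" using L0[of k0] by (simp add: powr_minus_divide)
    also have "\<dots> \<le> I * (L k0 powr \<alpha> * L k powr (- \<alpha>))"
      using Lmono[of k k0] False I0 by (intro mult_left_mono) auto
    also have "\<dots> \<le> C1 * L k powr (- \<alpha>)" unfolding C1_def by (simp add: algebra_simps)
    finally show ?thesis .
  qed
  define C where "C = C1 + 2 * reg_const * 2 powr \<alpha> + 16 * B \<delta> / c + 4 * real k0 * C1"
  have parts: "0 \<le> 2 * reg_const * 2 powr \<alpha>" "0 \<le> 16 * B \<delta> / c" "0 \<le> 4 * real k0 * C1"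
    using reg_const_nonneg B_nonneg[OF \<delta>(1)] c C1 by simp_all
  have C: "0 \<le> C" "C1 \<le> C" "2 * reg_const * 2 powr \<alpha> \<le> C" "16 * B \<delta> / c \<le> C" "4 * real k0 * C1 \<le> C"
    unfolding C_def using parts C1 by linarith+
  have diff: "\<bar>sin_seq j - sin_seq k\<bar> / (real j - real k) \<le> C * L k powr (- \<alpha>) / real j + C / ((real k + 1) * (real j - real k))"
    if kj: "k < j" for j k
  proof -
    have d: "0 < real j - real k" "1 \<le> real j - real k" using kj by linarith+
    have j0: "0 < real j" using kj by simp
    show ?thesis
    proof (cases "k0 \<le> k \<and> j \<le> 2 * k")
      case True
      then have k: "k0 \<le> k" "real j \<le> 2 * real k" by linarith+
      have kp: "1 \<le> real k" using k(1) k0'(1) by linarith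
      have xk: "0 < x k" "0 < x j" "x k \<le> x j" "x j - x k = c * (real j - real k)"
        using c kp j0 kj by (simp_all add: x_def right_diff_distrib)
      have "\<bar>sin_sing (x j) - sin_sing (x k)\<bar> \<le> (x j - x k) * (reg_const * ln (x k) powr (- \<alpha>) / x k)"
        by (rule sin_sing_diff[OF big(1)[OF k(1)] xk(3)])
      also have "\<dots> = (real j - real k) * (reg_const * ln (x k) powr (- \<alpha>) / real k)"
        unfolding xk(4) using c kp by (simp add: x_def)
      also have "\<dots> \<le> (real j - real k) * (reg_const * (2 powr \<alpha> * L k powr (- \<alpha>)) / (real j / 2))"
        using d j0 k(2) reg_const_nonneg lnx[OF k(1)]
        by (intro mult_left_mono frac_le mult_nonneg_nonneg) auto
      also have "\<dots> = (real j - real k) * ((2 * reg_const * 2 powr \<alpha>) * L k powr (- \<alpha>) / real j)" by simp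
      also have "\<dots> \<le> (real j - real k) * (C * L k powr (- \<alpha>) / real j)"
        using d j0 C(3) by (intro mult_left_mono divide_right_mono mult_right_mono) auto
      finally have 1: "\<bar>sin_sing (x j) - sin_sing (x k)\<bar> \<le> (real j - real k) * (C * L k powr (- \<alpha>) / real j)" .
      have rem: "4 * B \<delta> / x i \<le> 8 * B \<delta> / c / (real k + 1)" if "k \<le> i" for i
      proof -
        have "4 * B \<delta> / x i \<le> 4 * B \<delta> / (c * ((real k + 1) / 2))"
          using that kp c B_nonneg[OF \<delta>(1)] by (intro divide_left_mono mult_pos_pos) (auto simp: x_def)
        then show ?thesis by simp
      qed
      have "\<bar>(sin_seq j - sin_sing (x j)) - (sin_seq k - sin_sing (x k))\<bar> \<le> 16 * B \<delta> / c / (real k + 1)"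
        using sin_int_minus_sing[OF xk(1)] sin_int_minus_sing[OF xk(2)] rem[of k] rem[of j] kj unfolding sx by linarith
      also have "\<dots> \<le> C / (real k + 1)" using C(4) by (intro divide_right_mono) auto
      finally have 2: "\<bar>(sin_seq j - sin_sing (x j)) - (sin_seq k - sin_sing (x k))\<bar> \<le> C / (real k + 1)" .
      have "\<bar>sin_seq j - sin_seq k\<bar> \<le> (real j - real k) * (C * L k powr (- \<alpha>) / real j) + C / (real k + 1)"
        using 1 2 by linarith
      then have "\<bar>sin_seq j - sin_seq k\<bar> / (real j - real k) \<le> ((real j - real k) * (C * L k powr (- \<alpha>) / real j) + C / (real k + 1)) / (real j - real k)"
        using d by (intro divide_right_mono) auto
      also have "\<dots> = C * L k powr (- \<alpha>) / real j + C / ((real k + 1) * (real j - real k))"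
        using d by (simp add: add_divide_distrib)
      finally show ?thesis .
    next
      case False
      \<comment> \<open>Either \<open>j <= 2 * k\<close> with \<open>k < k0\<close>, and then
        \<open>j - k >= 1\<close> while \<open>j\<close> is bounded, or \<open>j > 2 * k\<close>,
        and then \<open>j - k\<close> exceeds \<open>j / 2\<close>.\<close>
      have far: "real j / (2 * real k0) \<le> real j - real k"
      proof (cases "j \<le> 2 * k")
        case True
        then have "k < k0" using False by simp
        then have "real j \<le> 2 * real k0" using True by simp
        then have "real j / (2 * real k0) \<le> 1" using k0'(1) by simp
        then show ?thesis using d by linarith
      next
        case False
        have "real j / (2 * real k0) \<le> real j / 2" using k0'(1) j0 by (intro divide_left_mono) auto
        then show ?thesis using False by linarith
      qed
      have jk: "0 < real j / (2 * real k0)" using j0 k0'(1) by simp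
      have "\<bar>sin_seq j - sin_seq k\<bar> \<le> C1 * L j powr (- \<alpha>) + C1 * L k powr (- \<alpha>)"
        using s1[of j] s1[of k] by linarith
      also have "\<dots> \<le> 2 * C1 * L k powr (- \<alpha>)"
        using mult_left_mono[OF Lmono[of k j] C1] kj by simp
      finally have "\<bar>sin_seq j - sin_seq k\<bar> / (real j - real k) \<le> 2 * C1 * L k powr (- \<alpha>) / (real j / (2 * real k0))"
        using far jk C1 by (intro frac_le) auto
      also have "\<dots> = (4 * real k0 * C1) * L k powr (- \<alpha>) / real j" by simp
      also have "\<dots> \<le> C * L k powr (- \<alpha>) / real j"
        using C(5) j0 by (intro divide_right_mono mult_right_mono) auto
      also have "\<dots> \<le> C * L k powr (- \<alpha>) / real j + C / ((real k + 1) * (real j - real k))"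
        using C(1) d by simp
      finally show ?thesis .
    qed
  qed
  have "\<bar>sin_seq k\<bar> \<le> C * L k powr (- \<alpha>)" for k
    using s1[of k] mult_right_mono[OF C(2), of "L k powr (- \<alpha>)"] by simp
  then show ?thesis using that[OF C(1)] diff unfolding L_def by blast
qed

end

section \<open>Double series with logarithmic weights\<close>

text \<open>The natural logarithm, shifted so as to be positive at every index; not the logarithm to
  base 2.\<close>

definition log2 :: "nat \<Rightarrow> real" where
  "log2 k = ln (real k + 2)"

lemma log2_pos: "0 < log2 k"
  by (simp add: log2_def)

lemma log2_mono: "j \<le> k \<Longrightarrow> log2 j \<le> log2 k"
  by (simp add: log2_def)

lemma log2_powr_le:
  assumes "0 < a"
  shows "log2 k powr a \<le> (2 * a) powr a * sqrt (real k + 2)"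
proof -
  have "ln (sqrt (real k + 2)) powr a \<le> a powr a * sqrt (real k + 2)"
    using assms by (intro ln_powr_bound2) (auto simp: real_less_rsqrt)
  moreover have "log2 k = 2 * ln (sqrt (real k + 2))" by (simp add: log2_def ln_sqrt)
  moreover have "0 \<le> ln (sqrt (real k + 2))" by simp
  ultimately show ?thesis using assms by (simp add: powr_mult mult.assoc mult_left_mono)
qed

text \<open>At most \<open>2 * sqrt (j + 2)\<close> indices satisfy
  \<open>k + 2 < sqrt (j + 2)\<close>, each with a term of at most \<open>ln 2 powr (- a)\<close>;
  for the others \<open>log2 k >= log2 j / 2\<close>. The root is dominated by a multiple of
  \<open>j * log2 j powr (- a)\<close>.\<close>

lemma sum_inverse_log2_powr:
  assumes a: "0 < a"
  obtains C where "0 \<le> C" "\<And>j. 1 \<le> j \<Longrightarrow> (\<Sum>k\<le>j. log2 k powr (- a)) \<le> C * real j * log2 j powr (- a)"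
proof -
  define C where "C = 2 * 2 powr a + 6 * ln 2 powr (- a) * (2 * a) powr a"
  have C: "0 \<le> C" by (simp add: C_def)
  have "(\<Sum>k\<le>j. log2 k powr (- a)) \<le> C * real j * log2 j powr (- a)" if j: "1 \<le> j" for j
  proof -
    let ?S = "{k. (real k + 2)\<^sup>2 < real j + 2}"
    have Ssub: "?S \<subseteq> {..<nat \<lceil>sqrt (real j + 2)\<rceil>}"
    proof
      fix k assume "k \<in> ?S"
      then have "real k + 2 < sqrt (real j + 2)" by (intro real_less_rsqrt) simp
      then show "k \<in> {..<nat \<lceil>sqrt (real j + 2)\<rceil>}" by (simp add: less_ceiling_iff zless_nat_eq_int_zless)
    qed
    then have fin: "finite ?S" by (rule finite_subset) simp
    have "real (card ?S) \<le> real (nat \<lceil>sqrt (real j + 2)\<rceil>)"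
      using card_mono[OF _ Ssub] by (simp only: card_lessThan of_nat_le_iff finite_lessThan)
    also have "\<dots> \<le> sqrt (real j + 2) + 1" by (simp add: of_nat_nat ceiling_correct) 
    also have "\<dots> \<le> 2 * sqrt (real j + 2)" by (simp add: real_le_rsqrt)
    finally have card: "real (card ?S) \<le> 2 * sqrt (real j + 2)" .
    have "(\<Sum>k\<le>j. log2 k powr (- a)) \<le> (\<Sum>k\<le>j. 2 powr a * log2 j powr (- a) + (if k \<in> ?S then ln 2 powr (- a) else 0))"
    proof (rule sum_mono)
      fix k
      show "log2 k powr (- a) \<le> 2 powr a * log2 j powr (- a) + (if k \<in> ?S then ln 2 powr (- a) else 0)"
      proof (cases "k \<in> ?S")
        case True
        have "log2 k powr (- a) \<le> ln 2 powr (- a)" using a by (intro powr_mono2') (auto simp: log2_def)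
        moreover have "0 \<le> 2 powr a * log2 j powr (- a)" by simp
        ultimately show ?thesis unfolding if_P[OF True] by linarith
      next
        case False
        then have "log2 j \<le> ln ((real k + 2)\<^sup>2)" unfolding log2_def by (intro ln_mono) auto
        also have "\<dots> = 2 * log2 k" by (simp add: log2_def ln_realpow)
        finally have "log2 k powr (- a) \<le> (log2 j / 2) powr (- a)"
          using a log2_pos[of j] by (intro powr_mono2') auto
        also have "\<dots> = 2 powr a * log2 j powr (- a)" using log2_pos[of j] by (simp add: powr_divide powr_minus_divide)
        finally show ?thesis using False by simp
      qed
    qed
    also have "\<dots> = (real j + 1) * (2 powr a * log2 j powr (- a)) + (\<Sum>k\<le>j. (if k \<in> ?S then ln 2 powr (- a) else 0))"
      by (simp add: sum.distrib)
    also have "(\<Sum>k\<le>j. (if k \<in> ?S then ln 2 powr (- a) else 0)) \<le> real (card ?S) * ln 2 powr (- a)"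
    proof -
      have "(\<Sum>k\<le>j. (if k \<in> ?S then ln 2 powr (- a) else 0)) = (\<Sum>k\<in>{..j} \<inter> ?S. ln 2 powr (- a))"
        by (rule sum.inter_restrict[symmetric]) simp
      also have "\<dots> \<le> (\<Sum>k\<in>?S. ln 2 powr (- a))" by (intro sum_mono2 fin) auto
      finally show ?thesis by simp
    qed
    also have "real (card ?S) * ln 2 powr (- a) \<le> (6 * ln 2 powr (- a) * (2 * a) powr a) * real j * log2 j powr (- a)"
    proof -
      let ?r = "sqrt (real j + 2)"
      have r: "0 < ?r" "?r * ?r = real j + 2" by auto
      have "?r * log2 j powr a \<le> ?r * ((2 * a) powr a * ?r)"
        using log2_powr_le[OF a, of j] r by (intro mult_left_mono) auto
      also have "\<dots> = (2 * a) powr a * (real j + 2)" using r(2) by (metis mult.left_commute)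
      also have "\<dots> \<le> (2 * a) powr a * (3 * real j)" using j by (intro mult_left_mono) auto
      finally have "?r \<le> (2 * a) powr a * (3 * real j) * log2 j powr (- a)"
        using log2_pos[of j] by (simp add: powr_minus_divide field_simps)
      then have "2 * ?r * ln 2 powr (- a) \<le> 2 * ((2 * a) powr a * (3 * real j) * log2 j powr (- a)) * ln 2 powr (- a)"
        by (intro mult_right_mono mult_left_mono) auto
      moreover have "real (card ?S) * ln 2 powr (- a) \<le> 2 * ?r * ln 2 powr (- a)"
        using card by (intro mult_right_mono) auto
      ultimately show ?thesis by (simp add: mult_ac)
    qed
    also have "(real j + 1) * (2 powr a * log2 j powr (- a)) \<le> (2 * real j) * (2 powr a * log2 j powr (- a))"
      using j by (intro mult_right_mono) auto
    finally show ?thesis by (simp add: C_def algebra_simps)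
  qed
  then show ?thesis using that C by blast
qed

text \<open>Three times \<open>1 / log2 (j - 1) - 1 / log2 j\<close> dominates the term and
  telescopes; the factor comes from \<open>j + 2 <= 3 * j\<close>.\<close>

lemma sum_inverse_log2_square: "(\<Sum>j=1..<n. 1 / (real j * (log2 j)\<^sup>2)) \<le> 3 / log2 0"
proof -
  have step: "1 / (real j * (log2 j)\<^sup>2) \<le> 3 * (1 / log2 (j - 1) - 1 / log2 j)" if j: "1 \<le> j" for j
  proof -
    let ?a = "log2 (j - 1)" and ?b = "log2 j"
    have ab: "0 < ?a" "0 < ?b" "?a \<le> ?b" using log2_pos log2_mono[of "j - 1" j] by auto
    have "?b - ?a = - ln ((real j + 1) / (real j + 2))"
      using j by (simp add: log2_def ln_div of_nat_diff)
    moreover have "ln ((real j + 1) / (real j + 2)) \<le> (real j + 1) / (real j + 2) - 1"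
      by (rule ln_le_minus_one) simp
    moreover have "(real j + 1) / (real j + 2) - 1 = - (1 / (real j + 2))" by (simp add: field_simps)
    ultimately have d: "1 / (real j + 2) \<le> ?b - ?a" by linarith
    have "1 / (real j * ?b\<^sup>2) = 3 * ((1 / (3 * real j)) / (?b * ?b))" by (simp add: power2_eq_square)
    also have "\<dots> \<le> 3 * ((?b - ?a) / (?a * ?b))"
    proof (intro mult_left_mono frac_le)
      have "1 / (3 * real j) \<le> 1 / (real j + 2)" using j by (intro divide_left_mono) auto
      then show "1 / (3 * real j) \<le> ?b - ?a" using d by linarith
    qed (use ab in auto)
    also have "(?b - ?a) / (?a * ?b) = 1 / ?a - 1 / ?b" using ab by (simp add: field_simps)
    finally show ?thesis .
  qed
  have "(\<Sum>j=1..<n. 1 / (real j * (log2 j)\<^sup>2)) \<le> (\<Sum>j=1..<n. 3 * (1 / log2 (j - 1) - 1 / log2 j))"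
    by (intro sum_mono step) auto
  also have "\<dots> = 3 * (\<Sum>j=1..<n. 1 / log2 (j - 1) - 1 / log2 j)" by (simp add: sum_distrib_left)
  also have "(\<Sum>j=1..<n. 1 / log2 (j - 1) - 1 / log2 j) \<le> 1 / log2 0"
  proof (cases n)
    case (Suc m)
    have "(\<Sum>j=1..<Suc m. 1 / log2 (j - 1) - 1 / log2 j) = 1 / log2 0 - 1 / log2 m"
      by (induction m) auto
    then show ?thesis using Suc log2_pos[of m] by simp
  qed (use log2_pos[of 0] in simp)
  finally show ?thesis by simp
qed

text \<open>The powers of \<open>log2 k\<close> combine to the exponent
  \<open>- (\<alpha> + 1)\<close>, with a sum of order
  \<open>j * log2 j powr (- (\<alpha> + 1))\<close>. Against the outer factor
  \<open>log2 j powr (\<alpha> - 1) / j^2\<close> the exponent \<alpha> cancels, and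
  \<open>1 / (j * (log2 j)\<^sup>2)\<close> remains.\<close>

lemma double_sum_slow:
  fixes \<alpha> :: real
  assumes \<alpha>: "1 < \<alpha>"
  obtains M where "\<And>n. (\<Sum>j=1..<n. \<Sum>k\<le>j. (log2 k powr (- \<alpha>) / real j)\<^sup>2 * (log2 j powr (\<alpha> - 1) * log2 k powr (\<alpha> - 1))) \<le> M"
proof -
  obtain C where C: "0 \<le> C" "\<And>j. 1 \<le> j \<Longrightarrow> (\<Sum>k\<le>j. log2 k powr (- (\<alpha> + 1))) \<le> C * real j * log2 j powr (- (\<alpha> + 1))"
    using sum_inverse_log2_powr[of "\<alpha> + 1"] \<alpha> by auto
  have "(\<Sum>j=1..<n. \<Sum>k\<le>j. (log2 k powr (- \<alpha>) / real j)\<^sup>2 * (log2 j powr (\<alpha> - 1) * log2 k powr (\<alpha> - 1))) \<le> C * (3 / log2 0)" for n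
  proof -
    have "(\<Sum>k\<le>j. (log2 k powr (- \<alpha>) / real j)\<^sup>2 * (log2 j powr (\<alpha> - 1) * log2 k powr (\<alpha> - 1))) \<le> C * (1 / (real j * (log2 j)\<^sup>2))"
      if j: "j \<in> {1..<n}" for j
    proof -
      have j1: "1 \<le> j" using j by simp
      have e: "(log2 k powr (- \<alpha>) / real j)\<^sup>2 * (log2 j powr (\<alpha> - 1) * log2 k powr (\<alpha> - 1))
          = log2 j powr (\<alpha> - 1) / (real j)\<^sup>2 * log2 k powr (- (\<alpha> + 1))" for k
      proof -
        have "(log2 k powr (- \<alpha>))\<^sup>2 * log2 k powr (\<alpha> - 1) = log2 k powr (- \<alpha> + - \<alpha> + (\<alpha> - 1))"
          unfolding power2_eq_square powr_add by simp
        also have "- \<alpha> + - \<alpha> + (\<alpha> - 1) = - (\<alpha> + 1)" by simp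
        finally show ?thesis by (simp add: power_divide mult_ac)
      qed
      have "(\<Sum>k\<le>j. (log2 k powr (- \<alpha>) / real j)\<^sup>2 * (log2 j powr (\<alpha> - 1) * log2 k powr (\<alpha> - 1)))
          = log2 j powr (\<alpha> - 1) / (real j)\<^sup>2 * (\<Sum>k\<le>j. log2 k powr (- (\<alpha> + 1)))"
        unfolding e by (simp only: sum_distrib_left)
      also have "\<dots> \<le> log2 j powr (\<alpha> - 1) / (real j)\<^sup>2 * (C * real j * log2 j powr (- (\<alpha> + 1)))"
        by (intro mult_left_mono C(2) j1) auto
      also have "\<dots> = C * (real j / (real j)\<^sup>2 * (log2 j powr (\<alpha> - 1) * log2 j powr (- (\<alpha> + 1))))" by simp
      also have "log2 j powr (\<alpha> - 1) * log2 j powr (- (\<alpha> + 1)) = log2 j powr (- 2)" by (simp add: powr_add[symmetric])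
      also have "\<dots> = 1 / (log2 j)\<^sup>2" using log2_pos[of j] by (simp add: powr_minus_divide)
      also have "real j / (real j)\<^sup>2 * (1 / (log2 j)\<^sup>2) = 1 / (real j * (log2 j)\<^sup>2)" using j1 by (simp add: power2_eq_square)
      finally show ?thesis .
    qed
    then have "(\<Sum>j=1..<n. \<Sum>k\<le>j. (log2 k powr (- \<alpha>) / real j)\<^sup>2 * (log2 j powr (\<alpha> - 1) * log2 k powr (\<alpha> - 1)))
       \<le> (\<Sum>j=1..<n. C * (1 / (real j * (log2 j)\<^sup>2)))" by (rule sum_mono)
    also have "\<dots> = C * (\<Sum>j=1..<n. 1 / (real j * (log2 j)\<^sup>2))" by (simp only: sum_distrib_left)
    also have "\<dots> \<le> C * (3 / log2 0)" by (intro mult_left_mono sum_inverse_log2_square C(1))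
    finally show ?thesis .
  qed
  then show ?thesis by (rule that)
qed

text \<open>The decay is polynomial in \<open>k\<close> and in \<open>d = j - k - 1\<close>
  separately, so the logarithms may be estimated crudely by \<open>sqrt (j + 2)\<close>. This costs
  half a power in each variable and leaves a product of two convergent series.\<close>

lemma double_sum_fast:
  fixes \<alpha> :: real
  assumes \<alpha>: "1 < \<alpha>"
  obtains M where "\<And>n. (\<Sum>j<n. \<Sum>k<j. (1 / ((real k + 1) * (real j - real k)))\<^sup>2 * (log2 j powr (\<alpha> - 1) * log2 k powr (\<alpha> - 1))) \<le> M"
proof -
  define a where "a = 2 * (\<alpha> - 1)"
  define D where "D = (2 * a) powr a"
  have a: "0 < a" using \<alpha> by (simp add: a_def)
  define g where "g d = (real d + 1) powr (- (3 / 2))" for d :: nat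
  have gs: "summable g"
  proof -
    have "summable (\<lambda>d. real (Suc d) powr (- (3 / 2)))"
      unfolding summable_Suc_iff[of "\<lambda>d. real d powr (- (3 / 2))"] by (simp add: summable_real_powr_iff)
    then show ?thesis by (simp add: g_def[abs_def] add.commute)
  qed
  have g0: "0 \<le> g d" for d by (simp add: g_def)
  define S where "S = (\<Sum>d. g d)"
  have Sn: "(\<Sum>d<n. g d) \<le> S" for n unfolding S_def by (intro sum_le_suminf gs) (auto simp: g0)
  have term_le: "(1 / ((real k + 1) * (real j - real k)))\<^sup>2 * (log2 j powr (\<alpha> - 1) * log2 k powr (\<alpha> - 1)) \<le> 3 * D * (g k * g (j - k - 1))"
    if kj: "k < j" for j k
  proof -
    define d where "d = j - k - 1"
    have d: "real j - real k = real d + 1" "j = k + d + 1" using kj by (auto simp: d_def)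
    have "log2 j powr (\<alpha> - 1) * log2 k powr (\<alpha> - 1) \<le> log2 j powr (\<alpha> - 1) * log2 j powr (\<alpha> - 1)"
      using \<alpha> log2_mono[of k j] log2_pos[of k] kj by (intro mult_left_mono powr_mono2) auto
    also have "\<dots> = log2 j powr a" by (simp add: a_def powr_add[symmetric])
    also have "\<dots> \<le> D * sqrt (real j + 2)" unfolding D_def by (rule log2_powr_le[OF a])
    \<comment> \<open>Here \<open>j + 2 = k + d + 3\<close>; the generous factor 9 has an exact
      root.\<close>
    also have "sqrt (real j + 2) \<le> sqrt (9 * ((real k + 1) * (real d + 1)))"
      by (rule real_sqrt_le_mono) (simp add: d(2) algebra_simps)
    also have "\<dots> = 3 * (sqrt (real k + 1) * sqrt (real d + 1))" by (simp add: real_sqrt_mult)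
    finally have w: "log2 j powr (\<alpha> - 1) * log2 k powr (\<alpha> - 1) \<le> D * (3 * (sqrt (real k + 1) * sqrt (real d + 1)))"
      by (simp add: D_def mult_left_mono)
    have gg: "g m = sqrt (real m + 1) / (real m + 1)\<^sup>2" for m
    proof -
      have "g m = (real m + 1) powr (1 / 2 + - 2)" by (simp add: g_def)
      also have "\<dots> = (real m + 1) powr (1 / 2) * (real m + 1) powr (- 2)" by (rule powr_add)
      also have "(real m + 1) powr (1 / 2) = sqrt (real m + 1)" by (simp add: powr_half_sqrt)
      also have "(real m + 1) powr (- 2) = 1 / (real m + 1)\<^sup>2" by (simp add: powr_minus_divide)
      finally show ?thesis by simp
    qed
    have "(1 / ((real k + 1) * (real j - real k)))\<^sup>2 * (log2 j powr (\<alpha> - 1) * log2 k powr (\<alpha> - 1))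
        \<le> (1 / ((real k + 1) * (real d + 1)))\<^sup>2 * (D * (3 * (sqrt (real k + 1) * sqrt (real d + 1))))"
      unfolding d(1) by (intro mult_left_mono w) auto
    also have "\<dots> = 3 * D * (g k * g d)" by (simp add: gg power_mult_distrib power_divide)
    finally show ?thesis by (simp add: d_def)
  qed
  have "(\<Sum>j<n. \<Sum>k<j. (1 / ((real k + 1) * (real j - real k)))\<^sup>2 * (log2 j powr (\<alpha> - 1) * log2 k powr (\<alpha> - 1))) \<le> 3 * D * (S * S)" for n
  proof -
    have "(\<Sum>j<n. \<Sum>k<j. (1 / ((real k + 1) * (real j - real k)))\<^sup>2 * (log2 j powr (\<alpha> - 1) * log2 k powr (\<alpha> - 1)))
        \<le> (\<Sum>j<n. \<Sum>k<j. 3 * D * (g k * g (j - k - 1)))"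
      by (intro sum_mono term_le) auto
    also have "\<dots> = 3 * D * (\<Sum>j<n. \<Sum>k<j. g k * g (j - k - 1))" by (simp only: sum_distrib_left)
    also have "(\<Sum>j<n. \<Sum>k<j. g k * g (j - k - 1)) = (\<Sum>p\<in>(SIGMA j:{..<n}. {..<j}). g (snd p) * g (fst p - snd p - 1))"
      by (subst sum.Sigma) (auto simp: case_prod_unfold)
    \<comment> \<open>In the variables \<open>k\<close> and \<open>d\<close> the triangle becomes
      part of a square, over which the sum factors.\<close>
    also have "\<dots> = (\<Sum>q\<in>(\<lambda>p. (snd p, fst p - snd p - 1)) ` (SIGMA j:{..<n}. {..<j}). g (fst q) * g (snd q))"
      by (subst sum.reindex) (auto simp: inj_on_def)
    also have "\<dots> \<le> (\<Sum>q\<in>{..<n} \<times> {..<n}. g (fst q) * g (snd q))"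
      by (intro sum_mono2) (auto simp: g0)
    also have "\<dots> = (\<Sum>d<n. g d) * (\<Sum>d<n. g d)"
      by (simp add: sum_product sum.cartesian_product case_prod_unfold)
    also have "\<dots> \<le> S * S" by (intro mult_mono Sn) (auto intro!: sum_nonneg g0 suminf_nonneg[OF gs] simp: S_def)
    finally show ?thesis by (simp add: D_def mult_left_mono)
  qed
  then show ?thesis by (rule that)
qed

text \<open>Up to a constant, a majorant for the squared entries of the normalized Gram matrix minus
  the identity: the quotients are the parts of an entry with difference and sum frequency, the
  weights bound the reciprocal normalizers. At \<open>j = k\<close> the first quotient is left out,
  since that part of the diagonal is what the normalization removes.\<close>

definition divided_diff_square :: "real \<Rightarrow> (nat \<Rightarrow> real) \<Rightarrow> nat \<Rightarrow> nat \<Rightarrow> real" where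
  "divided_diff_square \<alpha> s j k =
     ((if j = k then 0 else ((s j - s k) / (real j - real k))\<^sup>2) +
      (if j + k = 0 then 0 else ((s j + s k) / (real j + real k))\<^sup>2)) * (log2 j powr (\<alpha> - 1) * log2 k powr (\<alpha> - 1))"

text \<open>By symmetry only \<open>k <= j\<close> is estimated. The quotient with
  \<open>j + k\<close> is harmless, its denominator being at least \<open>j\<close>; the one with
  \<open>j - k\<close> is split by \<open>ds\<close> into the two kinds of double sums.\<close>

lemma divided_diff_square_summable:
  fixes \<alpha> :: real
  assumes \<alpha>: "1 < \<alpha>" and C: "0 \<le> C" and s: "\<And>k. \<bar>s k\<bar> \<le> C * log2 k powr (- \<alpha>)"
    and ds: "\<And>j k. k < j \<Longrightarrow> \<bar>s j - s k\<bar> / (real j - real k)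
      \<le> C * log2 k powr (- \<alpha>) / real j + C / ((real k + 1) * (real j - real k))"
  obtains M where "\<And>n. (\<Sum>j<n. \<Sum>k<n. divided_diff_square \<alpha> s j k) \<le> M"
proof -
  let ?\<Theta> = "divided_diff_square \<alpha> s"
  let ?w = "\<lambda>j k. log2 j powr (\<alpha> - 1) * log2 k powr (\<alpha> - 1)"
  let ?A = "\<lambda>j k. (log2 k powr (- \<alpha>) / real j)\<^sup>2 * ?w j k"
  let ?D = "\<lambda>j k. (1 / ((real k + 1) * (real j - real k)))\<^sup>2 * ?w j k"
  obtain M1 where M1: "\<And>n. (\<Sum>j=1..<n. \<Sum>k\<le>j. ?A j k) \<le> M1" using double_sum_slow[OF \<alpha>] by blast
  obtain M2 where M2: "\<And>n. (\<Sum>j<n. \<Sum>k<j. ?D j k) \<le> M2" using double_sum_fast[OF \<alpha>] by blast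
  have sq: "(x + y)\<^sup>2 \<le> 2 * x\<^sup>2 + 2 * y\<^sup>2" for x y :: real
    using sum_squares_bound[of x y] by (simp add: power2_sum)
  have nonneg: "0 \<le> ?\<Theta> j k" for j k unfolding divided_diff_square_def by simp
  have sym: "?\<Theta> j k = ?\<Theta> k j" for j k
  proof -
    have "((s j - s k) / (real j - real k))\<^sup>2 = ((s k - s j) / (real k - real j))\<^sup>2"
      by (simp add: power_divide power2_commute)
    then show ?thesis unfolding divided_diff_square_def by (auto simp: add.commute mult.commute)
  qed
  have plus: "(if j + k = 0 then 0 else ((s j + s k) / (real j + real k))\<^sup>2) \<le> 4 * C\<^sup>2 * (log2 k powr (- \<alpha>) / real j)\<^sup>2"
    if kj: "k \<le> j" "1 \<le> j" for j k
  proof -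
    let ?l = "log2 k powr (- \<alpha>)"
    have "log2 j powr (- \<alpha>) \<le> ?l" using \<alpha> log2_mono[OF kj(1)] log2_pos[of k] by (intro powr_mono2') auto
    then have "\<bar>s j + s k\<bar> \<le> 2 * C * ?l"
      using s[of j] s[of k] mult_left_mono[of "log2 j powr (- \<alpha>)" ?l C] C by linarith
    then have "\<bar>s j + s k\<bar> / (real j + real k) \<le> 2 * C * ?l / real j"
      using kj C by (intro frac_le) auto
    then have "(\<bar>s j + s k\<bar> / (real j + real k))\<^sup>2 \<le> (2 * C * ?l / real j)\<^sup>2" by (intro power_mono) auto
    then show ?thesis using kj by (simp add: power_divide power_mult_distrib)
  qed
  have le1: "?\<Theta> j k \<le> 6 * C\<^sup>2 * ?A j k + 2 * C\<^sup>2 * ?D j k" if kj: "k < j" for j k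
  proof -
    have "((s j - s k) / (real j - real k))\<^sup>2 = (\<bar>s j - s k\<bar> / (real j - real k))\<^sup>2" by (simp add: power_divide)
    also have "\<dots> \<le> (C * log2 k powr (- \<alpha>) / real j + C / ((real k + 1) * (real j - real k)))\<^sup>2"
      using kj by (intro power_mono ds) auto
    also have "\<dots> \<le> 2 * (C * log2 k powr (- \<alpha>) / real j)\<^sup>2 + 2 * (C / ((real k + 1) * (real j - real k)))\<^sup>2" by (rule sq)
    also have "\<dots> = 2 * C\<^sup>2 * (log2 k powr (- \<alpha>) / real j)\<^sup>2 + 2 * C\<^sup>2 * (1 / ((real k + 1) * (real j - real k)))\<^sup>2"
      by (simp add: power_divide power_mult_distrib)
    finally have "(if j = k then 0 else ((s j - s k) / (real j - real k))\<^sup>2) + (if j + k = 0 then 0 else ((s j + s k) / (real j + real k))\<^sup>2)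
      \<le> 6 * C\<^sup>2 * (log2 k powr (- \<alpha>) / real j)\<^sup>2 + 2 * C\<^sup>2 * (1 / ((real k + 1) * (real j - real k)))\<^sup>2"
      using plus[of k j] kj by simp
    then have "?\<Theta> j k \<le> (6 * C\<^sup>2 * (log2 k powr (- \<alpha>) / real j)\<^sup>2 + 2 * C\<^sup>2 * (1 / ((real k + 1) * (real j - real k)))\<^sup>2) * ?w j k"
      unfolding divided_diff_square_def by (intro mult_right_mono) auto
    then show ?thesis by (simp add: distrib_right mult.assoc)
  qed
  have le2: "?\<Theta> j j \<le> 6 * C\<^sup>2 * ?A j j" if j: "1 \<le> j" for j
  proof -
    have "(if j = j then 0 else ((s j - s j) / (real j - real j))\<^sup>2) + (if j + j = 0 then 0 else ((s j + s j) / (real j + real j))\<^sup>2)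
      \<le> 6 * C\<^sup>2 * (log2 j powr (- \<alpha>) / real j)\<^sup>2"
    proof -
      have "0 \<le> C\<^sup>2 * (log2 j powr (- \<alpha>) / real j)\<^sup>2" by simp
      then have "4 * C\<^sup>2 * (log2 j powr (- \<alpha>) / real j)\<^sup>2 \<le> 6 * C\<^sup>2 * (log2 j powr (- \<alpha>) / real j)\<^sup>2" by linarith
      from order_trans[OF plus[OF order_refl j] this] show ?thesis by simp
    qed
    then have "?\<Theta> j j \<le> (6 * C\<^sup>2 * (log2 j powr (- \<alpha>) / real j)\<^sup>2) * ?w j j"
      unfolding divided_diff_square_def by (intro mult_right_mono) auto
    then show ?thesis by (simp add: mult.assoc)
  qed
  have "(\<Sum>j<n. \<Sum>k<n. ?\<Theta> j k) \<le> 2 * (6 * C\<^sup>2 * M1 + 2 * C\<^sup>2 * M2)" for n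
  proof -
    have half: "(\<Sum>j<n. \<Sum>k\<le>j. ?\<Theta> j k) \<le> 6 * C\<^sup>2 * M1 + 2 * C\<^sup>2 * M2"
    proof -
      have "(\<Sum>j<n. \<Sum>k\<le>j. ?\<Theta> j k) = (\<Sum>j=1..<n. \<Sum>k\<le>j. ?\<Theta> j k)"
        by (rule sum.mono_neutral_right) (auto simp: divided_diff_square_def)
      also have "\<dots> \<le> (\<Sum>j=1..<n. 6 * C\<^sup>2 * (\<Sum>k\<le>j. ?A j k) + 2 * C\<^sup>2 * (\<Sum>k<j. ?D j k))"
      proof (rule sum_mono)
        fix j assume j: "j \<in> {1..<n}"
        have "(\<Sum>k\<le>j. ?\<Theta> j k) = (\<Sum>k<j. ?\<Theta> j k) + ?\<Theta> j j" by (simp add: lessThan_Suc_atMost[symmetric])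
        also have "\<dots> \<le> (\<Sum>k<j. 6 * C\<^sup>2 * ?A j k + 2 * C\<^sup>2 * ?D j k) + 6 * C\<^sup>2 * ?A j j"
          using j by (intro add_mono sum_mono le1 le2) auto
        also have "\<dots> = 6 * C\<^sup>2 * ((\<Sum>k<j. ?A j k) + ?A j j) + 2 * C\<^sup>2 * (\<Sum>k<j. ?D j k)"
          by (simp only: sum.distrib sum_distrib_left distrib_left)
        also have "(\<Sum>k<j. ?A j k) + ?A j j = (\<Sum>k\<le>j. ?A j k)" by (simp add: lessThan_Suc_atMost[symmetric])
        finally show "(\<Sum>k\<le>j. ?\<Theta> j k) \<le> 6 * C\<^sup>2 * (\<Sum>k\<le>j. ?A j k) + 2 * C\<^sup>2 * (\<Sum>k<j. ?D j k)" .
      qed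
      also have "\<dots> = 6 * C\<^sup>2 * (\<Sum>j=1..<n. \<Sum>k\<le>j. ?A j k) + 2 * C\<^sup>2 * (\<Sum>j=1..<n. \<Sum>k<j. ?D j k)"
        by (simp only: sum.distrib sum_distrib_left)
      also have "(\<Sum>j=1..<n. \<Sum>k<j. ?D j k) \<le> (\<Sum>j<n. \<Sum>k<j. ?D j k)"
        by (intro sum_mono2 sum_nonneg) auto
      also have "6 * C\<^sup>2 * (\<Sum>j=1..<n. \<Sum>k\<le>j. ?A j k) \<le> 6 * C\<^sup>2 * M1" by (intro mult_left_mono M1) auto
      finally have "(\<Sum>j<n. \<Sum>k\<le>j. ?\<Theta> j k) \<le> 6 * C\<^sup>2 * M1 + 2 * C\<^sup>2 * (\<Sum>j<n. \<Sum>k<j. ?D j k)"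
        by (simp add: mult_left_mono)
      then show ?thesis using mult_left_mono[OF M2[of n], of "2 * C\<^sup>2"] by simp
    qed
    have "(\<Sum>j<n. \<Sum>k<n. ?\<Theta> j k) \<le> (\<Sum>j<n. \<Sum>k<n. (if k \<le> j then ?\<Theta> j k else 0) + (if j \<le> k then ?\<Theta> j k else 0))"
      by (intro sum_mono) (auto simp: nonneg)
    also have "\<dots> = (\<Sum>j<n. \<Sum>k<n. if k \<le> j then ?\<Theta> j k else 0) + (\<Sum>j<n. \<Sum>k<n. if j \<le> k then ?\<Theta> j k else 0)"
      by (simp only: sum.distrib)
    also have "(\<Sum>j<n. \<Sum>k<n. if j \<le> k then ?\<Theta> j k else 0) = (\<Sum>k<n. \<Sum>j<n. if j \<le> k then ?\<Theta> k j else 0)"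
      by (subst sum.swap) (simp only: sym)
    also have "(\<Sum>j<n. \<Sum>k<n. if k \<le> j then ?\<Theta> j k else 0) = (\<Sum>j<n. \<Sum>k\<le>j. ?\<Theta> j k)"
      by (intro sum.cong refl sum.mono_neutral_cong_right) auto
    finally show ?thesis using half by simp
  qed
  then show ?thesis by (rule that)
qed

section \<open>The Gram matrix of the trigonometric system\<close>

context log_kernel
begin

definition freq :: real where
  "freq = 2 * pi / T"

lemma freq_pos: "0 < freq"
  using T by (simp add: freq_def)

lemma freq_T: "freq * of_int n * T = of_int n * (2 * pi)"
  using T by (simp add: freq_def)

lemma sin_cos_int_2pi: "sin (of_int n * (2 * pi) + x) = sin x" "cos (of_int n * (2 * pi) + x) = cos x"
  using sin_int_2pin[of n] cos_int_2pin[of n] by (simp_all add: sin_add cos_add mult.commute)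

text \<open>Products of trigonometric functions of \<open>s\<close> and \<open>t\<close> split into
  such waves, whose integrals along lines of constant \<open>s - t\<close> are explicit.\<close>

definition plane_wave :: "(real \<Rightarrow> real) \<Rightarrow> int \<Rightarrow> int \<Rightarrow> real \<Rightarrow> real \<Rightarrow> real" where
  "plane_wave h p q s t = indicator {0<..<T} s * indicator {0<..<T} t * h (freq * (of_int p * s + of_int q * t))"

lemma plane_wave_kernel:
  assumes h: "h \<in> borel_measurable borel" "\<And>x. \<bar>h x\<bar> \<le> 1"
  shows "integrable (lborel \<Otimes>\<^sub>M lborel) (\<lambda>z. plane_wave h p q (fst z) (snd z) * ker (fst z - snd z))"
    and "(LINT z|(lborel \<Otimes>\<^sub>M lborel). plane_wave h p q (fst z) (snd z) * ker (fst z - snd z))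
      = (LINT u|lborel. ker u * (LINT t|lborel. plane_wave h p q (t + u) t))"
proof -
  note [measurable] = h(1)
  have m: "(\<lambda>z. plane_wave h p q (fst z) (snd z)) \<in> borel_measurable (lborel \<Otimes>\<^sub>M lborel)"
    unfolding plane_wave_def by measurable
  have le: "\<bar>plane_wave h p q s t\<bar> \<le> 1" for s t
    using h(2) by (simp add: plane_wave_def indicator_def)
  have supp: "plane_wave h p q s t = 0" if "t \<notin> {0<..<T}" for s t
    using that by (simp add: plane_wave_def)
  show "integrable (lborel \<Otimes>\<^sub>M lborel) (\<lambda>z. plane_wave h p q (fst z) (snd z) * ker (fst z - snd z))"
    and "(LINT z|(lborel \<Otimes>\<^sub>M lborel). plane_wave h p q (fst z) (snd z) * ker (fst z - snd z))
      = (LINT u|lborel. ker u * (LINT t|lborel. plane_wave h p q (t + u) t))"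
    by (rule kernel_integral_substitution[OF ker_integrable m le supp]; assumption)+
qed

definition wave_form :: "(real \<Rightarrow> real) \<Rightarrow> int \<Rightarrow> int \<Rightarrow> real" where
  "wave_form h p q = (LINT z|(lborel \<Otimes>\<^sub>M lborel). plane_wave h p q (fst z) (snd z) * ker (fst z - snd z))"

text \<open>Reflecting \<open>(s, t)\<close> to \<open>(T - s, T - t)\<close> negates the phase
  modulo \<open>2 * pi\<close> and leaves the even kernel unchanged. Hence cosines and sines do not
  interact.\<close>

lemma wave_form_sin: "wave_form sin p q = 0"
proof -
  let ?W = "\<lambda>u. LINT t|lborel. plane_wave sin p q (t + u) t"
  have W: "?W (- u) = - ?W u" for u
  proof -
    have eq: "plane_wave sin p q (T - t - u) (T - t) = - plane_wave sin p q (t + u) t" for t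
    proof -
      have "freq * (of_int p * (T - t - u) + of_int q * (T - t))
        = of_int (p + q) * (2 * pi) + - (freq * (of_int p * (t + u) + of_int q * t))"
        using freq_T[of "p + q"] by (simp add: algebra_simps)
      then have "sin (freq * (of_int p * (T - t - u) + of_int q * (T - t))) = - sin (freq * (of_int p * (t + u) + of_int q * t))"
        by (simp only: sin_cos_int_2pi sin_minus)
      then show ?thesis by (auto simp: plane_wave_def indicator_def)
    qed
    have "?W (- u) = (LINT t|lborel. plane_wave sin p q (T - t - u) (T - t))"
      using lborel_integral_real_affine[of "-1" "\<lambda>t. plane_wave sin p q (t + - u) t" T] by simp
    then show ?thesis unfolding eq by simp
  qed
  have "wave_form sin p q = (LINT u|lborel. ker u * ?W u)"
    unfolding wave_form_def by (rule plane_wave_kernel(2)) auto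
  also have "\<dots> = (LINT u|lborel. ker (- u) * ?W (- u))"
    using lborel_integral_real_affine[of "-1" "\<lambda>u. ker u * ?W u" 0] by simp
  also have "\<dots> = - (LINT u|lborel. ker u * ?W u)" unfolding W ker.even by simp
  also have "(LINT u|lborel. ker u * ?W u) = wave_form sin p q"
    unfolding wave_form_def by (rule plane_wave_kernel(2)[symmetric]) auto
  finally show ?thesis by simp
qed

text \<open>Along a line \<open>s = t + u\<close> the phase grows at rate \<open>r\<close>, so
  integration over the part inside the square leaves two sines at its ends. By periodicity they
  depend only on \<open>\<bar>u\<bar>\<close>, and the kernel turns them into sine integrals, twice
  because of the two signs of \<open>u\<close>. For \<open>p + q = 0\<close> the phase is constant
  along the line; that case goes into the normalization.\<close>

lemma wave_form_cos:
  assumes pq: "p + q \<noteq> 0"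
  shows "wave_form cos p q = - 2 * (sin_int (freq * of_int p) + sin_int (freq * of_int q)) / (freq * of_int (p + q))"
proof -
  let ?W = "\<lambda>u. LINT t|lborel. plane_wave cos p q (t + u) t"
  define r where "r = freq * of_int (p + q)"
  have r: "r \<noteq> 0" using pq freq_pos unfolding r_def by simp
  define k where "k = - 1 / r"
  have rT: "r * T = of_int (p + q) * (2 * pi)" unfolding r_def by (rule freq_T)
  let ?a = "freq * of_int p" and ?b = "freq * of_int q"
  have rab: "r = ?a + ?b" by (simp add: r_def distrib_left)
  have ftc: "(LINT t|lborel. indicator {x<..<y} t * cos (r * t + ?a * u)) = sin (r * y + ?a * u) / r - sin (r * x + ?a * u) / r"
    if "x \<le> y" for x y u
    using that r by (intro integral_Ioo_FTC) (auto intro!: derivative_eq_intros continuous_intros)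
  have arg: "freq * (of_int p * (t + u) + of_int q * t) = r * t + ?a * u" for t u
    by (simp add: r_def algebra_simps)
  have W: "?W u = k * (sin (?a * \<bar>u\<bar>) + sin (?b * \<bar>u\<bar>))" if u: "\<bar>u\<bar> < T" for u
  proof (cases "0 \<le> u")
    case True
    have "?W u = (LINT t|lborel. indicator {0<..<T - u} t * cos (r * t + ?a * u))"
      using True u by (intro Bochner_Integration.integral_cong refl) (auto simp: plane_wave_def arg indicator_def)
    also have "\<dots> = sin (r * (T - u) + ?a * u) / r - sin (r * 0 + ?a * u) / r"
      using True u by (intro ftc) auto
    also have "r * (T - u) + ?a * u = of_int (p + q) * (2 * pi) + - (?b * u)"
      using rT by (simp add: rab algebra_simps)
    also have "sin (of_int (p + q) * (2 * pi) + - (?b * u)) = - sin (?b * u)"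
      by (simp only: sin_cos_int_2pi sin_minus)
    finally show ?thesis using True r by (simp add: k_def field_simps)
  next
    case False
    have "?W u = (LINT t|lborel. indicator {- u<..<T} t * cos (r * t + ?a * u))"
      using False u by (intro Bochner_Integration.integral_cong refl) (auto simp: plane_wave_def arg indicator_def)
    also have "\<dots> = sin (r * T + ?a * u) / r - sin (r * (- u) + ?a * u) / r"
      using False u by (intro ftc) auto
    also have "sin (r * T + ?a * u) = sin (?a * u)" unfolding rT by (rule sin_cos_int_2pi)
    also have "r * (- u) + ?a * u = - (?b * u)" by (simp add: rab algebra_simps)
    finally show ?thesis using False r by (simp add: k_def field_simps)
  qed
  have W0: "?W u = 0" if "T \<le> \<bar>u\<bar>" for u
  proof -
    have "plane_wave cos p q (t + u) t = 0" for t using that by (auto simp: plane_wave_def indicator_def)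
    then show ?thesis by simp
  qed
  let ?h = "\<lambda>u. k * (indicator {0<..<T} u * (B u * sin (?a * u)) + indicator {0<..<T} u * (B u * sin (?b * u)))"
  have ia: "integrable lborel (\<lambda>u. indicator {0<..<T} u * (B u * sin (x * u)))" for x
    by (rule B_mult_integrable) simp_all
  have h: "integrable lborel ?h" using ia[of ?a] ia[of ?b] by simp
  have h': "integrable lborel (\<lambda>u. ?h (- u))" using lborel_integrable_real_affine[OF h, of "-1" 0] by simp
  have eq: "ker u * ?W u = ?h u + ?h (- u)" if "u \<noteq> 0" for u
  proof (cases "\<bar>u\<bar> < T")
    case True
    then show ?thesis using that unfolding W[OF True] by (auto simp: ker_def abs_if indicator_def algebra_simps)
  next
    case False
    then show ?thesis using that W0[of u] by (auto simp: indicator_def)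
  qed
  have "wave_form cos p q = (LINT u|lborel. ker u * ?W u)"
    unfolding wave_form_def by (rule plane_wave_kernel(2)) auto
  also have "\<dots> = (LINT u|lborel. ?h u + ?h (- u))"
  proof (rule integral_cong_AE)
    have i: "integrable lborel (\<lambda>u. ?h u + ?h (- u))" using h h' by (rule Bochner_Integration.integrable_add)
    then show m: "(\<lambda>u. ?h u + ?h (- u)) \<in> borel_measurable lborel" by (rule borel_measurable_integrable)
    \<comment> \<open>Measurability of the product comes from the explicit expression, changed at
      the single point 0.\<close>
    have "(\<lambda>u. if u = 0 then ker 0 * ?W 0 else ?h u + ?h (- u)) \<in> borel_measurable lborel" using m by measurable
    also have "(\<lambda>u. if u = 0 then ker 0 * ?W 0 else ?h u + ?h (- u)) = (\<lambda>u. ker u * ?W u)"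
      using eq by (auto simp: fun_eq_iff)
    finally show "(\<lambda>u. ker u * ?W u) \<in> borel_measurable lborel" .
    show "AE u in lborel. ker u * ?W u = ?h u + ?h (- u)"
      using AE_not_in_lborel[of 0] by eventually_elim (rule eq)
  qed
  also have "\<dots> = (LINT u|lborel. ?h u) + (LINT u|lborel. ?h (- u))" by (rule Bochner_Integration.integral_add[OF h h'])
  also have "(LINT u|lborel. ?h (- u)) = (LINT u|lborel. ?h u)"
    by (rule sym) (use lborel_integral_real_affine[of "-1" ?h 0] in simp)
  also have "(LINT u|lborel. ?h u) = k * (sin_int ?a + sin_int ?b)"
    unfolding sin_int_def lborel_integral_eq_integral(2)[OF ia, symmetric] using ia[of ?a] ia[of ?b] by simp
  finally show ?thesis by (simp add: r_def k_def)
qed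

lemma sin_int_minus: "sin_int (- x) = - sin_int x"
  by (simp add: sin_int_def)

text \<open>Since \<open>sin_int\<close> is odd, the choice \<open>q = - n\<close> turns the sum of
  sine integrals into a difference.\<close>

lemma wave_form_cos_seq:
  shows "m \<noteq> n \<Longrightarrow> wave_form cos (int m) (- int n) = - (2 / freq) * ((sin_seq m - sin_seq n) / (real m - real n))"
    and "m + n \<noteq> 0 \<Longrightarrow> wave_form cos (int m) (int n) = - (2 / freq) * ((sin_seq m + sin_seq n) / (real m + real n))"
proof -
  have s: "sin_int (freq * of_int (int k)) = sin_seq k" for k by (simp add: sin_seq_def freq_def)
  show "m \<noteq> n \<Longrightarrow> wave_form cos (int m) (- int n) = - (2 / freq) * ((sin_seq m - sin_seq n) / (real m - real n))"
    using wave_form_cos[of "int m" "- int n"] s[of m] s[of n] by (simp add: sin_int_minus diff_divide_distrib mult.commute)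
  have "int m + int n \<noteq> 0" if "m + n \<noteq> 0" using that by presburger
  then  show "m + n \<noteq> 0 \<Longrightarrow> wave_form cos (int m) (int n) = - (2 / freq) * ((sin_seq m + sin_seq n) / (real m + real n))"
    using wave_form_cos[of "int m" "int n"] s[of m] s[of n] by (simp add: diff_divide_distrib add_divide_distrib mult.commute)
qed

definition gram :: "nat \<Rightarrow> nat \<Rightarrow> real" where
  "gram i j = kernel_form ker (trig_fun T i) (trig_fun T j)"

lemma gram_eq:
  defines "m \<equiv> \<lambda>i. int (trig_freq i)"
  shows "even i \<Longrightarrow> even j \<Longrightarrow> gram i j = (wave_form cos (m i) (- m j) + wave_form cos (m i) (m j)) / 2"
    and "odd i \<Longrightarrow> odd j \<Longrightarrow> gram i j = (wave_form cos (m i) (- m j) - wave_form cos (m i) (m j)) / 2"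
    and "even i \<noteq> even j \<Longrightarrow> gram i j = 0"
proof -
  have arg: "2 * pi * real (trig_freq i) * t / T = freq * of_int (m i) * t" for i t
    by (simp add: freq_def m_def)
  have pm: "freq * of_int a * s + freq * of_int b * t = freq * (of_int a * s + of_int b * t)"
    "freq * of_int a * s - freq * of_int b * t = freq * (of_int a * s + of_int (- b) * t)" for a b :: int and s t
    by (simp_all add: algebra_simps)
  have ic: "integrable (lborel \<Otimes>\<^sub>M lborel) (\<lambda>z. plane_wave cos p q (fst z) (snd z) * ker (fst z - snd z))"
    and isn: "integrable (lborel \<Otimes>\<^sub>M lborel) (\<lambda>z. plane_wave sin p q (fst z) (snd z) * ker (fst z - snd z))" for p q
    by (rule plane_wave_kernel(1); simp)+
  have E: "gram i j = (LINT z|(lborel \<Otimes>\<^sub>M lborel). indicator {0<..<T} (fst z) * indicator {0<..<T} (snd z) *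
      ((if even i then cos else sin) (freq * of_int (m i) * fst z) * (if even j then cos else sin) (freq * of_int (m j) * snd z)) * ker (fst z - snd z))"
    unfolding gram_def kernel_form_def trig_fun_def trig_basis_def arg
    by (intro Bochner_Integration.integral_cong refl) (simp add: mult_ac)
  {
    assume p: "even i" "even j"
    have "gram i j = (LINT z|(lborel \<Otimes>\<^sub>M lborel). (plane_wave cos (m i) (- m j) (fst z) (snd z) * ker (fst z - snd z)
        + plane_wave cos (m i) (m j) (fst z) (snd z) * ker (fst z - snd z)) / 2)"
      unfolding E using p
      by (intro Bochner_Integration.integral_cong refl)
        (simp only: if_True cos_times_cos pm plane_wave_def, simp add: field_simps)
    also have "\<dots> = (wave_form cos (m i) (- m j) + wave_form cos (m i) (m j)) / 2"
      unfolding wave_form_def by (simp only: integral_divide_zero Bochner_Integration.integral_add[OF ic ic])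
    finally show "gram i j = (wave_form cos (m i) (- m j) + wave_form cos (m i) (m j)) / 2" .
  next
    assume p: "odd i" "odd j"
    have "gram i j = (LINT z|(lborel \<Otimes>\<^sub>M lborel). (plane_wave cos (m i) (- m j) (fst z) (snd z) * ker (fst z - snd z)
        - plane_wave cos (m i) (m j) (fst z) (snd z) * ker (fst z - snd z)) / 2)"
      unfolding E using p
      by (intro Bochner_Integration.integral_cong refl)
        (simp only: if_False sin_times_sin pm plane_wave_def, simp add: field_simps)
    also have "\<dots> = (wave_form cos (m i) (- m j) - wave_form cos (m i) (m j)) / 2"
      unfolding wave_form_def by (simp only: integral_divide_zero Bochner_Integration.integral_diff[OF ic ic])
    finally show "gram i j = (wave_form cos (m i) (- m j) - wave_form cos (m i) (m j)) / 2" .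
  next
    assume "even i \<noteq> even j"
    then consider "even i" "odd j" | "odd i" "even j" by blast
    then show "gram i j = 0"
    proof cases
      case 1
      have "gram i j = (LINT z|(lborel \<Otimes>\<^sub>M lborel). (plane_wave sin (m i) (m j) (fst z) (snd z) * ker (fst z - snd z)
          - plane_wave sin (m i) (- m j) (fst z) (snd z) * ker (fst z - snd z)) / 2)"
        unfolding E using 1
        by (intro Bochner_Integration.integral_cong refl)
          (simp only: if_True if_False cos_times_sin pm plane_wave_def, simp add: field_simps)
      also have "\<dots> = (wave_form sin (m i) (m j) - wave_form sin (m i) (- m j)) / 2"
        unfolding wave_form_def by (simp only: integral_divide_zero Bochner_Integration.integral_diff[OF isn isn])
      finally show ?thesis by (simp add: wave_form_sin)
    next
      case 2
      have "gram i j = (LINT z|(lborel \<Otimes>\<^sub>M lborel). (plane_wave sin (m i) (m j) (fst z) (snd z) * ker (fst z - snd z)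
          + plane_wave sin (m i) (- m j) (fst z) (snd z) * ker (fst z - snd z)) / 2)"
        unfolding E using 2
        by (intro Bochner_Integration.integral_cong refl)
          (simp only: if_True if_False sin_times_cos pm plane_wave_def, simp add: field_simps)
      also have "\<dots> = (wave_form sin (m i) (m j) + wave_form sin (m i) (- m j)) / 2"
        unfolding wave_form_def by (simp only: integral_divide_zero Bochner_Integration.integral_add[OF isn isn])
      finally show ?thesis by (simp add: wave_form_sin)
    qed
  }
qed

text \<open>The mean of the two diagonal entries at frequency \<open>m\<close>, shared by cosine and
  sine. For \<open>m > 0\<close> it is half the wave form with \<open>p = m\<close> and
  \<open>q = - m\<close>, where the phase is constant along the lines; the entries deviate from it
  only by a term of sum frequency \<open>2 * m\<close>.\<close>

definition lam :: "nat \<Rightarrow> real" where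
  "lam m = (if m = 0 then gram 0 0 else (gram (2 * m) (2 * m) + gram (2 * m - 1) (2 * m - 1)) / 2)"

text \<open>A function supported in \<open>(0, T)\<close> is viewed on \<open>(0, 2 * T)\<close>,
  where the frequency doubles; one of the two squares in the rank-two bound is dropped.\<close>

lemma kernel_form_ker_lower:
  assumes F: "F \<in> borel_measurable borel" "integrable lborel (\<lambda>t. (F t)\<^sup>2)" "\<And>t. t \<notin> {0<..<T} \<Longrightarrow> F t = 0"
  shows "cos_int (trig_freq i) / T * (LINT t|lborel. F t * trig_basis T i t)\<^sup>2 \<le> kernel_form ker F F"
proof -
  define m where "m = trig_freq i"
  let ?w = "2 * pi * real (2 * m) / (2 * T)"
  let ?C = "(LINT t|lborel. F t * cos (?w * t))\<^sup>2" and ?S = "(LINT t|lborel. F t * sin (?w * t))\<^sup>2"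
  have F': "F t = 0" if "t \<notin> {0<..<2 * T}" for t using that T by (intro F(3)) auto
  have low: "2 * cos_int m / trig_square (2 * T) (2 * m) * (?C + ?S) \<le> kernel_form ker F F"
    using ker.kernel_form_lower[OF cos_coeff_ker_nonneg F(1,2) F', of "2 * m"] unfolding cos_coeff_ker_even .
  have "(LINT t|lborel. F t * trig_basis T i t)\<^sup>2 \<le> ?C + ?S"
  proof -
    have arg: "2 * pi * real (trig_freq i) * t / T = ?w * t" for t by (simp add: m_def)
    have "(LINT t|lborel. F t * trig_basis T i t)\<^sup>2 = (if even i then ?C else ?S)"
      unfolding trig_basis_def arg by simp
    then show ?thesis by simp
  qed
  then have "cos_int m / T * (LINT t|lborel. F t * trig_basis T i t)\<^sup>2 \<le> cos_int m / T * (?C + ?S)"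
    using cos_int_pos[of m] T by (intro mult_left_mono) auto
  also have "\<dots> \<le> 2 * cos_int m / trig_square (2 * T) (2 * m) * (?C + ?S)"
    using cos_int_pos[of m] T by (intro mult_right_mono) (auto simp: trig_square_def field_simps)
  finally show ?thesis using low by (simp add: m_def)
qed

text \<open>The lower bound for the form is tested on the trigonometric function itself; the
  constant comes from \<open>trig_square T i >= T / 2\<close>.\<close>

lemma gram_diag_lower: "cos_int (trig_freq i) * T / 4 \<le> gram i i"
proof -
  have 1: "cos_int (trig_freq i) / T * (LINT t|lborel. trig_fun T i t * trig_basis T i t)\<^sup>2 \<le> gram i i"
    unfolding gram_def
    by (rule kernel_form_ker_lower) (simp_all add: trig_fun_square_integrable, simp add: trig_fun_def)
  have 2: "(LINT t|lborel. trig_fun T i t * trig_basis T i t) = trig_square T i"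
    using trig_fun_orthogonal[OF T, of i i] by simp
  have "cos_int (trig_freq i) * T / 4 \<le> cos_int (trig_freq i) / T * (trig_square T i)\<^sup>2"
  proof -
    have "(T / 2)\<^sup>2 \<le> (trig_square T i)\<^sup>2" using T by (intro power_mono) (auto simp: trig_square_def)
    then have "cos_int (trig_freq i) / T * (T / 2)\<^sup>2 \<le> cos_int (trig_freq i) / T * (trig_square T i)\<^sup>2"
      using cos_int_pos[of "trig_freq i"] T by (intro mult_left_mono) auto
    moreover have "cos_int (trig_freq i) / T * (T / 2)\<^sup>2 = cos_int (trig_freq i) * T / 4" using T by (simp add: power2_eq_square)
    ultimately show ?thesis by linarith
  qed
  then show ?thesis using 1 unfolding 2 by (rule order_trans)
qed

lemma lam_lower: "cos_int m * T / 4 \<le> lam m"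
proof (cases "m = 0")
  case True
  then show ?thesis using gram_diag_lower[of 0] by (simp add: lam_def trig_freq_def)
next
  case False
  then have f: "trig_freq (2 * m) = m" "trig_freq (2 * m - 1) = m" by (simp_all add: trig_freq_def)
  show ?thesis
    unfolding lam_def if_not_P[OF False]
  proof -
    have "x \<le> a \<Longrightarrow> x \<le> b \<Longrightarrow> x \<le> (a + b) / 2" for x a b :: real by simp
    then show "cos_int m * T / 4 \<le> (gram (2 * m) (2 * m) + gram (2 * m - 1) (2 * m - 1)) / 2"
      using gram_diag_lower[of "2 * m"] gram_diag_lower[of "2 * m - 1"] unfolding f by blast
  qed
qed

lemma lam_pos: "0 < lam m"
  using lam_lower[of m] cos_int_pos[of m] T by (smt (verit) divide_pos_pos mult_pos_pos)

text \<open>Entries of different parity vanish. For equal parity and \<open>i \<noteq> j\<close> the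
  frequencies differ, so both divided differences are available. On the diagonal the normalization
  removes the part of constant phase and only the quotient with \<open>m + m\<close> survives; at
  \<open>m = 0\<close> nothing does.\<close>

lemma normalized_gram_bound:
  obtains K where "0 \<le> K" "\<And>i j. (gram i j / (sqrt (lam (trig_freq i)) * sqrt (lam (trig_freq j))) - of_bool (i = j))\<^sup>2
     \<le> K * divided_diff_square \<alpha> sin_seq (trig_freq i) (trig_freq j)"
proof -
  obtain c where c: "0 < c" "\<And>k. c * log2 k powr (1 - \<alpha>) \<le> cos_int k"
    using cos_int_ln_bound unfolding log2_def by blast
  define d where "d = c * T / 4"
  have d: "0 < d" using c(1) T by (simp add: d_def)
  have lam_low: "d * log2 m powr (1 - \<alpha>) \<le> lam m" for m
  proof -
    have "d * log2 m powr (1 - \<alpha>) = (c * log2 m powr (1 - \<alpha>)) * T / 4" by (simp add: d_def)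
    also have "\<dots> \<le> cos_int m * T / 4" using c(2)[of m] T by simp
    finally show ?thesis using lam_lower[of m] by linarith
  qed
  have inv: "1 / lam m \<le> log2 m powr (\<alpha> - 1) / d" for m
  proof -
    have "1 / lam m \<le> 1 / (d * log2 m powr (1 - \<alpha>))"
      using lam_low[of m] d log2_pos[of m] lam_pos[of m] by (intro divide_left_mono mult_pos_pos) auto
    also have "\<dots> = log2 m powr (- (1 - \<alpha>)) / d" using d by (simp only: powr_minus_divide) simp
    finally show ?thesis by simp
  qed
  define K where "K = 2 / freq\<^sup>2 / d\<^sup>2"
  have K: "0 \<le> K" by (simp add: K_def)
  define X where "X m n = (if m = n then 0 else ((sin_seq m - sin_seq n) / (real m - real n))\<^sup>2)" for m n
  define Y where "Y m n = (if m + n = 0 then 0 else ((sin_seq m + sin_seq n) / (real m + real n))\<^sup>2)" for m n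
  have XY: "0 \<le> X m n" "0 \<le> Y m n" for m n by (simp_all add: X_def Y_def)
  have sq4: "(- (2 / freq) * x)\<^sup>2 = 4 / freq\<^sup>2 * x\<^sup>2" for x by (simp add: power2_eq_square)
  have wave1: "(wave_form cos (int m) (- int n))\<^sup>2 = 4 / freq\<^sup>2 * X m n" if "m \<noteq> n" for m n
    using that unfolding wave_form_cos_seq(1)[OF that] X_def sq4 by (simp only: if_False)
  have wave2: "(wave_form cos (int m) (int n))\<^sup>2 = 4 / freq\<^sup>2 * Y m n" if "m + n \<noteq> 0" for m n
    using that unfolding wave_form_cos_seq(2)[OF that] Y_def sq4 by (simp only: if_False)
  have dd: "divided_diff_square \<alpha> sin_seq m n = (X m n + Y m n) * (log2 m powr (\<alpha> - 1) * log2 n powr (\<alpha> - 1))" for m n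
    by (simp add: divided_diff_square_def X_def Y_def)
  have fin: "v\<^sup>2 / (lam m * lam n) \<le> K * divided_diff_square \<alpha> sin_seq m n"
    if v: "v\<^sup>2 \<le> 2 / freq\<^sup>2 * (X m n + Y m n)" for v m n
  proof -
    have "v\<^sup>2 / (lam m * lam n) = v\<^sup>2 * ((1 / lam m) * (1 / lam n))" by simp
    also have "\<dots> \<le> (2 / freq\<^sup>2 * (X m n + Y m n)) * ((log2 m powr (\<alpha> - 1) / d) * (log2 n powr (\<alpha> - 1) / d))"
      using v XY[of m n] lam_pos[of m] lam_pos[of n] d
      by (intro mult_mono inv) auto
    also have "\<dots> = K * divided_diff_square \<alpha> sin_seq m n" by (simp add: K_def dd power2_eq_square)
    finally show ?thesis .
  qed
  have sq: "((x + y) / 2)\<^sup>2 \<le> (x\<^sup>2 + y\<^sup>2) / 2" "((x - y) / 2)\<^sup>2 \<le> (x\<^sup>2 + y\<^sup>2) / 2" for x y :: real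
    using zero_le_power2[of "x - y"] zero_le_power2[of "x + y"] by (simp_all add: power2_eq_square algebra_simps)
  have norm_eq: "(g / (sqrt (lam m) * sqrt (lam n)))\<^sup>2 = g\<^sup>2 / (lam m * lam n)" for g m n
    using lam_pos[of m] lam_pos[of n] by (simp add: power_divide power_mult_distrib)
  have "(gram i j / (sqrt (lam (trig_freq i)) * sqrt (lam (trig_freq j))) - of_bool (i = j))\<^sup>2
     \<le> K * divided_diff_square \<alpha> sin_seq (trig_freq i) (trig_freq j)" for i j
  proof -
    define m n where "m = trig_freq i" and "n = trig_freq j"
    note g = gram_eq[of i j, folded m_def n_def]
    have D0: "0 \<le> K * divided_diff_square \<alpha> sin_seq m n" unfolding dd using K XY by simp
    show ?thesis
    proof (cases "i = j")
      case True
      then have mn: "n = m" by (simp add: m_def n_def)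
      show ?thesis
      proof (cases "m = 0")
        case m0: True
        then have "i = 0" unfolding m_def trig_freq_def by (cases i) auto
        then show ?thesis using True D0 m0 lam_pos[of 0] unfolding m_def[symmetric] n_def[symmetric]
          by (simp add: mn lam_def)
      next
        case False
        define y where "y = wave_form cos (int m) (int m)"
        have f: "trig_freq (2 * m) = m" "trig_freq (2 * m - 1) = m" using False by (simp_all add: trig_freq_def)
        have g2: "gram (2 * m) (2 * m) = (wave_form cos (int m) (- int m) + y) / 2"
          "gram (2 * m - 1) (2 * m - 1) = (wave_form cos (int m) (- int m) - y) / 2"
          using gram_eq(1)[of "2 * m" "2 * m"] gram_eq(2)[of "2 * m - 1" "2 * m - 1"] False f by (simp_all add: y_def)
        have lam_m: "lam m = wave_form cos (int m) (- int m) / 2" unfolding lam_def if_not_P[OF False] g2 by (simp add: field_simps)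
        have im: "i = 2 * m \<or> i = 2 * m - 1" unfolding m_def trig_freq_def by (cases "even i") (auto elim!: evenE oddE)
        have gi: "gram i j = lam m + y / 2 \<or> gram i j = lam m - y / 2"
          using im g2 lam_m True by (auto simp: add_divide_distrib diff_divide_distrib)
        have "sqrt (lam m) * sqrt (lam m) = lam m" using lam_pos[of m] by simp
        then have "gram i j / (sqrt (lam m) * sqrt (lam n)) - of_bool (i = j) = (gram i j - lam m) / lam m"
          using True mn lam_pos[of m] by (simp add: field_simps)
        also have "\<dots>\<^sup>2 = (y / 2)\<^sup>2 / (lam m * lam m)"
          using gi by (auto simp: power_divide power2_eq_square)
        also have "\<dots> \<le> K * divided_diff_square \<alpha> sin_seq m m"
        proof (rule fin)
          show "(y / 2)\<^sup>2 \<le> 2 / freq\<^sup>2 * (X m m + Y m m)"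
            using wave2[of m m] False XY(2)[of m m] freq_pos by (simp add: y_def power_divide X_def field_simps)
        qed
        finally show ?thesis by (simp add: m_def[symmetric] n_def[symmetric] mn)
      qed
    next
      case False
      have bound: "(gram i j)\<^sup>2 \<le> 2 / freq\<^sup>2 * (X m n + Y m n)"
      proof (cases "even i = even j")
        case par: True
        have "m \<noteq> n" using False par unfolding m_def n_def trig_freq_def by (cases "even i") (auto elim!: evenE oddE)
        then have "m + n \<noteq> 0" by presburger
        have "(gram i j)\<^sup>2 \<le> ((wave_form cos (int m) (- int n))\<^sup>2 + (wave_form cos (int m) (int n))\<^sup>2) / 2"
        proof (cases "even i")
          case True
          then have "even j" using par by simp
          show ?thesis unfolding g(1)[OF True \<open>even j\<close>] by (rule sq(1))
        next
          case False
          then have "odd j" using par by simp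
          show ?thesis unfolding g(2)[OF False \<open>odd j\<close>] by (rule sq(2))
        qed
        also have "\<dots> = 2 / freq\<^sup>2 * (X m n + Y m n)"
          unfolding wave1[OF \<open>m \<noteq> n\<close>] wave2[OF \<open>m + n \<noteq> 0\<close>] by (simp add: add_divide_distrib algebra_simps)
        finally show ?thesis .
      next
        case par: False
        then show ?thesis using g(3) XY[of m n] by simp
      qed
      have "(gram i j / (sqrt (lam m) * sqrt (lam n)) - of_bool (i = j))\<^sup>2 = (gram i j)\<^sup>2 / (lam m * lam n)"
        using False by (simp add: norm_eq)
      then show ?thesis using fin[OF bound] by (simp add: m_def n_def)
    qed
  qed
  then show ?thesis using that K by blast
qed

end

text \<open>A frequency belongs to at most two indices, \<open>2 * m\<close> and
  \<open>2 * m - 1\<close>; for \<open>m = 0\<close> truncated subtraction merges them.\<close>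

lemma sum_trig_freq_le:
  fixes f :: "nat \<Rightarrow> real"
  assumes "\<And>m. 0 \<le> f m"
  shows "(\<Sum>i<n. f (trig_freq i)) \<le> 2 * (\<Sum>m<n. f m)"
proof -
  have sub: "trig_freq ` {..<n} \<subseteq> {..<n}" by (auto simp: trig_freq_def)
  have "(\<Sum>i<n. f (trig_freq i)) = (\<Sum>m<n. \<Sum>i\<in>{i\<in>{..<n}. trig_freq i = m}. f (trig_freq i))"
    by (rule sum.group[symmetric]) (use sub in auto)
  also have "\<dots> \<le> (\<Sum>m<n. 2 * f m)"
  proof (rule sum_mono)
    fix m
    have "{i\<in>{..<n}. trig_freq i = m} \<subseteq> {2 * m, 2 * m - 1}"
      by (auto simp: trig_freq_def)
    then have "card {i\<in>{..<n}. trig_freq i = m} \<le> card {2 * m, 2 * m - 1}" by (intro card_mono) auto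
    also have "\<dots> \<le> 2" by (simp add: card_insert_if)
    finally have "real (card {i\<in>{..<n}. trig_freq i = m}) \<le> 2" by simp
    then have "real (card {i\<in>{..<n}. trig_freq i = m}) * f m \<le> 2 * f m" using assms by (intro mult_right_mono) auto
    then show "(\<Sum>i\<in>{i\<in>{..<n}. trig_freq i = m}. f (trig_freq i)) \<le> 2 * f m" by simp
  qed
  finally show ?thesis by (simp add: sum_distrib_left)
qed

section \<open>Orthogonality in the completion\<close>

context log_kernel
begin

text \<open>Differences of points of \<open>(0, T)\<close> stay in \<open>(- T, T)\<close>, where
  the periodized kernel is \<open>B\<close>.\<close>

lemma B_form_eq_kernel_form:
  "B_form B T f g = kernel_form ker (\<lambda>t. indicator {0<..<T} t * f t) (\<lambda>t. indicator {0<..<T} t * g t)"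
  unfolding B_form_def set_lebesgue_integral_def kernel_form_def
proof (intro Bochner_Integration.integral_cong refl)
  fix p :: "real \<times> real"
  obtain s t where p: "p = (s, t)" by (cases p)
  show "indicator ({0<..<T} \<times> {0<..<T}) p *\<^sub>R (f (fst p) * g (snd p) * B (fst p - snd p))
    = indicator {0<..<T} (fst p) * f (fst p) * (indicator {0<..<T} (snd p) * g (snd p)) * ker (fst p - snd p)"
  proof (cases "s \<in> {0<..<T} \<and> t \<in> {0<..<T}")
    case True
    then have "\<bar>s - t\<bar> < T" by auto
    then have "ker (s - t) = B (s - t)" using B_even[of "s - t"] by (auto simp: ker_def abs_if)
    then show ?thesis using True by (simp add: p)
  qed (auto simp: p)
qed

end

lemma trig_poly_in_L2:
  "(\<lambda>t. \<Sum>i<n. c i * trig_fun T i t) \<in> L2_functions T"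
proof -
  let ?f = "\<lambda>t. \<Sum>i<n. c i * trig_fun T i t"
  have eq: "(\<lambda>t. indicator {0<..<T} t *\<^sub>R ?f t) = ?f" "(\<lambda>t. indicator {0<..<T} t *\<^sub>R (?f t)\<^sup>2) = (\<lambda>t. (?f t)\<^sup>2)"
    by (auto simp: fun_eq_iff indicator_def trig_fun_def)
  have "\<bar>?f t\<bar> \<le> (\<Sum>i<n. \<bar>c i\<bar>)" for t
  proof (rule order_trans[OF sum_abs sum_mono])
    show "\<bar>c i * trig_fun T i t\<bar> \<le> \<bar>c i\<bar>" for i
      using trig_fun_le[of T i t] by (simp add: abs_mult mult_left_le)
  qed
  then have "integrable lborel (\<lambda>t. (?f t)\<^sup>2)"
    by (intro integrable_power2_bounded[where P = T]) (auto simp: trig_fun_def)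
  then show ?thesis
    unfolding L2_functions_def set_borel_measurable_def set_integrable_def mem_Collect_eq eq by simp
qed

lemma trig_fun_in_L2: "trig_fun T k \<in> L2_functions T"
proof -
  have "trig_fun T k = (\<lambda>t. \<Sum>i<Suc k. of_bool (i = k) * trig_fun T i t)"
    by (simp add: fun_eq_iff of_bool_def if_distrib[of "\<lambda>s. s * _"] cong: if_cong)
  then show ?thesis using trig_poly_in_L2[where n = "Suc k" and c = "\<lambda>i. of_bool (i = k)" and T = T] by simp
qed

locale log_kernel_space = log_kernel \<alpha> T \<delta> B for \<alpha> T \<delta> :: real and B +
  fixes J :: "(real \<Rightarrow> real) \<Rightarrow> 'h::{real_inner, complete_space}"
  assumes J: "is_G B T J"
begin

lemma J_add: "f \<in> L2_functions T \<Longrightarrow> g \<in> L2_functions T \<Longrightarrow> J (\<lambda>t. f t + g t) = J f + J g"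
  and J_scale: "f \<in> L2_functions T \<Longrightarrow> J (\<lambda>t. c * f t) = c *\<^sub>R J f"
  and J_inner: "f \<in> L2_functions T \<Longrightarrow> g \<in> L2_functions T \<Longrightarrow> inner (J f) (J g) = B_form B T f g"
  and J_dense: "closure (J ` L2_functions T) = UNIV"
  using J unfolding is_G_def by blast+

lemma J_norm: "f \<in> L2_functions T \<Longrightarrow> (norm (J f))\<^sup>2 = kernel_form ker (\<lambda>t. indicator {0<..<T} t * f t) (\<lambda>t. indicator {0<..<T} t * f t)"
  unfolding power2_norm_eq_inner by (simp only: J_inner B_form_eq_kernel_form)

lemma J_zero: "J (\<lambda>t. 0) = 0"
  using J_scale[OF trig_fun_in_L2[of T 0], of 0] by simp

lemma J_trig_sum: "J (\<lambda>t. \<Sum>i<n. c i * trig_fun T i t) = (\<Sum>i<n. c i *\<^sub>R J (trig_fun T i))"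
proof (induction n)
  case (Suc n)
  have "(\<lambda>t. c n * trig_fun T n t) \<in> L2_functions T"
  proof -
    have "(\<lambda>t. c n * trig_fun T n t) = (\<lambda>t. \<Sum>i<Suc n. (if i = n then c n else 0) * trig_fun T i t)"
      by (simp add: fun_eq_iff if_distrib[of "\<lambda>s. s * _"] cong: if_cong)
    then show ?thesis using trig_poly_in_L2[where n = "Suc n" and c = "\<lambda>i. if i = n then c n else 0" and T = T] by simp
  qed
  then show ?case
    using J_add[OF trig_poly_in_L2[where n = n and c = c and T = T], of "\<lambda>t. c n * trig_fun T n t"] Suc
      J_scale[OF trig_fun_in_L2[of T n], of "c n"]
    by simp
qed (simp add: J_zero)

lemma inner_trig: "inner (J (trig_fun T i)) (J (trig_fun T j)) = gram i j"
proof -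
  have "(\<lambda>t. indicator {0<..<T} t * trig_fun T i t) = trig_fun T i" for i
    by (auto simp: fun_eq_iff trig_fun_def indicator_def)
  then show ?thesis by (simp only: J_inner[OF trig_fun_in_L2 trig_fun_in_L2] B_form_eq_kernel_form gram_def)
qed

definition x :: "nat \<Rightarrow> 'h" where
  "x i = (1 / sqrt (lam (trig_freq i))) *\<^sub>R J (trig_fun T i)"

lemma J_trig: "J (trig_fun T i) = sqrt (lam (trig_freq i)) *\<^sub>R x i"
  using lam_pos[of "trig_freq i"] by (simp add: x_def)

text \<open>The Young bound with the integrable kernel turns mean square convergence into
  convergence in the completion, so density of trigonometric polynomials carries over.\<close>

lemma x_dense: "closure (span (range x)) = UNIV"
proof -
  define M where "M = (LINT s|lborel. \<bar>ker s\<bar>)"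
  have M: "0 \<le> M" by (simp add: M_def)
  have "J f \<in> closure (span (range x))" if f: "f \<in> L2_functions T" for f
    unfolding closure_approachable
  proof safe
    fix e :: real assume e: "0 < e"
    have "0 < e\<^sup>2 / (M + 1)" using e M by simp
    then obtain q where q: "trig_poly T q" "(LINT t|lborel. (indicator {0<..<T} t * (f t - q t))\<^sup>2) < e\<^sup>2 / (M + 1)"
      "integrable lborel (\<lambda>t. (indicator {0<..<T} t * (f t - q t))\<^sup>2)"
      using trig_poly_dense[OF T f, of "e\<^sup>2 / (M + 1)"] by blast
    obtain n c where c: "\<And>t. q t = (\<Sum>i<n. c i * trig_basis T i t)" using q(1) unfolding trig_poly_def by blast
    let ?q = "\<lambda>t. \<Sum>i<n. c i * trig_fun T i t"
    have qL: "?q \<in> L2_functions T" by (rule trig_poly_in_L2)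
    \<comment> \<open>\<open>J\<close> is known to be additive and homogeneous on
      \<open>L2_functions T\<close>, so a difference is written as a sum with the factor
      \<open>- 1\<close>.\<close>
    have mqL: "(\<lambda>t. - 1 * ?q t) \<in> L2_functions T"
      using trig_poly_in_L2[where n = n and c = "\<lambda>i. - c i" and T = T] by (simp add: sum_negf)
    define D where "D t = indicator {0<..<T} t * (f t - q t)" for t
    have D_eq: "indicator {0<..<T} t * (f t + - 1 * ?q t) = D t" for t
      by (simp add: D_def c trig_fun_def indicator_def)
    have Dm: "D \<in> borel_measurable lborel"
    proof -
      have "D = (\<lambda>t. indicator {0<..<T} t * f t - ?q t)"
        by (auto simp: fun_eq_iff D_def c trig_fun_def indicator_def)
      then show ?thesis using L2_functionsD(1)[OF f] by simp
    qed
    have D2: "integrable lborel (\<lambda>t. (D t)\<^sup>2)" using q(3) by (simp add: D_def)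
    have fq: "(\<lambda>t. f t + - 1 * ?q t) \<in> L2_functions T"
    proof -
      have e1: "(\<lambda>t. indicator {0<..<T} t *\<^sub>R (f t + - 1 * ?q t)) = D" using D_eq by (simp add: fun_eq_iff)
      have e2: "(\<lambda>t. indicator {0<..<T} t *\<^sub>R (f t + - 1 * ?q t)\<^sup>2) = (\<lambda>t. (D t)\<^sup>2)"
        by (auto simp: fun_eq_iff D_eq[symmetric] indicator_def)
      show ?thesis
        unfolding L2_functions_def set_borel_measurable_def set_integrable_def mem_Collect_eq e1 e2
        using Dm D2 by simp
    qed
    have "J f - J ?q = J (\<lambda>t. f t + - 1 * ?q t)"
      using J_add[OF f mqL] J_scale[OF qL, of "- 1"] by simp
    then have "(norm (J f - J ?q))\<^sup>2 = kernel_form ker D D"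
      using J_norm[OF fq] unfolding D_eq by simp
    also have "\<dots> \<le> M * (LINT t|lborel. (D t)\<^sup>2)"
      using kernel_form_Young(2)[OF ker_integrable Dm D2 Dm D2] by (simp add: M_def)
    also have "\<dots> \<le> (M + 1) * (LINT t|lborel. (D t)\<^sup>2)" by (intro mult_right_mono) auto
    also have "\<dots> < e\<^sup>2" using q(2) M unfolding D_def[symmetric] by (simp add: field_simps)
    finally have "norm (J f - J ?q) < e" using e power2_less_imp_less by fastforce
    then have "dist (J ?q) (J f) < e" by (simp add: dist_norm norm_minus_commute)
    moreover have "J ?q \<in> span (range x)"
      unfolding J_trig_sum J_trig by (intro span_sum span_scale span_base) auto
    ultimately show "\<exists>y\<in>span (range x). dist y (J f) < e" by blast
  qed
  then have "J ` L2_functions T \<subseteq> closure (span (range x))" by blast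
  then have "closure (J ` L2_functions T) \<subseteq> closure (span (range x))" by (rule closure_minimal) simp
  then show ?thesis using J_dense by auto
qed

text \<open>The coefficient \<open>c k\<close> is recovered from a Fourier coefficient of the
  function behind the sum, which the form controls by \<open>kernel_form_ker_lower\<close>. The
  constant depends on \<open>k\<close> but not on \<open>n\<close>.\<close>

lemma x_independent: "\<exists>C. \<forall>n c. k < n \<longrightarrow> \<bar>c k\<bar> \<le> C * norm (\<Sum>i<n. c i *\<^sub>R x i)"
proof (intro exI allI impI)
  fix n :: nat and c :: "nat \<Rightarrow> real" assume kn: "k < n"
  define l where "l i = sqrt (lam (trig_freq i))" for i
  have l: "0 < l i" for i using lam_pos by (simp add: l_def)
  define F where "F t = (\<Sum>i<n. c i / l i * trig_fun T i t)" for t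
  have FL: "F \<in> L2_functions T" unfolding F_def by (rule trig_poly_in_L2)
  have ind: "(\<lambda>t. indicator {0<..<T} t * F t) = F"
    by (auto simp: fun_eq_iff F_def trig_fun_def indicator_def)
  have JF: "J F = (\<Sum>i<n. c i *\<^sub>R x i)"
    unfolding F_def J_trig_sum x_def l_def[symmetric] by simp
  define b where "b = cos_int (trig_freq k) / T"
  have b: "0 < b" using cos_int_pos T by (simp add: b_def)
  have "F t = 0" if "t \<notin> {0<..<T}" for t using that by (simp add: F_def trig_fun_def)
  then have low: "b * (LINT t|lborel. F t * trig_basis T k t)\<^sup>2 \<le> (norm (J F))\<^sup>2"
    unfolding J_norm[OF FL] ind b_def
    using L2_functionsD[OF FL] by (intro kernel_form_ker_lower) (simp_all add: fun_cong[OF ind] ind)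
  have i: "integrable lborel (\<lambda>t. trig_fun T i t * trig_basis T k t)" for i
  proof -
    have "integrable lborel (\<lambda>t. indicator {0<..<T} t * (trig_basis T i t * trig_basis T k t))"
    proof (rule integrable_Ioo_bounded[where M = 1])
      show "\<bar>trig_basis T i t * trig_basis T k t\<bar> \<le> 1" for t
        unfolding abs_mult using trig_basis_le[of T i t] trig_basis_le[of T k t] by (intro mult_le_one) auto
    qed measurable
    then show ?thesis by (simp add: trig_fun_def mult.assoc)
  qed
  have "(LINT t|lborel. F t * trig_basis T k t) = (LINT t|lborel. (\<Sum>i<n. c i / l i * (trig_fun T i t * trig_basis T k t)))"
    by (simp add: F_def sum_distrib_right mult.assoc)
  also have "\<dots> = (\<Sum>i<n. c i / l i * (LINT t|lborel. trig_fun T i t * trig_basis T k t))"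
    using i by (simp add: Bochner_Integration.integral_sum)
  also have "\<dots> = (\<Sum>i<n. if i = k then c k / l k * trig_square T k else 0)"
    unfolding trig_fun_orthogonal[OF T] by (intro sum.cong refl) auto
  also have "\<dots> = c k / l k * trig_square T k" using kn by simp
  finally have val: "(LINT t|lborel. F t * trig_basis T k t) = c k / l k * trig_square T k" .
  define h where "h = sqrt b * (trig_square T k / l k)"
  have h: "0 < h" using b l[of k] T by (simp add: h_def trig_square_def)
  have "(\<bar>c k\<bar> * h)\<^sup>2 = b * (c k / l k * trig_square T k)\<^sup>2"
    using b by (simp add: h_def power_mult_distrib power_divide)
  also have "\<dots> \<le> (norm (J F))\<^sup>2" using low unfolding val .
  finally have "\<bar>c k\<bar> * h \<le> norm (J F)" by (rule power2_le_imp_le) simp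
  then have "\<bar>c k\<bar> \<le> (1 / h) * norm (J F)" using h by (simp add: field_simps)
  then show "\<bar>c k\<bar> \<le> (1 / (sqrt (cos_int (trig_freq k) / T) * (trig_square T k / sqrt (lam (trig_freq k))))) * norm (\<Sum>i<n. c i *\<^sub>R x i)"
    unfolding JF h_def b_def l_def .
qed

lemma inner_x: "inner (x i) (x j) = gram i j / (sqrt (lam (trig_freq i)) * sqrt (lam (trig_freq j)))"
  by (simp add: x_def inner_trig)

text \<open>Passing from indices to frequencies costs a factor 2 in each variable, hence
  \<open>4 * M\<close>.\<close>

lemma x_gram: "\<exists>M. \<forall>n. (\<Sum>i<n. \<Sum>j<n. (inner (x i) (x j) - of_bool (i = j))\<^sup>2) \<le> M"
proof -
  obtain K where K: "0 \<le> K" "\<And>i j. (gram i j / (sqrt (lam (trig_freq i)) * sqrt (lam (trig_freq j))) - of_bool (i = j))\<^sup>2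
     \<le> K * divided_diff_square \<alpha> sin_seq (trig_freq i) (trig_freq j)"
    using normalized_gram_bound by blast
  obtain C where C: "0 \<le> C" "\<And>k. \<bar>sin_seq k\<bar> \<le> C * log2 k powr (- \<alpha>)"
    "\<And>j k. k < j \<Longrightarrow> \<bar>sin_seq j - sin_seq k\<bar> / (real j - real k)
      \<le> C * log2 k powr (- \<alpha>) / real j + C / ((real k + 1) * (real j - real k))"
    using sin_seq_bounds unfolding log2_def by blast
  obtain M where M: "\<And>n. (\<Sum>j<n. \<Sum>k<n. divided_diff_square \<alpha> sin_seq j k) \<le> M"
    using divided_diff_square_summable[OF \<alpha> C] by blast
  have nonneg: "0 \<le> divided_diff_square \<alpha> sin_seq j k" for j k by (simp add: divided_diff_square_def)
  have "(\<Sum>i<n. \<Sum>j<n. (inner (x i) (x j) - of_bool (i = j))\<^sup>2) \<le> K * (4 * M)" for n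
  proof -
    have "(\<Sum>i<n. \<Sum>j<n. (inner (x i) (x j) - of_bool (i = j))\<^sup>2)
        \<le> (\<Sum>i<n. \<Sum>j<n. K * divided_diff_square \<alpha> sin_seq (trig_freq i) (trig_freq j))"
      unfolding inner_x by (intro sum_mono K(2))
    also have "\<dots> = K * (\<Sum>i<n. \<Sum>j<n. divided_diff_square \<alpha> sin_seq (trig_freq i) (trig_freq j))"
      by (simp only: sum_distrib_left)
    also have "\<dots> \<le> K * (4 * M)"
    proof (rule mult_left_mono[OF _ K(1)])
      have "(\<Sum>i<n. \<Sum>j<n. divided_diff_square \<alpha> sin_seq (trig_freq i) (trig_freq j))
          \<le> (\<Sum>i<n. 2 * (\<Sum>k<n. divided_diff_square \<alpha> sin_seq (trig_freq i) k))"
        by (intro sum_mono sum_trig_freq_le nonneg)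
      also have "\<dots> \<le> 2 * (\<Sum>j<n. 2 * (\<Sum>k<n. divided_diff_square \<alpha> sin_seq j k))"
        by (intro sum_trig_freq_le mult_nonneg_nonneg sum_nonneg nonneg) simp
      also have "\<dots> = 4 * (\<Sum>j<n. \<Sum>k<n. divided_diff_square \<alpha> sin_seq j k)"
        by (simp add: sum_distrib_left)
      also have "\<dots> \<le> 4 * M" using M[of n] by simp
      finally show "(\<Sum>i<n. \<Sum>j<n. divided_diff_square \<alpha> sin_seq (trig_freq i) (trig_freq j)) \<le> 4 * M" .
    qed
    finally show ?thesis .
  qed
  then show ?thesis by blast
qed

section \<open>Complex exponentials in terms of the real system\<close>

lemma Re_X: "(\<lambda>t. Re (X T k t)) = trig_fun T (2 * nat \<bar>k\<bar>)"
proof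
  fix t
  have "2 * of_real pi * \<i> * of_int k * of_real t / of_real T = \<i> * of_real (2 * pi * of_int k * t / T)"
    by simp
  then have "exp (2 * of_real pi * \<i> * of_int k * of_real t / of_real T) = cis (2 * pi * of_int k * t / T)"
    by (simp only: cis_conv_exp)
  then have "Re (X T k t) = indicator {0<..<T} t * cos (2 * pi * of_int k * t / T)"
    by (simp add: X_def indicator_def)
  moreover have "cos (2 * pi * of_int k * t / T) = cos (2 * pi * real (nat \<bar>k\<bar>) * t / T)"
    using cos_minus[of "2 * pi * of_int k * t / T"] by (cases "0 \<le> k") simp_all
  ultimately show "Re (X T k t) = trig_fun T (2 * nat \<bar>k\<bar>) t"
    by (simp add: trig_fun_def trig_basis_simps)
qed

text \<open>At \<open>k = 0\<close> the truncated index is 0, a cosine, but the factor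
  \<open>sgn k\<close> is 0; a negative \<open>k\<close> only changes the sign.\<close>

lemma Im_X: "(\<lambda>t. Im (X T k t)) = (\<lambda>t. of_int (sgn k) * trig_fun T (2 * nat \<bar>k\<bar> - 1) t)"
proof
  fix t
  have "2 * of_real pi * \<i> * of_int k * of_real t / of_real T = \<i> * of_real (2 * pi * of_int k * t / T)"
    by simp
  then have "exp (2 * of_real pi * \<i> * of_int k * of_real t / of_real T) = cis (2 * pi * of_int k * t / T)"
    by (simp only: cis_conv_exp)
  then have im: "Im (X T k t) = indicator {0<..<T} t * sin (2 * pi * of_int k * t / T)"
    by (simp add: X_def indicator_def)
  show "Im (X T k t) = of_int (sgn k) * trig_fun T (2 * nat \<bar>k\<bar> - 1) t"
  proof (cases "k = 0")
    case False
    define m where "m = nat \<bar>k\<bar> - 1"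
    have m: "2 * nat \<bar>k\<bar> - 1 = Suc (2 * m)" "1 + real m = \<bar>of_int k\<bar>" using False by (simp_all add: m_def of_nat_diff)
    have "of_int (sgn k) * sin (2 * pi * \<bar>of_int k\<bar> * t / T) = sin (2 * pi * of_int k * t / T)"
      using False by (cases "0 < k") (simp_all add: abs_if)
    then show ?thesis
      unfolding im m trig_fun_def trig_basis_simps using m(2) by (simp add: mult.left_commute)
  qed (use im in simp)
qed

text \<open>The norm makes the real system orthogonal, with equal squares for cosine and sine of the
  same frequency. For \<open>k\<close> against \<open>- k\<close> the real part is the difference of
  these squares; in all other cases each term vanishes by itself.\<close>

lemma exists_admissible_norm:
  "\<exists>N\<in>(admissible_norms :: ('h \<Rightarrow> real) set). \<forall>j k :: int. j \<noteq> k \<longrightarrow>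
    hermitian_extension (norm_scalar_product N) (complexify J (X T j)) (complexify J (X T k)) = 0"
proof -
  obtain M where M: "\<And>n. (\<Sum>i<n. \<Sum>j<n. (inner (x i) (x j) - of_bool (i = j))\<^sup>2) \<le> M" using x_gram by blast
  obtain N where N: "N \<in> (admissible_norms :: ('h \<Rightarrow> real) set)"
    and on: "\<And>i j. norm_scalar_product N (x i) (x j) = of_bool (i = j)"
    using near_orthonormal_admissible[OF x_dense M x_independent] by blast
  have "separable_hilbert_norm N" using N by (simp add: admissible_norms_def FHS_equivalent_def)
  then obtain ip where ip: "is_inner_product ip" and nsp: "norm_scalar_product N = ip"
    unfolding separable_hilbert_norm_def using norm_scalar_product_unique by blast
  have scale: "ip (r *\<^sub>R u) v = r * ip u v" "ip u (r *\<^sub>R v) = r * ip u v" for r u v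
    using ip unfolding is_inner_product_def by metis+
  define e where "e i = J (trig_fun T i)" for i
  have ip_e: "ip (e i) (e j) = (if i = j then lam (trig_freq i) else 0)" for i j
    using on[of i j] lam_pos[of "trig_freq i"] unfolding nsp e_def J_trig by (cases "i = j") (simp_all add: scale)
  have cX: "complexify J (X T k) = (e (2 * nat \<bar>k\<bar>), of_int (sgn k) *\<^sub>R e (2 * nat \<bar>k\<bar> - 1))" for k
    unfolding complexify_def Re_X Im_X e_def by (simp add: J_scale[OF trig_fun_in_L2])
  have "hermitian_extension (norm_scalar_product N) (complexify J (X T j)) (complexify J (X T k)) = 0"
    if jk: "j \<noteq> k" for j k
  proof -
    define m n where "m = nat \<bar>j\<bar>" and "n = nat \<bar>k\<bar>"
    have re: "ip (e (2 * m)) (e (2 * n)) + of_int (sgn j) * of_int (sgn k) * ip (e (2 * m - 1)) (e (2 * n - 1)) = 0"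
    proof (cases "m = n")
      case True
      then have "j = - k" "j \<noteq> 0" using jk by (auto simp: m_def n_def)
      then have s: "sgn j * sgn k = - 1" by (auto simp: sgn_if)
      have "m \<noteq> 0" using \<open>j \<noteq> 0\<close> by (simp add: m_def)
      then have "trig_freq (2 * m) = m" "trig_freq (2 * m - 1) = m" by (simp_all add: trig_freq_def)
      then show ?thesis using True s by (simp add: ip_e flip: of_int_mult)
    next
      case False
      show ?thesis
      proof (cases "j = 0 \<or> k = 0")
        case True
        then show ?thesis using False by (auto simp: ip_e)
      next
        case nz: False
        then have "m \<noteq> 0" "n \<noteq> 0" by (simp_all add: m_def n_def)
        then have "2 * m - 1 \<noteq> 2 * n - 1" using False by presburger
        then show ?thesis using False by (simp add: ip_e)
      qed
    qed
    \<comment> \<open>Sine and cosine indices differ in parity, except that truncated subtraction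
      makes \<open>2 * a - 1\<close> even at \<open>a = 0\<close>, where the sign factor is
      0.\<close>
    have odd: "of_int (sgn i) * ip (e (2 * nat \<bar>i\<bar> - 1)) (e (2 * p)) = 0"
      "of_int (sgn i) * ip (e (2 * p)) (e (2 * nat \<bar>i\<bar> - 1)) = 0" for i :: int and p
    proof -
      have "a = 0 \<or> 2 * a - 1 \<noteq> 2 * p" for a :: nat by presburger
      from this[of "nat \<bar>i\<bar>"] have "i = 0 \<or> 2 * nat \<bar>i\<bar> - 1 \<noteq> 2 * p" by simp
      then show "of_int (sgn i) * ip (e (2 * nat \<bar>i\<bar> - 1)) (e (2 * p)) = 0"
        "of_int (sgn i) * ip (e (2 * p)) (e (2 * nat \<bar>i\<bar> - 1)) = 0" by (auto simp: ip_e)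
    qed
    have eq0: "Complex (a + s * (r * w)) (r * u - s * v) = 0"
      if "a + r * s * w = 0" "r * u = 0" "s * v = 0" for a r s u v w
      using that(1) unfolding that(2,3) by (simp add: complex_eq_iff mult.left_commute mult.assoc)
    have "Complex (ip (e (2 * m)) (e (2 * n)) + of_int (sgn k) * (of_int (sgn j) * ip (e (2 * m - 1)) (e (2 * n - 1))))
      (of_int (sgn j) * ip (e (2 * m - 1)) (e (2 * n)) - of_int (sgn k) * ip (e (2 * m)) (e (2 * n - 1))) = 0"
      using odd(1)[of j n] odd(2)[of k m] by (intro eq0 re) (simp_all only: m_def n_def)
    then show ?thesis
      unfolding hermitian_extension_def cX nsp fst_conv snd_conv scale m_def n_def
      by (simp only: mult.left_commute)
  qed
  then show ?thesis using N by blast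
qed

end

theorem proposition9p9:
  fixes \<alpha> T :: real and B :: "real \<Rightarrow> real"
    and J :: "(real \<Rightarrow> real) \<Rightarrow> 'h::{real_inner, complete_space}"
  assumes "1 < \<alpha>"
    and "\<forall>t. t \<noteq> 0 \<longrightarrow> B (- t) = B t"
    and "\<forall>t>0. 0 \<le> B t"
    and "antimono_on {0<..} B"
    and "convex_on {0<..} B"
    and "\<exists>\<epsilon>>0. \<forall>t\<in>{0<..<\<epsilon>}. B t = 1 / (t * ln (1 / t) powr \<alpha>)"
    and "0 < T"
    and "is_G B T J"
  shows "\<exists>N\<in>(admissible_norms :: ('h \<Rightarrow> real) set). \<forall>j k :: int. j \<noteq> k \<longrightarrow>
    hermitian_extension (norm_scalar_product N) (complexify J (X T j)) (complexify J (X T k)) = 0"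
proof -
  obtain \<epsilon> where \<epsilon>: "0 < \<epsilon>" "\<And>t. 0 < t \<Longrightarrow> t < \<epsilon> \<Longrightarrow> B t = 1 / (t * ln (1 / t) powr \<alpha>)"
    using assms(6) by auto
  \<comment> \<open>\<open>\<epsilon> / 2\<close> because the formula for \<open>B\<close> must hold
    up to and including \<open>\<delta>\<close>; the other two entries are the smallness conditions
    of the locale.\<close>
  define \<delta> where "\<delta> = min (\<epsilon> / 2) (min (T / 2) (exp (- 2 * (\<alpha> + 1))))"
  interpret log_kernel_space \<alpha> T \<delta> B J
  proof
    show "B t = 1 / (t * (- ln t) powr \<alpha>)" if "0 < t" "t \<le> \<delta>" for t
    proof -
      have "\<delta> \<le> \<epsilon> / 2" by (simp add: \<delta>_def)
      then have "t < \<epsilon>" using that(2) \<epsilon>(1) by linarith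
      then show ?thesis using \<epsilon>(2)[of t] that by (simp add: ln_div)
    qed
    show "B t \<le> B s" if "0 < s" "s \<le> t" for s t
      using assms(4) that by (auto simp: monotone_on_def)
  qed (use assms \<epsilon>(1) in \<open>auto simp: \<delta>_def\<close>)
  show ?thesis by (rule exists_admissible_norm)
qed

end
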